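(* Under Assumptions (A1), (A2), (A3), let $(J_t)_{t\ge 0}$ be generated by the optimistic policy iteration algorithm described in the context, with either step-size choice $\gamma_t(i)=\beta(t)$ or $\gamma_t(i)=\beta(n_t(i))$. Then $J_t\to J^*$ almost surely, i.e. $J_t(i)\to J^*(i)$ almost surely for every $i\in S$.
   Context: Let $\alpha\in(0,1)$ and let $X$ be a Markov decision process with finite state space $S=\{1,\dots,n\}$, finite nonempty action sets $\mathcal A(i)$ ($i\in S$), transition probabilities $P_{ij}(u)$ ($u\in\mathcal A(i)$) and deterministic costs $c(i,u)\ge 0$. A policy is a map $\mu$ with $\mu(i)\in\mathcal A(i)$ for all $i$; it induces a Markov chain $X^\mu=(X^\mu_k)_{k\ge0}$ on $S$ with transition probabilities $P(X^\mu_{k+1}=j\mid X^\mu_k=i)=P_{ij}(\mu(i))$. The value of $\mu$ is $J^\mu(i)=\mathbb E\big[\sum_{k\ge0}\alpha^k c(X^\mu_k,\mu(X^\mu_k))\mid X^\mu_0=i\big]$, and $J^*(i)=\min_\mu J^\mu(i)$; $J^*$ is the unique solution of $J^*(i)=\min_{u\in\mathcal A(i)}[c(i,u)+\alpha\sum_j P_{ij}(u)J^*(j)]$. A fixed probability distribution $p$ on $S$ is used as the initial distribution for all policies, and $q_\mu(i)$ denotes the probability that $X^\mu$ with $X^\mu_0\sim p$ ever visits $i$ (i.e. $X^\mu_k=i$ for some $k\ge0$). Assumption (A1): $q_\mu(i)>0$ for every policy $\mu$ and every $i\in S$ (hence there is $\delta>0$ with $q_\mu(i)\ge\delta$ for all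 $\mu,i$). Assumption (A2): for all $i,j\in S$ and $u,v\in\mathcal A(i)$, $P_{ij}(u)>0$ iff $P_{ij}(v)>0$. The reachability graph is the directed graph $G=(S,E)$ with $E=\{(i,j):P_{ij}(u)>0 \text{ for some } u\in\mathcal A(i)\}$. By (A2) the decomposition $S=\mathcal T\sqcup\mathcal R_1\sqcup\dots\sqcup\mathcal R_m$ into transient states $\mathcal T$ and closed irreducible recurrent classes $\mathcal R_1,\dots,\mathcal R_m$ is the same for every policy. Assumption (A3): the subgraph of $G$ induced by $\mathcal T$ is acyclic. Algorithm: set $J_0=0$. At iteration $t=0,1,2,\dots$: choose a greedy policy $\mu_t$ with respect to $J_t$, i.e. $\mu_t(i)\in\arg\min_{u\in\mathcal A(i)}[c(i,u)+\alpha\sum_jP_{ij}(u)J_t(j)]$ for each $i$; independently of the past, draw $X_0^{\mu_t}\sim p$ and simulate a trajectory $(X^{\mu_t}_k)_{k\ge0}$ of the chain under $\mu_t$. Let $N_t(i)=\inf\{k: X^{\mu_t}_k=i\}$ and, when $N_t(i)<\infty$, $\tilde J^{\mu_t}(i)=\sum_{k\ge N_t(i)}\alpha^{k-N_t(i)}c(X^{\mu_t}_k,\mu_t(X^{\mu_t}_k))$ (and $\tilde J^{\mu_t}(i)=0$ otherwise). Then for each $i$: $J_{t+1}(i)=(1-\gamma_t(i))J_t(i)+\gamma_t(i)\tilde J^{\mu_t}(i)$ if the trajectory visits $i$ (i.e. $N_t(i)<\infty$), and $J_{t+1}(i)=J_t(i)$ otherwise. Step sizes: $\beta:\mathbb N\to(0,1]$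 is deterministic with $\sum_t\beta(t)=\infty$, $\sum_t\beta(t)^2<\infty$, and $\beta$ nonincreasing for $t>T_0$ for some constant $T_0$. Either $\gamma_t(i)=\beta(t)$, or $\gamma_t(i)=\beta(n_t(i))$ where $n_t(i)=\sum_{\tau<t}\mathbf 1\{\text{the trajectory at iteration }\tau\text{ visits } i\}$. *)

theory Defs
  imports "HOL-Probability.Probability"
begin

text \<open>States are the elements of a finite type 's; actions have type 'a.
  A :: 's => 'a set  (admissible actions), P i u j = P_ij(u), c i u = cost.\<close>

definition is_policy :: "('s \<Rightarrow> 'a set) \<Rightarrow> ('s \<Rightarrow> 'a) \<Rightarrow> bool" where
  "is_policy A mu \<longleftrightarrow> (\<forall>i. mu i \<in> A i)"

fun nstep :: "('s::finite \<Rightarrow> 'a \<Rightarrow> 's \<Rightarrow> real) \<Rightarrow> ('s \<Rightarrow> 'a) \<Rightarrow> nat \<Rightarrow> 's \<Rightarrow> 's \<Rightarrow> real" where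
  "nstep P mu 0 i j = (if i = j then 1 else 0)"
| "nstep P mu (Suc k) i j = (\<Sum>l\<in>UNIV. nstep P mu k i l * P l (mu l) j)"

text \<open>Value of a policy: E[sum_k alpha^k c(X_k, mu(X_k)) | X_0 = i], written out.\<close>
definition Jmu :: "real \<Rightarrow> ('s::finite \<Rightarrow> 'a \<Rightarrow> 's \<Rightarrow> real) \<Rightarrow> ('s \<Rightarrow> 'a \<Rightarrow> real)
                    \<Rightarrow> ('s \<Rightarrow> 'a) \<Rightarrow> 's \<Rightarrow> real" where
  "Jmu \<alpha> P c mu i = (\<Sum>k. \<alpha> ^ k * (\<Sum>j\<in>UNIV. nstep P mu k i j * c j (mu j)))"

definition Jstar :: "('s::finite \<Rightarrow> 'a set) \<Rightarrow> real \<Rightarrow> ('s \<Rightarrow> 'a \<Rightarrow> 's \<Rightarrow> real)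
                    \<Rightarrow> ('s \<Rightarrow> 'a \<Rightarrow> real) \<Rightarrow> 's \<Rightarrow> real" where
  "Jstar A \<alpha> P c i = Min {Jmu \<alpha> P c mu i | mu. is_policy A mu}"

fun hitprob :: "('s::finite \<Rightarrow> 'a \<Rightarrow> 's \<Rightarrow> real) \<Rightarrow> ('s \<Rightarrow> 'a) \<Rightarrow> nat \<Rightarrow> 's \<Rightarrow> 's \<Rightarrow> real" where
  "hitprob P mu 0 i j = (if j = i then 1 else 0)"
| "hitprob P mu (Suc K) i j =
     (if j = i then 1 else (\<Sum>l\<in>UNIV. P j (mu j) l * hitprob P mu K i l))"

definition qvisit :: "('s::finite \<Rightarrow> real) \<Rightarrow> ('s \<Rightarrow> 'a \<Rightarrow> 's \<Rightarrow> real) \<Rightarrow> ('s \<Rightarrow> 'a) \<Rightarrow> 's \<Rightarrow> real" where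
  "qvisit p P mu i = (\<Sum>j\<in>UNIV. p j * lim (\<lambda>K. hitprob P mu K i j))"

text \<open>Reachability graph, recurrent/transient states (graph-theoretic, valid under (A2)).\<close>
definition reach_graph :: "('s \<Rightarrow> 'a set) \<Rightarrow> ('s \<Rightarrow> 'a \<Rightarrow> 's \<Rightarrow> real) \<Rightarrow> ('s \<times> 's) set" where
  "reach_graph A P = {(i, j). \<exists>u\<in>A i. P i u j > 0}"

definition transient_states :: "('s \<Rightarrow> 'a set) \<Rightarrow> ('s \<Rightarrow> 'a \<Rightarrow> 's \<Rightarrow> real) \<Rightarrow> 's set" where
  "transient_states A P =
     {i. \<exists>j. (i, j) \<in> (reach_graph A P)\<^sup>* \<and> (j, i) \<notin> (reach_graph A P)\<^sup>*}"

definition greedy :: "('s::finite \<Rightarrow> 'a set) \<Rightarrow> real \<Rightarrow> ('s \<Rightarrow> 'a \<Rightarrow> 's \<Rightarrow> real)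
                      \<Rightarrow> ('s \<Rightarrow> 'a \<Rightarrow> real) \<Rightarrow> ('s \<Rightarrow> real) \<Rightarrow> ('s \<Rightarrow> 'a) \<Rightarrow> bool" where
  "greedy A \<alpha> P c J mu \<longleftrightarrow>
     (\<forall>i. mu i \<in> A i \<and>
        (\<forall>u\<in>A i. c i (mu i) + \<alpha> * (\<Sum>j\<in>UNIV. P i (mu i) j * J j)
                 \<le> c i u + \<alpha> * (\<Sum>j\<in>UNIV. P i u j * J j)))"

section \<open>The optimistic policy iteration recursion (for one fixed sample path)\<close>

definition visits :: "(nat \<Rightarrow> 's) \<Rightarrow> 's \<Rightarrow> bool" where
  "visits x i \<longleftrightarrow> (\<exists>k. x k = i)"

definition first_visit :: "(nat \<Rightarrow> 's) \<Rightarrow> 's \<Rightarrow> nat" where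
  "first_visit x i = (LEAST k. x k = i)"

definition tail_cost :: "real \<Rightarrow> ('s \<Rightarrow> 'a \<Rightarrow> real) \<Rightarrow> (nat \<Rightarrow> 's) \<Rightarrow> ('s \<Rightarrow> 'a) \<Rightarrow> 's \<Rightarrow> real" where
  "tail_cost \<alpha> c x mu i =
     (if visits x i
      then (\<Sum>k. \<alpha> ^ k * c (x (first_visit x i + k)) (mu (x (first_visit x i + k))))
      else 0)"

definition step_size :: "(nat \<Rightarrow> real) \<Rightarrow> bool \<Rightarrow> (nat \<Rightarrow> nat \<Rightarrow> 's) \<Rightarrow> nat \<Rightarrow> 's \<Rightarrow> real" where
  "step_size \<beta> cnt X t i =
     (if cnt then \<beta> (card {\<tau>. \<tau> < t \<and> visits (X \<tau>) i}) else \<beta> t)"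

text \<open>X \<tau> is the trajectory simulated at iteration \<tau>, mu \<tau> the policy used there.\<close>
primrec opiJ :: "real \<Rightarrow> ('s \<Rightarrow> 'a \<Rightarrow> real) \<Rightarrow> (nat \<Rightarrow> real) \<Rightarrow> bool
                 \<Rightarrow> (nat \<Rightarrow> nat \<Rightarrow> 's) \<Rightarrow> (nat \<Rightarrow> 's \<Rightarrow> 'a) \<Rightarrow> nat \<Rightarrow> 's \<Rightarrow> real" where
  "opiJ \<alpha> c \<beta> cnt X mu 0 = (\<lambda>i. 0)"
| "opiJ \<alpha> c \<beta> cnt X mu (Suc t) =
     (\<lambda>i. if visits (X t) i
          then (1 - step_size \<beta> cnt X t i) * opiJ \<alpha> c \<beta> cnt X mu t i
               + step_size \<beta> cnt X t i * tail_cost \<alpha> c (X t) (mu t) i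
          else opiJ \<alpha> c \<beta> cnt X mu t i)"

end

theory Submission
  imports Defs
begin

text \<open>
  On a closed recurrent class all states are visited in the same iterations and hence carry the same
  step sizes, so there \<open>J\<^sub>t\<close> follows a synchronous recursion: the Bellman residual \<open>T J\<^sub>t - J\<^sub>t\<close>
  satisfies a stochastic recursion whose limsup is at most 0. A nonpositive residual gives
  \<open>J\<^sup>\<mu> \<le> T J\<^sub>t\<close> in the limit, and contraction of \<open>T\<close> together with \<open>J\<^sup>\<mu> \<ge> J\<^sup>*\<close> yields convergence.
  Transient states follow by induction along the acyclic graph, since the values of all
  successors, both iterated and exact, have already converged. The noise enters as a series of
  martingale differences that is bounded in \<open>L\<^sup>2\<close>, hence summable almost surely.
\<close>

section \<open>Stochastic recursions\<close>

text \<open>A common step size is what makes the residual tractable: the Bellman operator averages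
  over successors, and the factor \<open>1 - g\<close> can be pulled out of that average only if all
  successors carry the step of the state itself. From a transient state this may fail, and
  acyclicity replaces the argument there. The probabilistic difficulty is that the estimate of one
  iteration reads an infinite trajectory, while the law is given for finite paths only. The sampling
  error is therefore written as the limit of a sum of temporal differences, each centered by the
  Bellman equation of the current policy. The residual multiplies the noise by transition
  probabilities of the current, random policy, so summability is needed for noise with weights known
  before the trajectory is drawn. The bound on the variances holds path by path: noise lives only on
  visits, and the squared steps at visits sum to at most the series of squares of
  \<open>\<beta>\<close>. Divergence of the steps at visits comes from (A1): finitely many policies
  give one horizon and one positive lower bound for the probability of a visit within it.\<close>

lemma not_summable_imp_at_top:
  fixes g :: "nat \<Rightarrow> real"
  assumes "\<And>t. 0 \<le> g t" "\<not> summable g"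
  shows "filterlim (\<lambda>n. \<Sum>k<n. g k) at_top sequentially"
proof -
  have inc: "incseq (\<lambda>n. \<Sum>k<n. g k)"
    using assms(1) by (intro incseq_SucI) simp
  show ?thesis
    unfolding filterlim_at_top
  proof
    fix B :: real
    show "eventually (\<lambda>n. B \<le> (\<Sum>k<n. g k)) sequentially"
    proof (rule ccontr)
      assume a: "\<not> ?thesis"
      have "(\<Sum>k<n. g k) \<le> B" for n
      proof (rule ccontr)
        assume "\<not> ?thesis"
        then have "\<forall>m\<ge>n. B \<le> (\<Sum>k<m. g k)"
          using inc by (meson incseqD le_less_trans linear not_less order.trans)
        then show False using a by (auto simp: eventually_sequentially)
      qed
      then have "summable g"
        by (intro bounded_imp_summable[of g B]) (use assms(1) in \<open>auto simp: lessThan_Suc_atMost[symmetric] simp del: sum.lessThan_Suc\<close>)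
      then show False using assms(2) by blast
    qed
  qed
qed

text \<open>Since \<open>1 - g <= exp (- g)\<close>, the iterates are dominated by
  \<open>exp\<close> of minus a divergent sum.\<close>

lemma contraction_to_zero:
  fixes y g :: "nat \<Rightarrow> real"
  assumes y: "\<And>t. 0 \<le> y t" "\<And>t. t \<ge> T \<Longrightarrow> y (Suc t) \<le> (1 - g t) * y t"
    and g: "\<And>t. 0 \<le> g t" "\<not> summable g"
  shows "y \<longlonglongrightarrow> 0"
proof -
  have b: "y (n + T) \<le> y T * exp (- (\<Sum>k<n. g (k + T)))" for n
  proof (induction n)
    case (Suc n)
    have "y (Suc n + T) \<le> (1 - g (n + T)) * y (n + T)"
      using y(2)[of "n + T"] by simp
    also have "\<dots> \<le> exp (- g (n + T)) * y (n + T)"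
      using exp_ge_add_one_self[of "- g (n + T)"] y(1) by (intro mult_right_mono) auto
    also have "\<dots> \<le> exp (- g (n + T)) * (y T * exp (- (\<Sum>k<n. g (k + T))))"
      using Suc by (intro mult_left_mono) auto
    also have "\<dots> = y T * exp (- (\<Sum>k<Suc n. g (k + T)))"
      by (simp add: mult_exp_exp mult.left_commute)
    finally show ?case .
  qed simp
  have "\<not> summable (\<lambda>k. g (k + T))"
    using g(2) summable_iff_shift[of g T] by simp
  then have "filterlim (\<lambda>n. \<Sum>k<n. g (k + T)) at_top sequentially"
    using g(1) by (intro not_summable_imp_at_top) auto
  then have "(\<lambda>n. exp (- (\<Sum>k<n. g (k + T)))) \<longlonglongrightarrow> 0"
    by (intro filterlim_compose[OF exp_at_bot] filterlim_compose[OF filterlim_uminus_at_bot_at_top])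
  then have "(\<lambda>n. y T * exp (- (\<Sum>k<n. g (k + T)))) \<longlonglongrightarrow> 0"
    using tendsto_mult_right_zero by blast
  then have "(\<lambda>n. y (n + T)) \<longlonglongrightarrow> 0"
    by (rule tendsto_sandwich[OF _ _ tendsto_const, rotated 2]) (use b y(1) in auto)
  then show ?thesis by (rule LIMSEQ_offset)
qed

text \<open>Steps with divergent sum forget the initial value, and a convergent noise series has
  vanishing tails, so only the eventual bound on the targets \<open>r\<close> survives. That bound
  is one-sided because the targets, values of changing policies, are not known to converge
  beforehand.\<close>

lemma stochastic_recursion_upper:
  fixes x g r d :: "nat \<Rightarrow> real"
  assumes rec: "\<And>t. x (Suc t) \<le> (1 - g t) * x t + g t * r t + d t"
    and g: "\<And>t. 0 \<le> g t" "\<And>t. g t \<le> 1" "\<not> summable g"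
    and d: "summable d"
    and r: "eventually (\<lambda>t. r t \<le> \<rho>) sequentially"
    and e: "0 < \<epsilon>"
  shows "eventually (\<lambda>t. x t \<le> \<rho> + \<epsilon>) sequentially"
proof -
  \<comment> \<open>Adding the tail of the noise series to \<open>x\<close> removes the noise from the recursion.\<close>
  define R where "R t = suminf d - (\<Sum>s<t. d s)" for t
  have R_Suc: "R (Suc t) = R t - d t" for t
    by (simp add: R_def)
  have "R \<longlonglongrightarrow> suminf d - suminf d"
    unfolding R_def by (intro tendsto_intros summable_LIMSEQ d)
  then have R0: "R \<longlonglongrightarrow> 0" by simp
  have Re: "eventually (\<lambda>t. \<bar>R t\<bar> < \<epsilon> / 4) sequentially"
    using tendstoD[OF R0, of "\<epsilon> / 4"] e by (simp add: dist_real_def)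
  obtain T where T: "\<And>t. t \<ge> T \<Longrightarrow> r t \<le> \<rho> \<and> \<bar>R t\<bar> < \<epsilon> / 4"
    using eventually_conj[OF r Re] by (auto simp: eventually_sequentially)
  \<comment> \<open>The cut-off at 0 provides the nonnegativity that
    \<open>contraction_to_zero\<close> needs. Of the slack, \<open>\<epsilon> / 2\<close> goes into
    the threshold, a quarter to \<open>y\<close> and a quarter to \<open>R\<close>.\<close>
  define y where "y t = max 0 (x t + R t - (\<rho> + \<epsilon> / 2))" for t
  have "y (Suc t) \<le> (1 - g t) * y t" if "t \<ge> T" for t
  proof -
    have "x (Suc t) + R (Suc t) \<le> (1 - g t) * (x t + R t) + g t * (r t + R t)"
      using rec[of t] by (simp add: R_Suc algebra_simps)
    also have "\<dots> \<le> (1 - g t) * (x t + R t) + g t * (\<rho> + \<epsilon> / 2)"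
      using T[OF that] g(1)[of t] e by (intro add_left_mono mult_left_mono) auto
    finally have "x (Suc t) + R (Suc t) - (\<rho> + \<epsilon> / 2)
        \<le> (1 - g t) * (x t + R t - (\<rho> + \<epsilon> / 2))"
      by (simp add: field_simps)
    also have "\<dots> \<le> (1 - g t) * y t"
      using g(2)[of t] by (intro mult_left_mono) (auto simp: y_def)
    finally show ?thesis using g(2)[of t] by (simp add: y_def)
  qed
  then have "y \<longlonglongrightarrow> 0"
    by (intro contraction_to_zero[of y T g] g) (auto simp: y_def)
  then have "eventually (\<lambda>t. y t < \<epsilon> / 4) sequentially"
    using e by (auto dest!: order_tendstoD(2)[of _ _ _ "\<epsilon> / 4"])
  then show ?thesis using Re
  proof eventually_elim
    case (elim t)
    have "x t + R t - (\<rho> + \<epsilon> / 2) \<le> y t" by (simp add: y_def)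
    then show ?case using elim by linarith
  qed
qed

lemma stochastic_recursion_lower:
  fixes x g r d :: "nat \<Rightarrow> real"
  assumes rec: "\<And>t. x (Suc t) \<ge> (1 - g t) * x t + g t * r t + d t"
    and g: "\<And>t. 0 \<le> g t" "\<And>t. g t \<le> 1" "\<not> summable g"
    and d: "summable d"
    and r: "eventually (\<lambda>t. \<rho> \<le> r t) sequentially"
    and e: "0 < \<epsilon>"
  shows "eventually (\<lambda>t. \<rho> - \<epsilon> \<le> x t) sequentially"
proof -
  have "eventually (\<lambda>t. - x t \<le> - \<rho> + \<epsilon>) sequentially"
  proof (rule stochastic_recursion_upper[where x = "\<lambda>t. - x t" and r = "\<lambda>t. - r t" and d = "\<lambda>t. - d t", OF _ g _ _ e])
    show "- x (Suc t) \<le> (1 - g t) * - x t + g t * - r t + - d t" for t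
      using rec[of t] by simp
    show "summable (\<lambda>t. - d t)" using d by (rule summable_minus)
    show "eventually (\<lambda>t. - r t \<le> - \<rho>) sequentially" using r by simp
  qed
  then show ?thesis by eventually_elim simp
qed

lemma finite_minimizer:
  fixes f :: "'b \<Rightarrow> real"
  assumes "finite S" "S \<noteq> {}"
  obtains x where "x \<in> S" "\<And>y. y \<in> S \<Longrightarrow> f x \<le> f y"
proof -
  have "Min (f ` S) \<in> f ` S" using assms by (intro Min_in) auto
  then show ?thesis using that assms Min_le[of "f ` S"] by fastforce
qed

text \<open>The counter increases exactly at visits, so \<open>f 0\<close>, \<open>f 1\<close>, ...
  are used once each. This converts sums of \<open>\<beta> (n_t(i))\<close> over visits into partial
  sums of \<open>\<beta>\<close>.\<close>

lemma sum_over_visits: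
  fixes f :: "nat \<Rightarrow> 'b::comm_monoid_add" and V :: "nat \<Rightarrow> bool"
  shows "(\<Sum>\<tau><t. if V \<tau> then f (card {\<sigma>. \<sigma> < \<tau> \<and> V \<sigma>}) else 0) = (\<Sum>n<card {\<sigma>. \<sigma> < t \<and> V \<sigma>}. f n)"
proof (induction t)
  case (Suc t)
  have "{\<sigma>. \<sigma> < Suc t \<and> V \<sigma>} = (if V t then insert t {\<sigma>. \<sigma> < t \<and> V \<sigma>} else {\<sigma>. \<sigma> < t \<and> V \<sigma>})"
    by (auto simp: less_Suc_eq)
  then show ?case using Suc by auto
qed simp

section \<open>Finite Markov decision processes\<close>

locale mdp =
  fixes A :: "'s::finite \<Rightarrow> 'a set"
    and P :: "'s \<Rightarrow> 'a \<Rightarrow> 's \<Rightarrow> real"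
    and c :: "'s \<Rightarrow> 'a \<Rightarrow> real"
    and \<alpha> :: real
  assumes alpha: "0 < \<alpha>" "\<alpha> < 1"
    and actions: "\<And>i. finite (A i)" "\<And>i. A i \<noteq> {}"
    and trans_nonneg: "\<And>i u j. u \<in> A i \<Longrightarrow> 0 \<le> P i u j"
    and trans_sum: "\<And>i u. u \<in> A i \<Longrightarrow> (\<Sum>j\<in>UNIV. P i u j) = 1"
    and cost_nonneg: "\<And>i u. u \<in> A i \<Longrightarrow> 0 \<le> c i u"
begin

abbreviation J :: "('s \<Rightarrow> 'a) \<Rightarrow> 's \<Rightarrow> real" where
  "J \<equiv> Jmu \<alpha> P c"

abbreviation Jopt :: "'s \<Rightarrow> real" where
  "Jopt \<equiv> Jstar A \<alpha> P c"

abbreviation E :: "('s \<times> 's) set" where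
  "E \<equiv> reach_graph A P"

text \<open>The Bellman operator T gets no name of its own: for a policy \<open>m\<close> greedy
  with respect to \<open>f\<close>, its value at \<open>i\<close> is
  \<open>Q f i (m i)\<close>.\<close>

definition Q :: "('s \<Rightarrow> real) \<Rightarrow> 's \<Rightarrow> 'a \<Rightarrow> real" where
  "Q f i u = c i u + \<alpha> * (\<Sum>j\<in>UNIV. P i u j * f j)"

definition cost_bound :: real where
  "cost_bound = Max (insert 0 (\<Union>i. c i ` A i))"

definition value_bound :: real where
  "value_bound = cost_bound / (1 - \<alpha>)"

lemma finite_policies: "finite {m. is_policy A m}"
proof -
  have "{m. is_policy A m} = Pi\<^sub>E UNIV A"
    by (auto simp: is_policy_def PiE_UNIV_domain)
  then show ?thesis using actions by (auto intro!: finite_PiE)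
qed

lemma policy_exists: "\<exists>m. is_policy A m"
  unfolding is_policy_def using actions(2) by (intro choice) auto

lemma cost_le: "u \<in> A i \<Longrightarrow> c i u \<le> cost_bound"
  unfolding cost_bound_def using actions by (intro Max_ge) auto

lemma cost_bound_nonneg: "0 \<le> cost_bound"
  unfolding cost_bound_def using actions by (intro Max_ge) auto

lemma value_bound_nonneg: "0 \<le> value_bound"
  unfolding value_bound_def using cost_bound_nonneg alpha by simp

text \<open>The bound on \<open>f\<close> is asked for only at states of positive probability, so
  the lemma applies when bounds are known only inside a closed class or on graph successors.\<close>

lemma avg_le:
  assumes "u \<in> A i" "\<And>j. P i u j > 0 \<Longrightarrow> f j \<le> b"
  shows "(\<Sum>j\<in>UNIV. P i u j * f j) \<le> b"
proof -
  have "(\<Sum>j\<in>UNIV. P i u j * f j) \<le> (\<Sum>j\<in>UNIV. P i u j * b)"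
  proof (intro sum_mono)
    fix j show "P i u j * f j \<le> P i u j * b"
      using trans_nonneg[OF assms(1), of j] assms(2)[of j]
      by (cases "P i u j > 0") auto
  qed
  also have "\<dots> = b"
    using trans_sum[OF assms(1)] by (simp add: sum_distrib_right[symmetric])
  finally show ?thesis .
qed

lemma avg_ge:
  assumes "u \<in> A i" "\<And>j. P i u j > 0 \<Longrightarrow> b \<le> f j"
  shows "b \<le> (\<Sum>j\<in>UNIV. P i u j * f j)"
  using avg_le[OF assms(1), of "\<lambda>j. - f j" "- b"] assms(2) by (simp add: sum_negf)

section \<open>Policy values, the Bellman equation and comparison\<close>

lemma nstep_props:
  assumes "is_policy A m"
  shows "0 \<le> nstep P m k i j" "(\<Sum>j\<in>UNIV. nstep P m k i j) = 1"
proof -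
  show "0 \<le> nstep P m k i j"
    using assms trans_nonneg
    by (induction k arbitrary: j) (auto intro!: sum_nonneg mult_nonneg_nonneg simp: is_policy_def)
  show "(\<Sum>j\<in>UNIV. nstep P m k i j) = 1"
  proof (induction k)
    case (Suc k)
    have "(\<Sum>j\<in>UNIV. nstep P m (Suc k) i j) = (\<Sum>l\<in>UNIV. nstep P m k i l * (\<Sum>j\<in>UNIV. P l (m l) j))"
      by (simp add: sum_distrib_left) (rule sum.swap)
    also have "\<dots> = 1" using assms Suc trans_sum by (simp add: is_policy_def)
    finally show ?case .
  qed simp
qed

text \<open>\<open>nstep\<close> is defined by splitting off the last step; the Bellman equation
  conditions on the first one.\<close>

lemma nstep_first_step:
  "nstep P m (Suc k) i j = (\<Sum>l\<in>UNIV. P i (m i) l * nstep P m k l j)"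
proof (induction k arbitrary: j)
  case 0
  then show ?case by (simp add: if_distrib[where f = "\<lambda>x. x * _"] if_distrib[where f = "\<lambda>x. _ * x"] cong: if_cong)
next
  case (Suc k)
  have "nstep P m (Suc (Suc k)) i j = (\<Sum>l\<in>UNIV. (\<Sum>l'\<in>UNIV. P i (m i) l' * nstep P m k l' l) * P l (m l) j)"
    using Suc by simp
  also have "\<dots> = (\<Sum>l'\<in>UNIV. P i (m i) l' * nstep P m (Suc k) l' j)"
    by (simp add: sum_distrib_left sum_distrib_right mult.assoc) (rule sum.swap)
  finally show ?case .
qed

definition stage_cost :: "('s \<Rightarrow> 'a) \<Rightarrow> nat \<Rightarrow> 's \<Rightarrow> real" where
  "stage_cost m k i = (\<Sum>j\<in>UNIV. nstep P m k i j * c j (m j))"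

lemma stage_cost_bounds:
  assumes "is_policy A m"
  shows "0 \<le> stage_cost m k i" "stage_cost m k i \<le> cost_bound"
proof -
  show "0 \<le> stage_cost m k i"
    unfolding stage_cost_def using assms nstep_props[OF assms] cost_nonneg
    by (auto intro!: sum_nonneg mult_nonneg_nonneg simp: is_policy_def)
  have "stage_cost m k i \<le> (\<Sum>j\<in>UNIV. nstep P m k i j * cost_bound)"
    unfolding stage_cost_def using assms nstep_props[OF assms] cost_le
    by (intro sum_mono mult_left_mono) (auto simp: is_policy_def)
  also have "\<dots> = cost_bound"
    using nstep_props(2)[OF assms] by (simp add: sum_distrib_right[symmetric])
  finally show "stage_cost m k i \<le> cost_bound" .
qed

lemma discounted_series:
  assumes "\<And>k. 0 \<le> f k" "\<And>k. f k \<le> cost_bound"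
  shows "summable (\<lambda>k. \<alpha> ^ k * f k)" "0 \<le> (\<Sum>k. \<alpha> ^ k * f k)" "(\<Sum>k. \<alpha> ^ k * f k) \<le> value_bound"
proof -
  have g: "summable (\<lambda>k. \<alpha> ^ k * cost_bound)"
    using alpha by (intro summable_mult2 summable_geometric) auto
  show s: "summable (\<lambda>k. \<alpha> ^ k * f k)"
    using alpha assms by (intro summable_comparison_test'[OF g, of 0]) (auto intro!: mult_left_mono)
  show "0 \<le> (\<Sum>k. \<alpha> ^ k * f k)"
    using assms alpha by (intro suminf_nonneg s) auto
  have "(\<Sum>k. \<alpha> ^ k * f k) \<le> (\<Sum>k. \<alpha> ^ k * cost_bound)"
    using alpha assms by (intro suminf_le s g mult_left_mono) auto
  also have "\<dots> = value_bound"
    using alpha by (simp add: suminf_mult2[symmetric] summable_geometric suminf_geometric value_bound_def)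
  finally show "(\<Sum>k. \<alpha> ^ k * f k) \<le> value_bound" .
qed

lemma J_bounds:
  assumes "is_policy A m"
  shows "0 \<le> J m i" "J m i \<le> value_bound"
  using discounted_series[of "\<lambda>k. stage_cost m k i"] stage_cost_bounds[OF assms]
  by (auto simp: Jmu_def stage_cost_def)

text \<open>The \<open>k = 0\<close> term is the immediate cost; in the rest, the first step is
  split off and the finite sum over its states is exchanged with the discounted series.\<close>

lemma J_Bellman:
  assumes m: "is_policy A m"
  shows "J m i = Q (J m) i (m i)"
proof -
  have s: "summable (\<lambda>k. \<alpha> ^ k * stage_cost m k i)" for i
    using discounted_series[of "\<lambda>k. stage_cost m k i"] stage_cost_bounds[OF m] by auto
  have J: "J m i = (\<Sum>k. \<alpha> ^ k * stage_cost m k i)" for i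
    by (simp add: Jmu_def stage_cost_def)
  have Suc: "stage_cost m (Suc k) i = (\<Sum>l\<in>UNIV. P i (m i) l * stage_cost m k l)" for k
  proof -
    have "stage_cost m (Suc k) i = (\<Sum>j\<in>UNIV. (\<Sum>l\<in>UNIV. P i (m i) l * nstep P m k l j) * c j (m j))"
      unfolding stage_cost_def nstep_first_step ..
    also have "\<dots> = (\<Sum>l\<in>UNIV. P i (m i) l * stage_cost m k l)"
      unfolding stage_cost_def
      by (simp add: sum_distrib_left sum_distrib_right mult.assoc) (rule sum.swap)
    finally show ?thesis .
  qed
  have "J m i = stage_cost m 0 i + (\<Sum>k. \<alpha> ^ Suc k * stage_cost m (Suc k) i)"
    unfolding J using suminf_split_head[OF s, of i] by simp
  also have "(\<Sum>k. \<alpha> ^ Suc k * stage_cost m (Suc k) i)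
      = (\<Sum>k. \<Sum>l\<in>UNIV. \<alpha> * P i (m i) l * (\<alpha> ^ k * stage_cost m k l))"
    unfolding Suc by (simp add: sum_distrib_left mult_ac)
  also have "\<dots> = (\<Sum>l\<in>UNIV. \<Sum>k. \<alpha> * P i (m i) l * (\<alpha> ^ k * stage_cost m k l))"
    by (intro suminf_sum summable_mult s)
  also have "\<dots> = (\<Sum>l\<in>UNIV. \<alpha> * P i (m i) l * J m l)"
    unfolding J by (intro sum.cong refl suminf_mult s)
  also have "stage_cost m 0 i = c i (m i)"
    by (simp add: stage_cost_def if_distrib[where f = "\<lambda>x. x * _"] cong: if_cong)
  finally show ?thesis by (simp add: Q_def sum_distrib_left mult_ac)
qed

text \<open>At a maximizer of \<open>e\<close> over the closed set \<open>R\<close> the average over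
  successors is at most the maximum itself, so \<open>1 - \<alpha>\<close> times the maximum is at
  most \<open>\<epsilon>\<close>. With \<open>R = UNIV\<close> this compares a function with the
  value of a policy; with the recurrent states it turns a small residual into a bound on
  \<open>J\<close>.\<close>

lemma discounted_max_principle:
  assumes m: "is_policy A m"
    and closed: "\<And>i j. i \<in> R \<Longrightarrow> P i (m i) j > 0 \<Longrightarrow> j \<in> R"
    and sub: "\<And>i. i \<in> R \<Longrightarrow> e i \<le> \<alpha> * (\<Sum>j\<in>UNIV. P i (m i) j * e j) + \<epsilon>"
    and i: "i \<in> R"
  shows "e i \<le> \<epsilon> / (1 - \<alpha>)"
proof -
  obtain k where k: "k \<in> R" "\<And>j. j \<in> R \<Longrightarrow> e j \<le> e k"
  proof -
    have "Max (e ` R) \<in> e ` R" using i by (intro Max_in) auto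
    then show ?thesis using that Max_ge[of "e ` R"] by fastforce
  qed
  have "(\<Sum>j\<in>UNIV. P k (m k) j * e j) \<le> e k"
    using m k closed by (intro avg_le) (auto simp: is_policy_def)
  then have "e k \<le> \<alpha> * e k + \<epsilon>"
    using sub[OF k(1)] alpha by (smt (verit) mult_left_mono)
  then have "e k \<le> \<epsilon> / (1 - \<alpha>)"
    using alpha by (simp add: field_simps)
  then show ?thesis using k(2)[OF i] by linarith
qed

lemma Q_diff: "Q f i u - Q f' i u = \<alpha> * (\<Sum>j\<in>UNIV. P i u j * (f j - f' j))"
  by (simp add: Q_def sum_subtractf right_diff_distrib)

text \<open>The difference \<open>f - J m\<close> is bounded by \<open>\<alpha>\<close> times its
  own average, so the maximum principle applies with \<open>\<epsilon> = 0\<close>.\<close>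

lemma le_J:
  assumes m: "is_policy A m" and "\<And>i. f i \<le> Q f i (m i)"
  shows "f i \<le> J m i"
proof -
  have "f i - J m i \<le> 0 / (1 - \<alpha>)"
  proof (rule discounted_max_principle[OF m, of UNIV])
    fix i
    show "f i - J m i \<le> \<alpha> * (\<Sum>j\<in>UNIV. P i (m i) j * (f j - J m j)) + 0"
      using assms(2)[of i] J_Bellman[OF m, of i] Q_diff[of f i "m i" "J m"] by linarith
  qed auto
  then show ?thesis by simp
qed

lemma J_le:
  assumes m: "is_policy A m" and "\<And>i. Q f i (m i) \<le> f i"
  shows "J m i \<le> f i"
proof -
  have "J m i - f i \<le> 0 / (1 - \<alpha>)"
  proof (rule discounted_max_principle[OF m, of UNIV])
    fix i
    show "J m i - f i \<le> \<alpha> * (\<Sum>j\<in>UNIV. P i (m i) j * (J m j - f j)) + 0"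
      using assms(2)[of i] J_Bellman[OF m, of i] Q_diff[of "J m" i "m i" f] by linarith
  qed auto
  then show ?thesis by simp
qed

section \<open>Greedy policies and optimality\<close>

lemma greedy_Q: "greedy A \<alpha> P c f m \<longleftrightarrow> (\<forall>i. m i \<in> A i \<and> (\<forall>u\<in>A i. Q f i (m i) \<le> Q f i u))"
  by (simp add: greedy_def Q_def)

lemma greedy_exists: "\<exists>m. greedy A \<alpha> P c f m"
proof -
  have "\<exists>u. u \<in> A i \<and> (\<forall>v\<in>A i. Q f i u \<le> Q f i v)" for i
    by (rule finite_minimizer[OF actions, of i "Q f i"]) blast
  then show ?thesis unfolding greedy_Q by metis
qed

text \<open>A policy minimizing the sum of its values is stable under policy improvement.\<close>

lemma optimal_policy:
  obtains m where "is_policy A m" "Jopt = J m" "\<And>i u. u \<in> A i \<Longrightarrow> J m i \<le> Q (J m) i u"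
proof -
  obtain m where m: "is_policy A m"
    and min: "\<And>m'. is_policy A m' \<Longrightarrow> (\<Sum>i\<in>UNIV. J m i) \<le> (\<Sum>i\<in>UNIV. J m' i)"
    by (rule finite_minimizer[OF finite_policies, of "\<lambda>m. \<Sum>i\<in>UNIV. J m i"]) (use policy_exists in auto)
  obtain m' where g: "greedy A \<alpha> P c (J m) m'" using greedy_exists by blast
  then have m': "is_policy A m'" by (auto simp: greedy_def is_policy_def)
  have imp: "Q (J m) i (m' i) \<le> J m i" for i
    using g m J_Bellman[OF m, of i] by (auto simp: greedy_Q is_policy_def)
  then have le: "J m' i \<le> J m i" for i by (intro J_le m')
  \<comment> \<open>The improved policy is nowhere worse, so a strict gain in one state would lower
    the sum that \<open>m\<close> minimizes.\<close>
  have eq: "J m' i = J m i" for i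
  proof (rule ccontr)
    assume "J m' i \<noteq> J m i"
    then have "J m' i < J m i" using le[of i] by simp
    then have "(\<Sum>i\<in>UNIV. J m' i) < (\<Sum>i\<in>UNIV. J m i)"
      using le by (intro sum_strict_mono_ex1) auto
    then show False using min[OF m'] by simp
  qed
  have opt: "J m i \<le> Q (J m) i u" if "u \<in> A i" for i u
  proof -
    have "J m i = Q (J m') i (m' i)" using J_Bellman[OF m', of i] eq by simp
    also have "\<dots> = Q (J m) i (m' i)" using eq by (simp add: Q_def)
    also have "\<dots> \<le> Q (J m) i u" using g that by (auto simp: greedy_Q)
    finally show ?thesis .
  qed
  have "Jopt = J m"
  proof
    fix i
    show "Jopt i = J m i"
      unfolding Jstar_def
    proof (rule Min_eqI)
      show "finite {J m' i |m'. is_policy A m'}" using finite_policies by simp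
      show "J m i \<in> {J m' i |m'. is_policy A m'}" using m by blast
      show "J m i \<le> y" if y: "y \<in> {J m' i |m'. is_policy A m'}" for y
      proof -
        obtain m'' where "is_policy A m''" "y = J m'' i" using y by blast
        then show ?thesis using opt by (auto intro!: le_J simp: is_policy_def)
      qed
    qed
  qed
  then show ?thesis using that m opt by blast
qed

lemma Jopt_le_J: "is_policy A m \<Longrightarrow> Jopt i \<le> J m i"
  by (rule optimal_policy) (auto intro!: le_J simp: is_policy_def)

lemma Jopt_attained: "\<exists>u\<in>A i. Jopt i = Q Jopt i u"
  by (rule optimal_policy) (metis J_Bellman is_policy_def)

text \<open>Monotonicity and contraction of the Bellman operator in a single one-sided statement,
  for one action and with the shift assumed only on its successors.\<close>

lemma Q_le_shift:
  assumes "u \<in> A i" "\<And>j. P i u j > 0 \<Longrightarrow> f j \<le> f' j + b"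
  shows "Q f i u \<le> Q f' i u + \<alpha> * b"
proof -
  have "(\<Sum>j\<in>UNIV. P i u j * (f j - f' j)) \<le> b"
    using assms by (intro avg_le) (auto simp: algebra_simps)
  then have "\<alpha> * (\<Sum>j\<in>UNIV. P i u j * (f j - f' j)) \<le> \<alpha> * b"
    using alpha by (simp add: mult_left_mono)
  then show ?thesis using Q_diff[of f i u f'] by linarith
qed

section \<open>Hitting probabilities\<close>

lemma hitprob_bounds:
  assumes "is_policy A m"
  shows "0 \<le> hitprob P m K i j" "hitprob P m K i j \<le> 1"
proof (induction K arbitrary: j)
  case 0
  { case 1 then show ?case by simp }
  { case 2 then show ?case by simp }
next
  case (Suc K)
  have u: "m j \<in> A j" for j using assms by (auto simp: is_policy_def)
  { case 1 then show ?case
      by (auto intro!: sum_nonneg mult_nonneg_nonneg trans_nonneg[OF u] Suc) }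
  { case 2 then show ?case
      using avg_le[OF u, where f = "hitprob P m K i" and b = 1] Suc by simp }
qed

lemma hitprob_Suc_ge:
  assumes "is_policy A m"
  shows "hitprob P m K i j \<le> hitprob P m (Suc K) i j"
proof (induction K arbitrary: j)
  case 0
  have "m j \<in> A j" using assms by (auto simp: is_policy_def)
  then show ?case
    using avg_ge[where b = 0 and f = "hitprob P m 0 i" and i = j] by auto
next
  case (Suc K)
  have "(\<Sum>l\<in>UNIV. P j (m j) l * hitprob P m K i l) \<le> (\<Sum>l\<in>UNIV. P j (m j) l * hitprob P m (Suc K) i l)"
    using assms trans_nonneg by (intro sum_mono mult_left_mono Suc) (auto simp: is_policy_def)
  then show ?case by simp
qed

text \<open>The target \<open>i\<close> precedes the start \<open>j\<close>, as in
  \<open>hitprob\<close>. The limit is the one inside \<open>qvisit\<close>; it exists because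
  \<open>hitprob\<close> increases with the horizon.\<close>

definition hit :: "('s \<Rightarrow> 'a) \<Rightarrow> 's \<Rightarrow> 's \<Rightarrow> real" where
  "hit m i j = lim (\<lambda>K. hitprob P m K i j)"

lemma hitprob_LIMSEQ:
  assumes "is_policy A m"
  shows "(\<lambda>K. hitprob P m K i j) \<longlonglongrightarrow> hit m i j"
proof -
  have "convergent (\<lambda>K. hitprob P m K i j)"
  proof (rule Bseq_monoseq_convergent)
    show "Bseq (\<lambda>K. hitprob P m K i j)"
      by (rule BseqI'[of _ 1]) (use hitprob_bounds[OF assms] in \<open>simp add: abs_of_nonneg\<close>)
    show "monoseq (\<lambda>K. hitprob P m K i j)"
      using hitprob_Suc_ge[OF assms] by (auto simp: monoseq_Suc)
  qed
  then show ?thesis by (simp add: convergent_LIMSEQ_iff hit_def)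
qed

lemma hit_le_1: "is_policy A m \<Longrightarrow> hit m i j \<le> 1"
  by (rule LIMSEQ_le_const2[OF hitprob_LIMSEQ]) (use hitprob_bounds in auto)

lemma hit_self: "is_policy A m \<Longrightarrow> hit m i i = 1"
proof -
  have "hitprob P m K i i = 1" for K by (cases K) auto
  then show ?thesis by (simp add: hit_def)
qed

lemma hit_harmonic:
  assumes m: "is_policy A m" and "j \<noteq> i"
  shows "hit m i j = (\<Sum>l\<in>UNIV. P j (m j) l * hit m i l)"
proof -
  have "(\<lambda>K. hitprob P m (Suc K) i j) \<longlonglongrightarrow> (\<Sum>l\<in>UNIV. P j (m j) l * hit m i l)"
    using assms by (auto intro!: tendsto_intros hitprob_LIMSEQ)
  moreover have "(\<lambda>K. hitprob P m (Suc K) i j) \<longlonglongrightarrow> hit m i j"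
    using hitprob_LIMSEQ[OF m] by (rule LIMSEQ_Suc)
  ultimately show ?thesis by (blast intro: LIMSEQ_unique)
qed

lemma edgeI: "u \<in> A i \<Longrightarrow> P i u j > 0 \<Longrightarrow> (i, j) \<in> E"
  by (auto simp: reach_graph_def)

text \<open>The finite-horizon visit probabilities converge to \<open>qvisit\<close>, which is
  positive, and there are only finitely many policies and states. So one horizon \<open>K\<close>
  serves all of them, and \<open>\<delta>\<close> is a minimum of finitely many positive
  numbers.\<close>

lemma uniform_hitting:
  assumes A1: "\<And>m i. is_policy A m \<Longrightarrow> qvisit p P m i > 0"
  obtains K \<delta> where "0 < \<delta>" "\<And>m i. is_policy A m \<Longrightarrow> \<delta> \<le> (\<Sum>j\<in>UNIV. p j * hitprob P m K i j)"
proof -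
  have "eventually (\<lambda>K. 0 < (\<Sum>j\<in>UNIV. p j * hitprob P m K i j)) sequentially"
    if m: "is_policy A m" for m i
  proof -
    have "(\<lambda>K. \<Sum>j\<in>UNIV. p j * hitprob P m K i j) \<longlonglongrightarrow> qvisit p P m i"
      unfolding qvisit_def hit_def[symmetric] by (intro tendsto_intros hitprob_LIMSEQ m)
    then show ?thesis using A1[OF m] by (rule order_tendstoD)
  qed
  then have "eventually (\<lambda>K. \<forall>x\<in>{m. is_policy A m} \<times> UNIV. 0 < (\<Sum>j\<in>UNIV. p j * hitprob P (fst x) K (snd x) j)) sequentially"
    using finite_policies by (intro eventually_ball_finite) auto
  then obtain K where K: "\<And>m i. is_policy A m \<Longrightarrow> 0 < (\<Sum>j\<in>UNIV. p j * hitprob P m K i j)"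
    by (auto simp: eventually_sequentially)
  define W where "W = (\<lambda>(m, i). \<Sum>j\<in>UNIV. p j * hitprob P m K i j) ` ({m. is_policy A m} \<times> UNIV)"
  have "finite W" "W \<noteq> {}" unfolding W_def using finite_policies policy_exists by auto
  moreover have "\<And>w. w \<in> W \<Longrightarrow> 0 < w" using K by (auto simp: W_def)
  ultimately have "0 < Min W" by simp
  moreover have "Min W \<le> (\<Sum>j\<in>UNIV. p j * hitprob P m K i j)" if "is_policy A m" for m i
    using \<open>finite W\<close> that by (intro Min_le) (auto simp: W_def)
  ultimately show ?thesis using that by blast
qed

text \<open>The hitting probability is harmonic off the target, so its minimum over a recurrent class
  propagates along edges to the target, where it is 1.\<close>

lemma hit_recurrent:
  assumes A2: "\<And>i j u v. u \<in> A i \<Longrightarrow> v \<in> A i \<Longrightarrow> (P i u j > 0 \<longleftrightarrow> P i v j > 0)"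
    and m: "is_policy A m" and rec: "i \<notin> transient_states A P"
    and l: "(i, l) \<in> E\<^sup>*" and j: "(i, j) \<in> E\<^sup>*"
  shows "hit m j l = 1"
proof -
  define R where "R = {l. (i, l) \<in> E\<^sup>*}"
  have to_j: "(l, j) \<in> E\<^sup>*" if "l \<in> R" for l
  proof -
    have "(l, i) \<in> E\<^sup>*" using rec that by (auto simp: transient_states_def R_def)
    then show ?thesis using j by (rule rtrancl_trans)
  qed
  obtain k where k: "k \<in> R" "\<And>l. l \<in> R \<Longrightarrow> hit m j k \<le> hit m j l"
  proof -
    have "finite R" "R \<noteq> {}" using l by (auto simp: R_def)
    then show ?thesis using that by (rule finite_minimizer)
  qed
  \<comment> \<open>If the minimum is not 1, it is carried along any path from \<open>k\<close>. A
    path ending in the target \<open>j\<close>, where the value is 1, then gives the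
    contradiction.\<close>
  have const: "l \<in> R \<and> hit m j l = hit m j k" if "(k, l) \<in> E\<^sup>*" "j \<noteq> k" "(l, j) \<in> E\<^sup>*" "hit m j k \<noteq> 1" for l
    using that(1)
  proof (induction rule: rtrancl_induct)
    case base then show ?case using k by simp
  next
    case (step a b)
    have R_step: "x \<in> R" if "(a, x) \<in> E" for x
      using step(3) that unfolding R_def by (blast intro: rtrancl_into_rtrancl)
    have b: "b \<in> R" using R_step step(2) .
    have aj: "a \<noteq> j" using step hit_self[OF m] that(4) by auto
    have u: "m a \<in> A a" using m by (auto simp: is_policy_def)
    \<comment> \<open>The edge only says that some action leads to \<open>b\<close>; (A2) passes
      this on to the action of \<open>m\<close>.\<close>
    obtain v where "v \<in> A a" "P a v b > 0" using step(2) by (auto simp: reach_graph_def)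
    then have Pab: "P a (m a) b > 0" using A2[of "m a" a v b] u by blast
    \<comment> \<open>\<open>a\<close> attains the minimum and is not the target, so its value is
      the average over successors, none of which lies below it. A successor of positive probability
      with a larger value would push the average above the minimum.\<close>
    have "hit m j b \<le> hit m j k"
    proof (rule ccontr)
      assume n: "\<not> ?thesis"
      have "(\<Sum>l\<in>UNIV. P a (m a) l * hit m j k) < (\<Sum>l\<in>UNIV. P a (m a) l * hit m j l)"
      proof (rule sum_strict_mono_ex1)
        show "\<forall>x\<in>UNIV. P a (m a) x * hit m j k \<le> P a (m a) x * hit m j x"
        proof
          fix x
          show "P a (m a) x * hit m j k \<le> P a (m a) x * hit m j x"
          proof (cases "P a (m a) x > 0")
            case True
            have "x \<in> R" by (rule R_step[OF edgeI[OF u True]])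
            then show ?thesis using k(2) True by simp
          next
            case False
            then show ?thesis using trans_nonneg[OF u, of x] by simp
          qed
        qed
        show "\<exists>x\<in>UNIV. P a (m a) x * hit m j k < P a (m a) x * hit m j x"
          using n Pab by (intro bexI[of _ b]) auto
      qed simp
      then show False
        using hit_harmonic[OF m aj] step trans_sum[OF u] by (simp add: sum_distrib_right[symmetric])
    qed
    then show ?case using k(2)[OF b] b by simp
  qed
  have "hit m j k = 1"
  proof (rule ccontr)
    assume n: "hit m j k \<noteq> 1"
    have "j \<noteq> k" using n hit_self[OF m, of j] by blast
    then have "hit m j j = hit m j k" using const[of j] to_j[OF k(1)] n by blast
    then show False using n hit_self[OF m, of j] by simp
  qed
  then show ?thesis using k(2)[of l] l hit_le_1[OF m, of j l] by (simp add: R_def)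
qed

end

section \<open>Martingale differences\<close>

text \<open>The sigma-algebra generated by all maps \<open>\<Phi> K\<close> with discrete targets.
  The index \<open>K\<close> is a horizon: each \<open>\<Phi> K\<close> will have finite range, and
  only all horizons together capture infinite trajectories.\<close>

definition fibre_sigma :: "'w measure \<Rightarrow> (nat \<Rightarrow> 'w \<Rightarrow> 'b) \<Rightarrow> 'w measure" where
  "fibre_sigma M \<Phi> = sigma (space M) {{\<omega> \<in> space M. \<Phi> K \<omega> \<in> Y} |K Y. True}"

lemma space_fibre_sigma: "space (fibre_sigma M \<Phi>) = space M"
  unfolding fibre_sigma_def by (intro space_measure_of) auto

lemma sets_fibre_sigma:
  "sets (fibre_sigma M \<Phi>) = sigma_sets (space M) {{\<omega> \<in> space M. \<Phi> K \<omega> \<in> Y} |K Y. True}"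
  unfolding fibre_sigma_def by (intro sets_measure_of) auto

lemma fibre_sigma_subset:
  assumes "space N = space M" "\<And>K. \<Phi> K \<in> measurable N (count_space UNIV)"
  shows "sets (fibre_sigma M \<Phi>) \<subseteq> sets N"
  unfolding sets_fibre_sigma assms(1)[symmetric]
  using measurable_sets[OF assms(2), of UNIV] measurable_sets[OF assms(2)]
  by (intro sets.sigma_sets_subset) (auto simp: vimage_def Int_def conj_commute)

lemma measurable_fibre_sigma:
  assumes "\<And>\<omega>. \<omega> \<in> space M \<Longrightarrow> f \<omega> = g (\<Phi> K \<omega>)"
  shows "f \<in> measurable (fibre_sigma M \<Phi>) (count_space UNIV)"
proof (rule measurableI)
  fix S
  have "f -` S \<inter> space (fibre_sigma M \<Phi>) = {\<omega> \<in> space M. \<Phi> K \<omega> \<in> g -` S}"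
    using assms by (auto simp: space_fibre_sigma)
  then show "f -` S \<inter> space (fibre_sigma M \<Phi>) \<in> sets (fibre_sigma M \<Phi>)"
    unfolding sets_fibre_sigma by (blast intro: sigma_sets.Basic)
qed simp

lemma (in prob_space) integrable_bounded:
  fixes f :: "'a \<Rightarrow> real"
  assumes "f \<in> borel_measurable M" "\<And>\<omega>. \<omega> \<in> space M \<Longrightarrow> \<bar>f \<omega>\<bar> \<le> B"
  shows "integrable M f"
  using assms by (intro integrable_const_bound[of _ B]) auto

text \<open>Vanishing integrals over all sets of \<open>F\<close> identify the conditional
  expectation of \<open>D\<close> as 0, and a bounded \<open>F\<close>-measurable factor can be
  pulled out of it.\<close>

lemma (in prob_space) centered_mult:
  fixes D Z :: "'a \<Rightarrow> real"
  assumes sub: "subalgebra M F"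
    and D: "D \<in> borel_measurable M" "\<And>\<omega>. \<omega> \<in> space M \<Longrightarrow> \<bar>D \<omega>\<bar> \<le> b"
    and zero: "\<And>S. S \<in> sets F \<Longrightarrow> expectation (\<lambda>\<omega>. indicator S \<omega> * D \<omega>) = 0"
    and Z: "Z \<in> borel_measurable F" "\<And>\<omega>. \<omega> \<in> space M \<Longrightarrow> \<bar>Z \<omega>\<bar> \<le> B"
  shows "expectation (\<lambda>\<omega>. Z \<omega> * D \<omega>) = 0"
proof -
  interpret finite_measure_subalgebra M F
    by (intro finite_measure_subalgebra.intro finite_measure_axioms finite_measure_subalgebra_axioms.intro sub)
  note [measurable] = D(1)
  have [measurable]: "Z \<in> borel_measurable M" using measurable_from_subalg[OF sub Z(1)] .
  have iD: "integrable M D" using D by (rule integrable_bounded)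
  have iZD: "integrable M (\<lambda>\<omega>. Z \<omega> * D \<omega>)"
  proof (rule integrable_bounded)
    show "\<bar>Z \<omega> * D \<omega>\<bar> \<le> B * b" if "\<omega> \<in> space M" for \<omega>
      unfolding abs_mult using D(2)[OF that] Z(2)[OF that] by (intro mult_mono) auto
  qed simp
  have "AE \<omega> in M. real_cond_exp M F D \<omega> = 0"
    using zero by (intro real_cond_exp_charact iD) (auto simp: set_lebesgue_integral_def)
  then have "expectation (\<lambda>\<omega>. Z \<omega> * real_cond_exp M F D \<omega>) = expectation (\<lambda>\<omega>. 0)"
    using real_cond_exp_intg(1)[OF iZD Z(1) D(1)] by (intro integral_cong_AE) auto
  then show ?thesis using real_cond_exp_intg(2)[OF iZD Z(1) D(1)] by simp
qed

text \<open>Reduces centering to single fibres, whose probabilities can be computed from path laws.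
  Horizons refine one another, so the generating events are closed under intersection and a Dynkin
  argument extends the vanishing integral to the whole sigma-algebra. The threshold
  \<open>K0\<close> is there because the path law is usable only at horizons that cover the current
  state.\<close>

lemma (in prob_space) fibre_sigma_centered:
  fixes \<Phi> :: "nat \<Rightarrow> 'a \<Rightarrow> 'b" and D Z :: "'a \<Rightarrow> real"
  assumes refine: "\<And>K K' \<omega> \<omega>'. K \<le> K' \<Longrightarrow> \<Phi> K' \<omega> = \<Phi> K' \<omega>' \<Longrightarrow> \<Phi> K \<omega> = \<Phi> K \<omega>'"
    and fin: "\<And>K. finite (\<Phi> K ` space M)"
    and meas: "\<And>K. \<Phi> K \<in> measurable M (count_space UNIV)"
    and D: "D \<in> borel_measurable M" "\<And>\<omega>. \<omega> \<in> space M \<Longrightarrow> \<bar>D \<omega>\<bar> \<le> b"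
    and zero: "\<And>K y. K \<ge> K0 \<Longrightarrow> y \<in> \<Phi> K ` space M \<Longrightarrow>
        expectation (\<lambda>\<omega>. indicator {\<omega> \<in> space M. \<Phi> K \<omega> = y} \<omega> * D \<omega>) = 0"
    and Z: "Z \<in> borel_measurable (fibre_sigma M \<Phi>)" "\<And>\<omega>. \<omega> \<in> space M \<Longrightarrow> \<bar>Z \<omega>\<bar> \<le> B"
  shows "expectation (\<lambda>\<omega>. Z \<omega> * D \<omega>) = 0"
proof (rule centered_mult[OF _ D _ Z])
  note [measurable] = D(1) meas
  have sub: "sets (fibre_sigma M \<Phi>) \<subseteq> sets M"
    using meas by (intro fibre_sigma_subset) auto
  then show "subalgebra M (fibre_sigma M \<Phi>)"
    by (simp add: subalgebra_def space_fibre_sigma)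
  have iD: "integrable M D" using D by (rule integrable_bounded)
  have iSD: "integrable M (\<lambda>\<omega>. indicator S \<omega> * D \<omega>)" if "S \<in> sets M" for S
    using integrable_real_mult_indicator[OF that iD] by (simp add: mult.commute)
  have raise: "\<exists>Y'. {\<omega> \<in> space M. \<Phi> K \<omega> \<in> Y} = {\<omega> \<in> space M. \<Phi> K' \<omega> \<in> Y'}" if "K \<le> K'" for K K' Y
  proof (intro exI[of _ "\<Phi> K' ` {\<omega> \<in> space M. \<Phi> K \<omega> \<in> Y}"] set_eqI iffI)
    fix \<omega> assume "\<omega> \<in> {\<omega> \<in> space M. \<Phi> K' \<omega> \<in> \<Phi> K' ` {\<omega> \<in> space M. \<Phi> K \<omega> \<in> Y}}"
    then obtain \<omega>' where "\<omega> \<in> space M" "\<Phi> K' \<omega> = \<Phi> K' \<omega>'" "\<Phi> K \<omega>' \<in> Y" by blast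
    then show "\<omega> \<in> {\<omega> \<in> space M. \<Phi> K \<omega> \<in> Y}" using refine[OF that, of \<omega> \<omega>'] by simp
  qed blast
  let ?G = "{{\<omega> \<in> space M. \<Phi> K \<omega> \<in> Y} |K Y. True}"
  have generator: "expectation (\<lambda>\<omega>. indicator S \<omega> * D \<omega>) = 0" if "S \<in> ?G" for S
  proof -
    obtain K Y where "S = {\<omega> \<in> space M. \<Phi> K \<omega> \<in> Y}" using \<open>S \<in> ?G\<close> by blast
    moreover obtain K' where K': "K' = max K K0" by simp
    ultimately obtain Y' where S: "S = {\<omega> \<in> space M. \<Phi> K' \<omega> \<in> Y'}" using raise[of K K' Y] by auto
    \<comment> \<open>Only attained values matter, and they are finitely many, so the event is a
      finite disjoint union of fibres.\<close>
    define W where "W = Y' \<inter> \<Phi> K' ` space M"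
    have W: "finite W" using fin by (simp add: W_def)
    have fibre: "{\<omega> \<in> space M. \<Phi> K' \<omega> = y} \<in> sets M" for y
      using measurable_sets[OF meas, of "{y}" K'] by (simp add: vimage_def Int_def conj_commute)
    have "expectation (\<lambda>\<omega>. indicator S \<omega> * D \<omega>)
        = expectation (\<lambda>\<omega>. \<Sum>y\<in>W. indicator {\<omega> \<in> space M. \<Phi> K' \<omega> = y} \<omega> * D \<omega>)"
    proof (intro Bochner_Integration.integral_cong refl)
      fix \<omega> assume "\<omega> \<in> space M"
      then have "indicator S \<omega> = (\<Sum>y\<in>W. if y = \<Phi> K' \<omega> then 1 else (0::real))"
        using W by (auto simp: S W_def indicator_def)
      also have "\<dots> = (\<Sum>y\<in>W. indicator {\<omega> \<in> space M. \<Phi> K' \<omega> = y} \<omega>)"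
        using \<open>\<omega> \<in> space M\<close> by (intro sum.cong) (auto simp: indicator_def)
      finally show "indicator S \<omega> * D \<omega> = (\<Sum>y\<in>W. indicator {\<omega> \<in> space M. \<Phi> K' \<omega> = y} \<omega> * D \<omega>)"
        by (simp add: sum_distrib_right)
    qed
    also have "\<dots> = (\<Sum>y\<in>W. expectation (\<lambda>\<omega>. indicator {\<omega> \<in> space M. \<Phi> K' \<omega> = y} \<omega> * D \<omega>))"
      using fibre by (intro Bochner_Integration.integral_sum iSD)
    also have "\<dots> = 0" using zero K' by (intro sum.neutral) (auto simp: W_def)
    finally show ?thesis .
  qed
  have stable: "Int_stable ?G"
  proof (rule Int_stableI)
    fix S S' assume "S \<in> ?G" "S' \<in> ?G"
    then obtain K Y K' Y' where "S = {\<omega> \<in> space M. \<Phi> K \<omega> \<in> Y}" "S' = {\<omega> \<in> space M. \<Phi> K' \<omega> \<in> Y'}" by blast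
    moreover obtain Y1 where "{\<omega> \<in> space M. \<Phi> K \<omega> \<in> Y} = {\<omega> \<in> space M. \<Phi> (max K K') \<omega> \<in> Y1}"
      using raise[OF max.cobounded1] by blast
    moreover obtain Y2 where "{\<omega> \<in> space M. \<Phi> K' \<omega> \<in> Y'} = {\<omega> \<in> space M. \<Phi> (max K K') \<omega> \<in> Y2}"
      using raise[OF max.cobounded2] by blast
    ultimately have "S \<inter> S' = {\<omega> \<in> space M. \<Phi> (max K K') \<omega> \<in> Y1 \<inter> Y2}" by auto
    then show "S \<inter> S' \<in> ?G" by blast
  qed
  have pow: "?G \<subseteq> Pow (space M)" by auto
  show "expectation (\<lambda>\<omega>. indicator S \<omega> * D \<omega>) = 0" if "S \<in> sets (fibre_sigma M \<Phi>)" for S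
    using stable pow that[unfolded sets_fibre_sigma]
  proof (induction rule: sigma_sets_induct_disjoint)
    case (basic S)
    then show ?case by (rule generator)
  next
    case empty
    then show ?case by simp
  next
    case (compl S)
    have [measurable]: "S \<in> sets M" using compl(1) sub by (auto simp: sets_fibre_sigma)
    have "expectation D = expectation (\<lambda>\<omega>. indicator (space M) \<omega> * D \<omega>)"
      by (intro Bochner_Integration.integral_cong) auto
    also have "\<dots> = 0" by (rule generator) (auto intro!: exI[of _ UNIV])
    finally have "expectation D = 0" .
    moreover have "expectation (\<lambda>\<omega>. indicator (space M - S) \<omega> * D \<omega>) = expectation (\<lambda>\<omega>. D \<omega> - indicator S \<omega> * D \<omega>)"
      by (intro Bochner_Integration.integral_cong) (auto simp: indicator_def)
    moreover have "\<dots> = expectation D - expectation (\<lambda>\<omega>. indicator S \<omega> * D \<omega>)"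
      using \<open>S \<in> sets M\<close> by (intro Bochner_Integration.integral_diff iD iSD)
    ultimately show ?case using compl(2) by simp
  next
    case (union S)
    have [measurable]: "S i \<in> sets M" for i using union(2) sub by (auto simp: sets_fibre_sigma)
    \<comment> \<open>Countable additivity for the signed integrand: dominated convergence along the
      finite partial unions.\<close>
    have "(\<lambda>n. expectation (\<lambda>\<omega>. indicator (\<Union>i<n. S i) \<omega> * D \<omega>))
        \<longlonglongrightarrow> expectation (\<lambda>\<omega>. indicator (\<Union>i. S i) \<omega> * D \<omega>)"
    proof (rule integral_dominated_convergence[where w = "\<lambda>_. b"])
      show "AE \<omega> in M. (\<lambda>n. indicator (\<Union>i<n. S i) \<omega> * D \<omega>) \<longlonglongrightarrow> indicator (\<Union>i. S i) \<omega> * D \<omega>"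
        by (intro AE_I2 tendsto_mult tendsto_const LIMSEQ_indicator_UN)
      show "AE \<omega> in M. norm (indicator (\<Union>i<n. S i) \<omega> * D \<omega>) \<le> b" for n
        using D(2) by (intro AE_I2) (auto simp: indicator_def intro: order_trans[OF abs_ge_zero])
    qed auto
    moreover have "expectation (\<lambda>\<omega>. indicator (\<Union>i<n. S i) \<omega> * D \<omega>) = 0" for n
    proof -
      have "expectation (\<lambda>\<omega>. indicator (\<Union>i<n. S i) \<omega> * D \<omega>) = expectation (\<lambda>\<omega>. \<Sum>i<n. indicator (S i) \<omega> * D \<omega>)"
      proof (intro Bochner_Integration.integral_cong refl)
        fix \<omega>
        have "disjoint_family_on S {..<n}" using union(1) by (rule disjoint_family_on_mono[OF subset_UNIV])
        then have "indicator (\<Union>i<n. S i) \<omega> = (\<Sum>i<n. indicator (S i) \<omega> :: real)"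
          by (intro indicator_UN_disjoint) auto
        then show "indicator (\<Union>i<n. S i) \<omega> * D \<omega> = (\<Sum>i<n. indicator (S i) \<omega> * D \<omega>)"
          by (simp only: sum_distrib_right)
      qed
      also have "\<dots> = (\<Sum>i<n. expectation (\<lambda>\<omega>. indicator (S i) \<omega> * D \<omega>))"
        using \<open>\<And>i. S i \<in> sets M\<close> by (intro Bochner_Integration.integral_sum iSD)
      also have "\<dots> = 0" using union(3) by simp
      finally show ?thesis .
    qed
    ultimately show ?case using LIMSEQ_unique[OF _ tendsto_const] by simp
  qed
qed

text \<open>Centering is phrased as orthogonality to bounded \<open>F t\<close>-measurable factors.
  Kolmogorov's maximal inequality then bounds the oscillation of the partial sums after
  \<open>n\<close> by a tail of the variance series, so almost surely they form a Cauchy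
  sequence.\<close>

lemma (in prob_space) L2_martingale_summable:
  fixes D :: "nat \<Rightarrow> 'a \<Rightarrow> real"
  assumes F: "\<And>t. subalgebra M (F t)" "\<And>t. sets (F t) \<subseteq> sets (F (Suc t))"
    and D: "\<And>t. D t \<in> borel_measurable (F (Suc t))" "\<And>t \<omega>. \<omega> \<in> space M \<Longrightarrow> \<bar>D t \<omega>\<bar> \<le> b"
    and centered: "\<And>t Z B. Z \<in> borel_measurable (F t) \<Longrightarrow> (\<And>\<omega>. \<omega> \<in> space M \<Longrightarrow> \<bar>Z \<omega>\<bar> \<le> B) \<Longrightarrow>
        expectation (\<lambda>\<omega>. Z \<omega> * D t \<omega>) = 0"
    and sq: "\<And>T. (\<Sum>t<T. expectation (\<lambda>\<omega>. (D t \<omega>)\<^sup>2)) \<le> C"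
  shows "AE \<omega> in M. summable (\<lambda>t. D t \<omega>)"
proof -
  have space_F: "space (F t) = space M" for t using F(1) by (auto simp: subalgebra_def)
  have F_mono: "sets (F s) \<subseteq> sets (F t)" if "s \<le> t" for s t
    using lift_Suc_mono_le[of "\<lambda>t. sets (F t)", OF F(2) that] .
  have F_meas: "f \<in> measurable (F t) N" if "f \<in> measurable (F s) N" "s \<le> t" for f s t and N :: "'b measure"
    using that F_mono[OF that(2)] by (auto simp: measurable_def space_F)
  have [measurable]: "D t \<in> borel_measurable M" for t
    using measurable_from_subalg[OF F(1) D(1)] .
  have D_meas: "D s \<in> borel_measurable (F t)" if "s < t" for s t
    using F_meas[OF D(1)[of s], of t] that by simp
  define a where "a t = expectation (\<lambda>\<omega>. (D t \<omega>)\<^sup>2)" for t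
  have a0: "0 \<le> a t" for t by (simp add: a_def)
  have "summable a"
    by (rule bounded_imp_summable[of a C]) (use a0 sq[of "Suc _"] in \<open>auto simp: a_def lessThan_Suc_atMost[symmetric] simp del: sum.lessThan_Suc\<close>)
  define tail where "tail n = suminf a - (\<Sum>t<n. a t)" for n
  have "tail \<longlonglongrightarrow> suminf a - suminf a"
    unfolding tail_def by (intro tendsto_intros summable_LIMSEQ \<open>summable a\<close>)
  then have tail0: "tail \<longlonglongrightarrow> 0" by simp
  have a_tail: "(\<Sum>r<k. a (n + r)) \<le> tail n" for n k
  proof -
    have "(\<Sum>t<n + k. a t) = (\<Sum>t<n. a t) + (\<Sum>r<k. a (n + r))"
      by (induction k) (simp_all add: add.assoc)
    moreover have "(\<Sum>t<n + k. a t) \<le> suminf a" using a0 by (intro sum_le_suminf \<open>summable a\<close>) auto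
    ultimately show ?thesis by (simp add: tail_def)
  qed
  define S where "S n k \<omega> = (\<Sum>r<k. D (n + r) \<omega>)" for n k \<omega>
  have S_meas: "S n k \<in> borel_measurable (F (n + r))" if "k \<le> r" for n k r
    unfolding S_def using that by (intro borel_measurable_sum D_meas) auto
  have [measurable]: "S n k \<in> borel_measurable M" for n k
    unfolding S_def by measurable
  have deviation: "prob {\<omega> \<in> space M. \<exists>q. e \<le> \<bar>S n q \<omega>\<bar>} \<le> tail n / e\<^sup>2" if e: "0 < e" for n e
  proof -
    \<comment> \<open>The partial sums are stopped when they first leave \<open>(-e, e)\<close>.\<close>
    define w where "w r \<omega> = (of_bool (\<forall>q\<le>r. \<bar>S n q \<omega>\<bar> < e) :: real)" for r \<omega>
    define T where "T k \<omega> = (\<Sum>r<k. w r \<omega> * D (n + r) \<omega>)" for k \<omega>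
    \<comment> \<open>Whether the sum is still running at \<open>r\<close> depends only on
      increments before \<open>n + r\<close>, so \<open>w r\<close> is an admissible factor for
      \<open>D (n + r)\<close> in \<open>centered\<close>.\<close>
    have w_meas: "w r \<in> borel_measurable (F (n + s))" if "r \<le> s" for r s
    proof -
      have [measurable]: "S n q \<in> borel_measurable (F (n + s))" if "q \<in> {..r}" for q
        using S_meas[of q s n] that \<open>r \<le> s\<close> by auto
      have "(\<lambda>\<omega>. of_bool (\<forall>q\<in>{..r}. \<bar>S n q \<omega>\<bar> < e) :: real) \<in> borel_measurable (F (n + s))"
        by measurable
      then show ?thesis unfolding w_def atMost_iff[symmetric] Ball_def .
    qed
    have T_meas: "T k \<in> borel_measurable (F (n + k))" for k
      unfolding T_def by (intro borel_measurable_sum borel_measurable_times w_meas D_meas) auto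
    have [measurable]: "w r \<in> borel_measurable M" for r using measurable_from_subalg[OF F(1) w_meas[OF order_refl]] .
    have [measurable]: "T k \<in> borel_measurable M" for k using measurable_from_subalg[OF F(1) T_meas] .
    have w1: "\<bar>w r \<omega>\<bar> \<le> 1" "(w r \<omega>)\<^sup>2 \<le> 1" for r \<omega> by (auto simp: w_def)
    have Tb: "\<bar>T k \<omega>\<bar> \<le> real k * b" if "\<omega> \<in> space M" for k \<omega>
    proof -
      have "\<bar>T k \<omega>\<bar> \<le> (\<Sum>r<k. \<bar>w r \<omega> * D (n + r) \<omega>\<bar>)" unfolding T_def by (rule sum_abs)
      also have "\<dots> \<le> (\<Sum>r<k. 1 * b)"
        unfolding abs_mult using w1 D(2)[OF that] by (intro sum_mono mult_mono) auto
      finally show ?thesis by simp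
    qed
    have sq_bound: "x\<^sup>2 \<le> B\<^sup>2" if "\<bar>x\<bar> \<le> B" for x B :: real
      using that by (metis abs_le_square_iff abs_of_nonneg abs_ge_zero order_trans)
    have T2_int: "integrable M (\<lambda>\<omega>. (T k \<omega>)\<^sup>2)" for k
      by (rule integrable_bounded[where B = "(real k * b)\<^sup>2"]) (use Tb sq_bound in auto)
    have D2_int: "integrable M (\<lambda>\<omega>. (D k \<omega>)\<^sup>2)" for k
      by (rule integrable_bounded[where B = "b\<^sup>2"]) (use D(2) sq_bound in auto)
    \<comment> \<open>The cross term is centered because \<open>T k * w k\<close> is
      \<open>F (n + k)\<close>-measurable, and switching increments off only decreases the
      variances.\<close>
    have ET: "expectation (\<lambda>\<omega>. (T k \<omega>)\<^sup>2) \<le> (\<Sum>r<k. a (n + r))" for k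
    proof (induction k)
      case 0
      then show ?case by (simp add: T_def)
    next
      case (Suc k)
      have wDT_int: "integrable M (\<lambda>\<omega>. (2 * T k \<omega> * w k \<omega>) * D (n + k) \<omega>)"
      proof (rule integrable_bounded)
        show "\<bar>(2 * T k \<omega> * w k \<omega>) * D (n + k) \<omega>\<bar> \<le> (2 * (real k * b) * 1) * b" if "\<omega> \<in> space M" for \<omega>
          unfolding abs_mult using Tb[OF that, of k] w1[of k \<omega>] D(2)[OF that, of "n + k"]
          by (intro mult_mono mult_nonneg_nonneg) auto
      qed simp
      have wD_int: "integrable M (\<lambda>\<omega>. (w k \<omega>)\<^sup>2 * (D (n + k) \<omega>)\<^sup>2)"
        by (rule Bochner_Integration.integrable_bound[OF D2_int[of "n + k"]])
          (use w1 in \<open>auto intro!: AE_I2 mult_left_le_one_le simp: abs_mult\<close>)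
      have "expectation (\<lambda>\<omega>. (T (Suc k) \<omega>)\<^sup>2)
          = expectation (\<lambda>\<omega>. (T k \<omega>)\<^sup>2 + ((2 * T k \<omega> * w k \<omega>) * D (n + k) \<omega> + (w k \<omega>)\<^sup>2 * (D (n + k) \<omega>)\<^sup>2))"
        by (intro Bochner_Integration.integral_cong) (auto simp: T_def power2_eq_square algebra_simps)
      also have "\<dots> = expectation (\<lambda>\<omega>. (T k \<omega>)\<^sup>2) + (expectation (\<lambda>\<omega>. (2 * T k \<omega> * w k \<omega>) * D (n + k) \<omega>)
          + expectation (\<lambda>\<omega>. (w k \<omega>)\<^sup>2 * (D (n + k) \<omega>)\<^sup>2))"
        by (simp only: Bochner_Integration.integral_add T2_int wDT_int wD_int Bochner_Integration.integrable_add)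
      also have "expectation (\<lambda>\<omega>. (2 * T k \<omega> * w k \<omega>) * D (n + k) \<omega>) = 0"
      proof (rule centered)
        show "(\<lambda>\<omega>. 2 * T k \<omega> * w k \<omega>) \<in> borel_measurable (F (n + k))"
          by (intro borel_measurable_times T_meas w_meas) auto
        show "\<bar>2 * T k \<omega> * w k \<omega>\<bar> \<le> 2 * (real k * b) * 1" if "\<omega> \<in> space M" for \<omega>
          unfolding abs_mult using Tb[OF that, of k] w1[of k \<omega>] by (intro mult_mono) auto
      qed
      also have "expectation (\<lambda>\<omega>. (w k \<omega>)\<^sup>2 * (D (n + k) \<omega>)\<^sup>2) \<le> a (n + k)"
        unfolding a_def using w1 by (intro integral_mono wD_int D2_int mult_left_le_one_le) auto
      finally show ?case using Suc by simp
    qed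
    \<comment> \<open>After the first exit \<open>q0\<close> all weights are 0, so the stopped sum
      keeps the value \<open>S n q0\<close>. A running maximum above \<open>e\<close> is thus
      visible in the single variable \<open>T k\<close>, to which Chebyshev's inequality
      applies.\<close>
    have stop: "e \<le> \<bar>T k \<omega>\<bar>" if "q \<le> k" "e \<le> \<bar>S n q \<omega>\<bar>" for q k \<omega>
    proof -
      define q0 where "q0 = (LEAST q. e \<le> \<bar>S n q \<omega>\<bar>)"
      have q0: "e \<le> \<bar>S n q0 \<omega>\<bar>" "q0 \<le> q" unfolding q0_def
        using that(2) by (rule LeastI, rule Least_le)
      have w: "w r \<omega> = (if r < q0 then 1 else 0)" for r
        unfolding w_def using q0(1) not_less_Least[of _ "\<lambda>q. e \<le> \<bar>S n q \<omega>\<bar>"]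
        by (auto simp: q0_def[symmetric] not_le not_less dest: le_less_trans)
      have "T k \<omega> = (\<Sum>r<k. if r < q0 then D (n + r) \<omega> else 0)"
        unfolding T_def w by (intro sum.cong) auto
      also have "\<dots> = (\<Sum>r\<in>{..<k} \<inter> {r. r < q0}. D (n + r) \<omega>)" by (simp add: sum.inter_restrict)
      also have "{..<k} \<inter> {r. r < q0} = {..<q0}" using q0(2) that(1) by auto
      finally show ?thesis using q0(1) by (simp add: S_def)
    qed
    have "prob {\<omega> \<in> space M. \<exists>q\<le>k. e \<le> \<bar>S n q \<omega>\<bar>} \<le> tail n / e\<^sup>2" for k
    proof -
      have "prob {\<omega> \<in> space M. \<exists>q\<le>k. e \<le> \<bar>S n q \<omega>\<bar>} \<le> prob {\<omega> \<in> space M. e\<^sup>2 \<le> (T k \<omega>)\<^sup>2}"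
      proof (rule finite_measure_mono)
        show "{\<omega> \<in> space M. \<exists>q\<le>k. e \<le> \<bar>S n q \<omega>\<bar>} \<subseteq> {\<omega> \<in> space M. e\<^sup>2 \<le> (T k \<omega>)\<^sup>2}"
          using stop e by (auto simp: abs_le_square_iff[symmetric])
      qed measurable
      also have "\<dots> \<le> expectation (\<lambda>\<omega>. (T k \<omega>)\<^sup>2) / e\<^sup>2"
        using e by (intro integral_Markov_inequality_measure[OF T2_int, of "{}"]) auto
      also have "\<dots> \<le> tail n / e\<^sup>2"
        using order_trans[OF ET a_tail] by (intro divide_right_mono) auto
      finally show ?thesis .
    qed
    moreover have "(\<lambda>k. prob {\<omega> \<in> space M. \<exists>q\<le>k. e \<le> \<bar>S n q \<omega>\<bar>}) \<longlonglongrightarrow> prob (\<Union>k. {\<omega> \<in> space M. \<exists>q\<le>k. e \<le> \<bar>S n q \<omega>\<bar>})"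
    proof (rule finite_Lim_measure_incseq)
      show "incseq (\<lambda>k. {\<omega> \<in> space M. \<exists>q\<le>k. e \<le> \<bar>S n q \<omega>\<bar>})"
        by (auto simp: incseq_def intro: order_trans)
    qed (auto simp: image_subset_iff)
    moreover have "(\<Union>k. {\<omega> \<in> space M. \<exists>q\<le>k. e \<le> \<bar>S n q \<omega>\<bar>}) = {\<omega> \<in> space M. \<exists>q. e \<le> \<bar>S n q \<omega>\<bar>}"
      by auto
    ultimately show ?thesis by (auto intro: LIMSEQ_le_const2)
  qed
  have "AE \<omega> in M. \<exists>n. \<forall>q. \<bar>S n q \<omega>\<bar> < e" if e: "0 < e" for e
  proof -
    \<comment> \<open>The event that the partial sums still move by at least \<open>e\<close> after
      every starting index.\<close>
    let ?B = "{\<omega> \<in> space M. \<forall>n. \<exists>q. e \<le> \<bar>S n q \<omega>\<bar>}"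
    have "prob ?B \<le> tail n / e\<^sup>2" for n
    proof -
      have "prob ?B \<le> prob {\<omega> \<in> space M. \<exists>q. e \<le> \<bar>S n q \<omega>\<bar>}" by (intro finite_measure_mono) auto
      then show ?thesis using deviation[OF e, of n] by simp
    qed
    moreover have "(\<lambda>n. tail n / e\<^sup>2) \<longlonglongrightarrow> 0"
      using tendsto_divide[OF tail0 tendsto_const[of "e\<^sup>2"]] e by simp
    ultimately have "prob ?B \<le> 0" by (auto intro: LIMSEQ_le_const)
    then have "prob ?B = 0" using measure_nonneg[of M ?B] by linarith
    then have "?B \<in> null_sets M" by (intro null_setsI) (auto simp: emeasure_eq_measure)
    then show ?thesis by (rule AE_I') (auto simp: not_less)
  qed
  then have "AE \<omega> in M. \<forall>m. \<exists>n. \<forall>q. \<bar>S n q \<omega>\<bar> < 1 / real (Suc m)"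
    by (auto simp: AE_all_countable)
  then show ?thesis
  proof eventually_elim
    case (elim \<omega>)
    show ?case
      unfolding summable_Cauchy
    proof (intro allI impI)
      fix e :: real assume "0 < e"
      \<comment> \<open>Half of \<open>e\<close> suffices because both ends of a block are compared
        with the partial sum at \<open>n\<close>.\<close>
      then obtain m where m: "1 / real (Suc m) < e / 2" using nat_approx_posE[of "e / 2"] by (auto simp: inverse_eq_divide)
      obtain n where n: "\<And>q. \<bar>S n q \<omega>\<bar> < 1 / real (Suc m)" using elim by blast
      have "norm (sum (\<lambda>t. D t \<omega>) {i..<j}) < e" if "n \<le> i" for i j
      proof (cases "i \<le> j")
        case True
        have S_eq: "S n (k - n) \<omega> = sum (\<lambda>t. D t \<omega>) {n..<k}" if "n \<le> k" for k
          unfolding S_def using that by (intro sum.reindex_bij_witness[of _ "\<lambda>t. t - n" "\<lambda>r. n + r"]) auto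
        have "sum (\<lambda>t. D t \<omega>) {i..<j} = S n (j - n) \<omega> - S n (i - n) \<omega>"
          using True that S_eq[of i] S_eq[of j] sum.atLeastLessThan_concat[of n i j "\<lambda>t. D t \<omega>"] by simp
        then show ?thesis using n[of "j - n"] n[of "i - n"] m unfolding real_norm_def by linarith
      qed (use \<open>0 < e\<close> in simp)
      then show "\<exists>N. \<forall>i\<ge>N. \<forall>j. norm (sum (\<lambda>t. D t \<omega>) {i..<j}) < e" by blast
    qed
  qed
qed

section \<open>The sampling process\<close>

text \<open>The probabilistic input is \<open>trajectory_law\<close>: given the earlier
  trajectories, truncated at the same horizon \<open>K\<close>, and the policies up to
  \<open>t\<close>, a path has the product probability of the chain under \<open>m t\<close>. Since
  \<open>mu t\<close> belongs to the conditioning, ties in the greedy choice need no fixed rule. The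
  flag \<open>cnt\<close> selects the step size \<open>\<beta> (n_t(i))\<close>.\<close>

locale opi = mdp A P c \<alpha> + prob_space M
  for A :: "'s::finite \<Rightarrow> 'a set"
    and P :: "'s \<Rightarrow> 'a \<Rightarrow> 's \<Rightarrow> real"
    and c :: "'s \<Rightarrow> 'a \<Rightarrow> real"
    and \<alpha> :: real
    and M :: "'w measure" +
  fixes p :: "'s \<Rightarrow> real"
    and \<beta> :: "nat \<Rightarrow> real"
    and cnt :: bool
    and X :: "nat \<Rightarrow> nat \<Rightarrow> 'w \<Rightarrow> 's"
    and mu :: "nat \<Rightarrow> 'w \<Rightarrow> ('s \<Rightarrow> 'a)"
  assumes p_nonneg: "\<And>i. 0 \<le> p i"
    and p_sum: "(\<Sum>i\<in>UNIV. p i) = 1"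
    and A1: "\<And>m i. is_policy A m \<Longrightarrow> qvisit p P m i > 0"
    and A2: "\<And>i j u v. u \<in> A i \<Longrightarrow> v \<in> A i \<Longrightarrow> (P i u j > 0 \<longleftrightarrow> P i v j > 0)"
    and A3: "acyclic (reach_graph A P \<inter> (transient_states A P \<times> transient_states A P))"
    and beta_range: "\<And>t. 0 < \<beta> t \<and> \<beta> t \<le> 1"
    and beta_sum: "\<not> summable \<beta>"
    and beta_sq: "summable (\<lambda>t. (\<beta> t)\<^sup>2)"
    and X_meas [measurable]: "\<And>t k. X t k \<in> measurable M (count_space UNIV)"
    and mu_meas [measurable]: "\<And>t. mu t \<in> measurable M (count_space UNIV)"
    and mu_greedy: "\<And>t \<omega>. \<omega> \<in> space M \<Longrightarrow>
        greedy A \<alpha> P c (opiJ \<alpha> c \<beta> cnt (\<lambda>\<tau> k. X \<tau> k \<omega>) (\<lambda>\<tau>. mu \<tau> \<omega>) t) (mu t \<omega>)"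
    and trajectory_law: "\<And>t K h m s.
        measure M {\<omega> \<in> space M. (\<forall>\<tau><t. \<forall>k\<le>K. X \<tau> k \<omega> = h \<tau> k)
                                \<and> (\<forall>\<tau>\<le>t. mu \<tau> \<omega> = m \<tau>)
                                \<and> (\<forall>k\<le>K. X t k \<omega> = s k)}
        = measure M {\<omega> \<in> space M. (\<forall>\<tau><t. \<forall>k\<le>K. X \<tau> k \<omega> = h \<tau> k)
                                \<and> (\<forall>\<tau>\<le>t. mu \<tau> \<omega> = m \<tau>)}
          * (p (s 0) * (\<Prod>k<K. P (s k) (m t (s k)) (s (Suc k))))"
begin

section \<open>Histories and the law of the next state\<close>

lemma mu_policy: "\<omega> \<in> space M \<Longrightarrow> is_policy A (mu t \<omega>)"
  using mu_greedy[of \<omega> t] by (auto simp: greedy_def is_policy_def)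

lemma mu_in: "\<omega> \<in> space M \<Longrightarrow> mu t \<omega> i \<in> A i"
  using mu_policy[of \<omega> t] by (auto simp: is_policy_def)

text \<open>\<open>restrict\<close> makes two histories equal exactly if they agree on the recorded
  indices. \<open>K\<close> truncates the earlier trajectories only. The range \<open>{..<k}\<close>
  is strict, so \<open>k = 0\<close> records no state of trajectory \<open>t\<close>, while its
  policy is included.\<close>

definition hist :: "nat \<Rightarrow> nat \<Rightarrow> nat \<Rightarrow> 'w \<Rightarrow> (nat \<Rightarrow> nat \<Rightarrow> 's) \<times> (nat \<Rightarrow> 's \<Rightarrow> 'a) \<times> (nat \<Rightarrow> 's)" where
  "hist t k K \<omega> = (restrict (\<lambda>\<tau>. restrict (\<lambda>k'. X \<tau> k' \<omega>) {..K}) {..<t},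
     restrict (\<lambda>\<tau>. mu \<tau> \<omega>) {..t}, restrict (\<lambda>k'. X t k' \<omega>) {..<k})"

text \<open>The information available before the state at time \<open>k\<close> of iteration \<open>t\<close> is drawn: all
  trajectories before \<open>t\<close>, the policies up to \<open>t\<close>, and the first \<open>k\<close> states of trajectory \<open>t\<close>.\<close>

definition G :: "nat \<Rightarrow> nat \<Rightarrow> 'w measure" where
  "G t k = fibre_sigma M (hist t k)"

lemma space_G: "space (G t k) = space M"
  by (simp add: G_def space_fibre_sigma)

lemma restrict_eq_iff: "restrict f S = restrict g S \<longleftrightarrow> (\<forall>x\<in>S. f x = g x)"
  by (auto simp: restrict_def fun_eq_iff)

lemma hist_eq_iff: "hist t k K \<omega> = hist t k K \<omega>' \<longleftrightarrow>
    (\<forall>\<tau><t. \<forall>k'\<le>K. X \<tau> k' \<omega> = X \<tau> k' \<omega>') \<and> (\<forall>\<tau>\<le>t. mu \<tau> \<omega> = mu \<tau> \<omega>') \<and> (\<forall>k'<k. X t k' \<omega> = X t k' \<omega>')"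
  by (auto simp: hist_def restrict_eq_iff)

lemma finite_hist: "finite (hist t k K ` space M)"
proof (rule finite_subset)
  let ?S = "(PiE {..<t} (\<lambda>_. PiE {..K} (\<lambda>_. UNIV :: 's set))) \<times> (PiE {..t} (\<lambda>_. {m. is_policy A m})) \<times> (PiE {..<k} (\<lambda>_. UNIV :: 's set))"
  show "hist t k K ` space M \<subseteq> ?S"
    using mu_policy by (auto simp: hist_def intro!: restrict_PiE_iff[THEN iffD2])
  show "finite ?S" using finite_policies by (intro finite_cartesian_product finite_PiE) auto
qed

text \<open>The target type need not be countable, but only finitely many values are attained, so
  every preimage is a finite union of fibres.\<close>

lemma hist_measurable:
  assumes N: "space N = space M"
    and [measurable]: "\<And>\<tau> k'. \<tau> < t \<Longrightarrow> X \<tau> k' \<in> measurable N (count_space UNIV)"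
      "\<And>\<tau>. \<tau> \<le> t \<Longrightarrow> mu \<tau> \<in> measurable N (count_space UNIV)"
      "\<And>k'. k' < k \<Longrightarrow> X t k' \<in> measurable N (count_space UNIV)"
  shows "hist t k K \<in> measurable N (count_space UNIV)"
proof (rule measurableI)
  fix Y
  have eq: "hist t k K -` Y \<inter> space N = (\<Union>y\<in>Y \<inter> hist t k K ` space M. {\<omega> \<in> space N. hist t k K \<omega> = y})"
    using N by blast
  have "{\<omega> \<in> space N. hist t k K \<omega> = y} \<in> sets N" if range: "y \<in> hist t k K ` space M" for y
  proof -
    obtain \<omega>0 where y: "y = hist t k K \<omega>0" using range by blast
    have 1: "Measurable.pred N (\<lambda>\<omega>. X \<tau> k' \<omega> = x)" if "\<tau> < t" for \<tau> k' x
      using that by measurable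
    have 2: "Measurable.pred N (\<lambda>\<omega>. mu \<tau> \<omega> = x)" if "\<tau> \<le> t" for \<tau> x
      using that by measurable
    have 3: "Measurable.pred N (\<lambda>\<omega>. X t k' \<omega> = x)" if "k' < k" for k' x
      using that by measurable
    have "Measurable.pred N (\<lambda>\<omega>. (\<forall>\<tau>\<in>{..<t}. \<forall>k'\<in>{..K}. X \<tau> k' \<omega> = X \<tau> k' \<omega>0)
        \<and> (\<forall>\<tau>\<in>{..t}. mu \<tau> \<omega> = mu \<tau> \<omega>0) \<and> (\<forall>k'\<in>{..<k}. X t k' \<omega> = X t k' \<omega>0))"
      by (intro pred_intros_logic pred_intros_finite 1 2 3) auto
    then show ?thesis by (simp add: y hist_eq_iff pred_def Ball_def)
  qed
  then show "hist t k K -` Y \<inter> space N \<in> sets N"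
    unfolding eq using finite_hist by (intro sets.finite_UN) auto
qed simp

lemma G_sub: "subalgebra M (G t k)"
  unfolding subalgebra_def space_G
  unfolding G_def by (intro conjI refl fibre_sigma_subset hist_measurable) auto

lemma G_past: "\<tau> < t \<Longrightarrow> X \<tau> k' \<in> measurable (G t k) (count_space UNIV)"
  unfolding G_def by (rule measurable_fibre_sigma[where K = k' and g = "\<lambda>(h, m, s). h \<tau> k'"]) (simp add: hist_def)

lemma G_mu: "\<tau> \<le> t \<Longrightarrow> mu \<tau> \<in> measurable (G t k) (count_space UNIV)"
  unfolding G_def by (rule measurable_fibre_sigma[where K = 0 and g = "\<lambda>(h, m, s). m \<tau>"]) (simp add: hist_def)

lemma G_current: "k' < k \<Longrightarrow> X t k' \<in> measurable (G t k) (count_space UNIV)"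
  unfolding G_def by (rule measurable_fibre_sigma[where K = 0 and g = "\<lambda>(h, m, s). s k'"]) (simp add: hist_def)

lemma G_mono: "k \<le> k' \<Longrightarrow> sets (G t k) \<subseteq> sets (G t k')"
  unfolding G_def[of t k]
  by (intro fibre_sigma_subset hist_measurable G_past G_mu G_current) (auto simp: space_G)

lemma G_Suc: "sets (G t 0) \<subseteq> sets (G (Suc t) 0)"
  unfolding G_def[of t 0]
  by (intro fibre_sigma_subset hist_measurable G_past G_mu G_current) (auto simp: space_G)

lemma measurable_G_mono: "f \<in> measurable (G t k) N \<Longrightarrow> k \<le> k' \<Longrightarrow> f \<in> measurable (G t k') N"
  using G_mono[of k k' t] by (auto simp: measurable_def space_G)

lemma measurable_G_M: "f \<in> measurable (G t k) N \<Longrightarrow> f \<in> measurable M N"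
  by (rule measurable_from_subalg[OF G_sub])

text \<open>\<open>trajectory_law\<close> ties the length of the new path to the truncation
  \<open>K\<close> of the old ones. Summing over the last state shortens the new path step by step
  while the past stays truncated at \<open>K\<close>.\<close>

lemma law_prefix:
  assumes "k \<le> K"
  shows "measure M {\<omega> \<in> space M. (\<forall>\<tau><t. \<forall>k\<le>K. X \<tau> k \<omega> = h \<tau> k) \<and> (\<forall>\<tau>\<le>t. mu \<tau> \<omega> = m \<tau>) \<and> (\<forall>k'\<le>k. X t k' \<omega> = s k')}
    = measure M {\<omega> \<in> space M. (\<forall>\<tau><t. \<forall>k\<le>K. X \<tau> k \<omega> = h \<tau> k) \<and> (\<forall>\<tau>\<le>t. mu \<tau> \<omega> = m \<tau>)}
          * (p (s 0) * (\<Prod>k'<k. P (s k') (m t (s k')) (s (Suc k'))))"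
  using assms
proof (induction arbitrary: s rule: inc_induct)
  case base
  show ?case by (rule trajectory_law)
next
  case (step n)
  let ?H = "{\<omega> \<in> space M. (\<forall>\<tau><t. \<forall>k\<le>K. X \<tau> k \<omega> = h \<tau> k) \<and> (\<forall>\<tau>\<le>t. mu \<tau> \<omega> = m \<tau>)}"
  define B where "B s n = {\<omega> \<in> space M. (\<forall>\<tau><t. \<forall>k\<le>K. X \<tau> k \<omega> = h \<tau> k) \<and> (\<forall>\<tau>\<le>t. mu \<tau> \<omega> = m \<tau>) \<and> (\<forall>k'\<le>n. X t k' \<omega> = s k')}" for s n
  let ?\<pi> = "p (s 0) * (\<Prod>k'<n. P (s k') (m t (s k')) (s (Suc k')))"
  have B_sets: "B s n \<in> sets M" for s n unfolding B_def by measurable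
  have "B s n = (\<Union>l. B (s(Suc n := l)) (Suc n))"
    by (auto simp: B_def le_Suc_eq)
  moreover have "disjoint_family (\<lambda>l. B (s(Suc n := l)) (Suc n))"
    by (auto simp: disjoint_family_on_def B_def dest!: spec[of _ "Suc n"])
  ultimately have "measure M (B s n) = (\<Sum>l\<in>UNIV. measure M (B (s(Suc n := l)) (Suc n)))"
    using B_sets by (auto intro!: finite_measure_finite_Union)
  also have "\<dots> = (\<Sum>l\<in>UNIV. measure M ?H * ?\<pi> * P (s n) (m t (s n)) l)"
  proof (intro sum.cong refl)
    fix l
    have "(\<Prod>k'<n. P ((s(Suc n := l)) k') (m t ((s(Suc n := l)) k')) ((s(Suc n := l)) (Suc k'))) =
        (\<Prod>k'<n. P (s k') (m t (s k')) (s (Suc k')))"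
      by (intro prod.cong) auto
    then show "measure M (B (s(Suc n := l)) (Suc n)) = measure M ?H * ?\<pi> * P (s n) (m t (s n)) l"
      using step.IH[of "s(Suc n := l)"] by (simp add: B_def)
  qed
  also have "\<dots> = measure M ?H * ?\<pi> * (\<Sum>l\<in>UNIV. P (s n) (m t (s n)) l)"
    by (simp add: sum_distrib_left)
  also have "\<dots> = measure M ?H * ?\<pi>"
  \<comment> \<open>An arbitrary \<open>m t\<close> need not choose admissible actions, so its
    transition row may fail to sum to 1; but then the history event is empty.\<close>
  proof (cases "?H = {}")
    case False
    then obtain \<omega> where "\<omega> \<in> space M" "mu t \<omega> = m t" by blast
    then have "m t (s n) \<in> A (s n)" using mu_in[of \<omega> t "s n"] by simp
    then show ?thesis using trans_sum by simp
  next
    case True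
    show ?thesis unfolding True by simp
  qed
  finally show ?case by (simp add: B_def)
qed

text \<open>The conditional law of \<open>X t k\<close> given \<open>G t k\<close>.\<close>

definition kernel :: "nat \<Rightarrow> nat \<Rightarrow> 'w \<Rightarrow> 's \<Rightarrow> real" where
  "kernel t k \<omega> l = (case k of 0 \<Rightarrow> p l | Suc k' \<Rightarrow> P (X t k' \<omega>) (mu t \<omega> (X t k' \<omega>)) l)"

lemma kernel_bounds:
  assumes "\<omega> \<in> space M"
  shows "0 \<le> kernel t k \<omega> l" "(\<Sum>l\<in>UNIV. kernel t k \<omega> l) = 1" "kernel t k \<omega> l \<le> 1"
proof -
  show 0: "0 \<le> kernel t k \<omega> l" for l
    using p_nonneg trans_nonneg[OF mu_in[OF assms]] by (auto simp: kernel_def split: nat.split)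
  show 1: "(\<Sum>l\<in>UNIV. kernel t k \<omega> l) = 1"
    using p_sum trans_sum[OF mu_in[OF assms]] by (cases k) (simp_all add: kernel_def)
  show "kernel t k \<omega> l \<le> 1"
    using member_le_sum[of l UNIV "kernel t k \<omega>"] 0 1 by simp
qed

lemma measurable_mu_X:
  fixes f :: "('s \<Rightarrow> 'a) \<Rightarrow> 's \<Rightarrow> 'b::topological_space"
  assumes mu: "mu t \<in> measurable N (count_space UNIV)" and X: "X t' k \<in> measurable N (count_space UNIV)"
  shows "(\<lambda>\<omega>. f (mu t \<omega>) (X t' k \<omega>)) \<in> borel_measurable N"
proof (rule measurable_compose_countable[OF _ X])
  show "(\<lambda>\<omega>. f (mu t \<omega>) i) \<in> borel_measurable N" for i
    by (rule measurable_compose[OF mu]) simp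
qed

lemma kernel_measurable: "(\<lambda>\<omega>. kernel t k \<omega> l) \<in> borel_measurable (G t k)"
proof (cases k)
  case (Suc k')
  show ?thesis unfolding kernel_def Suc nat.case
    by (rule measurable_mu_X[where f = "\<lambda>m x. P x (m x) l"]) (auto intro: G_mu G_current)
qed (simp add: kernel_def)

text \<open>The Markov property, extracted from the path law: on a fibre of the history the kernel
  is constant, and the history continued by \<open>l\<close> has the probability of the history
  times that constant.\<close>

lemma next_state_indicator:
  assumes Z: "Z \<in> borel_measurable (G t k)" "\<And>\<omega>. \<omega> \<in> space M \<Longrightarrow> \<bar>Z \<omega>\<bar> \<le> B"
  shows "expectation (\<lambda>\<omega>. Z \<omega> * (of_bool (X t k \<omega> = l) - kernel t k \<omega> l)) = 0"
proof (rule fibre_sigma_centered[OF _ finite_hist hist_measurable _ _ _ Z[unfolded G_def], where ?K0.0 = "Suc k" and b = 1])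
  have [measurable]: "(\<lambda>\<omega>. kernel t k \<omega> l) \<in> borel_measurable M"
    by (rule measurable_G_M[OF kernel_measurable])
  show "(\<lambda>\<omega>. of_bool (X t k \<omega> = l) - kernel t k \<omega> l) \<in> borel_measurable M"
    by measurable
  show "\<bar>of_bool (X t k \<omega> = l) - kernel t k \<omega> l\<bar> \<le> 1" if "\<omega> \<in> space M" for \<omega>
    using kernel_bounds(1,3)[OF that, of t k l] by auto
  show "hist t k K \<omega> = hist t k K \<omega>'" if "K \<le> K'" "hist t k K' \<omega> = hist t k K' \<omega>'" for K K' \<omega> \<omega>'
    using that by (auto simp: hist_eq_iff)
  show "expectation (\<lambda>\<omega>. indicator {\<omega> \<in> space M. hist t k K \<omega> = y} \<omega> * (of_bool (X t k \<omega> = l) - kernel t k \<omega> l)) = 0"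
    if K: "Suc k \<le> K" and range: "y \<in> hist t k K ` space M" for K y
  proof -
    obtain \<omega>0 where y: "y = hist t k K \<omega>0" and \<omega>0: "\<omega>0 \<in> space M" using range by blast
    let ?F = "{\<omega> \<in> space M. hist t k K \<omega> = y}"
    let ?F' = "{\<omega> \<in> space M. hist t k K \<omega> = y \<and> X t k \<omega> = l}"
    \<comment> \<open>The recorded states of a representative \<open>\<omega>0\<close>, continued by
      \<open>l\<close> at time \<open>k\<close>.\<close>
    define s where "s k' = (if k' < k then X t k' \<omega>0 else l)" for k'
    have [measurable]: "?F \<in> sets M" "?F' \<in> sets M"
      unfolding y hist_eq_iff by measurable
    have F': "?F' = {\<omega> \<in> space M. (\<forall>\<tau><t. \<forall>k\<le>K. X \<tau> k \<omega> = X \<tau> k \<omega>0) \<and> (\<forall>\<tau>\<le>t. mu \<tau> \<omega> = mu \<tau> \<omega>0) \<and> (\<forall>k'\<le>k. X t k' \<omega> = s k')}"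
      by (auto simp: y hist_eq_iff s_def le_less)
    \<comment> \<open>For \<open>k = 0\<close> the fibre is the conditioning event of the law
      itself. Otherwise it is a path event too, one state shorter, and the two products differ by
      the last factor.\<close>
    have "measure M ?F' = measure M ?F * kernel t k \<omega>0 l"
    proof (cases k)
      case 0
      then show ?thesis unfolding F'
        using law_prefix[OF le0, where t = t and K = K and h = "\<lambda>\<tau> k. X \<tau> k \<omega>0" and m = "\<lambda>\<tau>. mu \<tau> \<omega>0" and s = s]
        by (simp add: y hist_eq_iff kernel_def s_def)
    next
      case (Suc k')
      have F: "?F = {\<omega> \<in> space M. (\<forall>\<tau><t. \<forall>k\<le>K. X \<tau> k \<omega> = X \<tau> k \<omega>0) \<and> (\<forall>\<tau>\<le>t. mu \<tau> \<omega> = mu \<tau> \<omega>0) \<and> (\<forall>k1\<le>k'. X t k1 \<omega> = s k1)}"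
        by (auto simp: y hist_eq_iff s_def Suc less_Suc_eq_le)
      show ?thesis unfolding F' F using K Suc
        by (simp add: law_prefix kernel_def s_def)
    qed
    moreover have "expectation (\<lambda>\<omega>. indicator ?F \<omega> * (of_bool (X t k \<omega> = l) - kernel t k \<omega> l))
        = expectation (\<lambda>\<omega>. indicator ?F' \<omega> - kernel t k \<omega>0 l * indicator ?F \<omega>)"
    proof (intro Bochner_Integration.integral_cong refl)
      fix \<omega>
      have "kernel t k \<omega> l = kernel t k \<omega>0 l" if "hist t k K \<omega> = y"
        using that by (auto simp: y hist_eq_iff kernel_def split: nat.split)
      then show "indicator ?F \<omega> * (of_bool (X t k \<omega> = l) - kernel t k \<omega> l) = indicator ?F' \<omega> - kernel t k \<omega>0 l * indicator ?F \<omega>"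
        by (auto simp: indicator_def)
    qed
    moreover have "\<dots> = measure M ?F' - kernel t k \<omega>0 l * measure M ?F"
      by (subst Bochner_Integration.integral_diff) (auto simp: less_top[symmetric])
    ultimately show ?thesis by simp
  qed
qed auto

text \<open>\<open>\<phi>\<close> may depend on the information in \<open>G t k\<close>; this
  matters because the functions averaged later, such as \<open>J (mu t \<omega>)\<close>, belong to
  a random policy.\<close>

lemma next_state:
  assumes Z: "Z \<in> borel_measurable (G t k)" "\<And>\<omega>. \<omega> \<in> space M \<Longrightarrow> \<bar>Z \<omega>\<bar> \<le> B"
    and \<phi>: "\<And>l. (\<lambda>\<omega>. \<phi> \<omega> l) \<in> borel_measurable (G t k)" "\<And>\<omega> l. \<omega> \<in> space M \<Longrightarrow> \<bar>\<phi> \<omega> l\<bar> \<le> b"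
  shows "expectation (\<lambda>\<omega>. Z \<omega> * \<phi> \<omega> (X t k \<omega>)) = expectation (\<lambda>\<omega>. Z \<omega> * (\<Sum>l\<in>UNIV. kernel t k \<omega> l * \<phi> \<omega> l))"
proof -
  note [measurable] = measurable_G_M[OF Z(1)] measurable_G_M[OF \<phi>(1)] measurable_G_M[OF kernel_measurable]
  have Z\<phi>: "\<bar>Z \<omega> * \<phi> \<omega> l\<bar> \<le> B * b" if "\<omega> \<in> space M" for \<omega> l
    unfolding abs_mult using Z(2)[OF that] \<phi>(2)[OF that] by (intro mult_mono) auto
  have i1: "integrable M (\<lambda>\<omega>. Z \<omega> * \<phi> \<omega> l * of_bool (X t k \<omega> = l))" for l
  proof (rule integrable_bounded)
    show "\<bar>Z \<omega> * \<phi> \<omega> l * of_bool (X t k \<omega> = l)\<bar> \<le> B * b" if "\<omega> \<in> space M" for \<omega>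
      using Z\<phi>[OF that, of l] order_trans[OF abs_ge_zero Z\<phi>[OF that, of l]] by auto
  qed simp
  have i2: "integrable M (\<lambda>\<omega>. Z \<omega> * \<phi> \<omega> l * kernel t k \<omega> l)" for l
  proof (rule integrable_bounded)
    show "\<bar>Z \<omega> * \<phi> \<omega> l * kernel t k \<omega> l\<bar> \<le> B * b * 1" if "\<omega> \<in> space M" for \<omega>
      unfolding abs_mult[of _ "kernel t k \<omega> l"] using Z\<phi>[OF that, of l] kernel_bounds(1,3)[OF that, of t k l]
      by (intro mult_mono) (auto intro: order_trans[OF abs_ge_zero])
  qed simp
  have *: "expectation (\<lambda>\<omega>. Z \<omega> * \<phi> \<omega> l * of_bool (X t k \<omega> = l)) = expectation (\<lambda>\<omega>. Z \<omega> * \<phi> \<omega> l * kernel t k \<omega> l)" for l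
  proof -
    have "expectation (\<lambda>\<omega>. (Z \<omega> * \<phi> \<omega> l) * (of_bool (X t k \<omega> = l) - kernel t k \<omega> l)) = 0"
      using Z\<phi> by (intro next_state_indicator borel_measurable_times Z \<phi>)
    then show ?thesis using i1 i2 by (simp add: right_diff_distrib)
  qed
  have "expectation (\<lambda>\<omega>. Z \<omega> * \<phi> \<omega> (X t k \<omega>)) = expectation (\<lambda>\<omega>. \<Sum>l\<in>UNIV. Z \<omega> * \<phi> \<omega> l * of_bool (X t k \<omega> = l))"
    by (simp add: of_bool_def if_distrib[where f = "\<lambda>x. _ * x"] cong: if_cong)
  also have "\<dots> = (\<Sum>l\<in>UNIV. expectation (\<lambda>\<omega>. Z \<omega> * \<phi> \<omega> l * of_bool (X t k \<omega> = l)))"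
    by (intro Bochner_Integration.integral_sum i1)
  also have "\<dots> = expectation (\<lambda>\<omega>. \<Sum>l\<in>UNIV. Z \<omega> * \<phi> \<omega> l * kernel t k \<omega> l)"
    unfolding * by (intro Bochner_Integration.integral_sum[symmetric] i2)
  finally show ?thesis by (simp add: sum_distrib_left mult_ac)
qed

end

section \<open>Sampling noise\<close>

text \<open>This is \<open>\<alpha> ^ (K - N)\<close> from the first visit \<open>N\<close> on and 0
  before. The recursive form reads only \<open>x 0\<close>, ..., \<open>x K\<close>, so the weight
  is known when the next state is drawn.\<close>

primrec visit_weight :: "real \<Rightarrow> 's \<Rightarrow> (nat \<Rightarrow> 's) \<Rightarrow> nat \<Rightarrow> real" where
  "visit_weight \<alpha> i x 0 = of_bool (x 0 = i)"
| "visit_weight \<alpha> i x (Suc K) =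
     (if \<exists>k\<in>{..K}. x k = i then \<alpha> * visit_weight \<alpha> i x K else of_bool (x (Suc K) = i))"

lemma first_visit_eq: "visits x i \<Longrightarrow> x (first_visit x i) = i"
  unfolding visits_def first_visit_def by (rule LeastI_ex)

lemma less_first_visit: "k < first_visit x i \<Longrightarrow> x k \<noteq> i"
  unfolding first_visit_def by (rule not_less_Least)

lemma first_visit_le: "x k = i \<Longrightarrow> first_visit x i \<le> k"
  unfolding first_visit_def by (rule Least_le)

lemma visit_weight_before:
  assumes "\<And>k. k \<le> K \<Longrightarrow> x k \<noteq> i"
  shows "visit_weight \<alpha> i x K = 0"
  using assms by (cases K) auto

lemma visit_weight_after:
  assumes "visits x i"
  shows "visit_weight \<alpha> i x (first_visit x i + n) = \<alpha> ^ n"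
proof (induction n)
  case 0
  show ?case
    using first_visit_eq[OF assms] less_first_visit[of _ x i]
    by (cases "first_visit x i") (auto simp: less_Suc_eq_le)
next
  case (Suc n)
  then show ?case using first_visit_eq[OF assms] by (auto intro!: bexI[of _ "first_visit x i"])
qed

lemma visit_weight_bounds:
  assumes "0 < \<alpha>" "\<alpha> < 1"
  shows "0 \<le> visit_weight \<alpha> i x K \<and> visit_weight \<alpha> i x K \<le> 1"
  using assms by (induction K) (auto simp: mult_le_one)

context mdp
begin

text \<open>Along a trajectory of the chain under \<open>m\<close> this is a martingale; it converges to the
  difference of the sampled and the exact value of \<open>i\<close>.\<close>

primrec td_sum :: "('s \<Rightarrow> 'a) \<Rightarrow> 's \<Rightarrow> (nat \<Rightarrow> 's) \<Rightarrow> nat \<Rightarrow> real" where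
  "td_sum m i x 0 = 0"
| "td_sum m i x (Suc K) = td_sum m i x K
     + visit_weight \<alpha> i x K * (c (x K) (m (x K)) + \<alpha> * J m (x (Suc K)) - J m (x K))"

lemma td_sum_before:
  assumes "\<And>k. k < K \<Longrightarrow> x k \<noteq> i"
  shows "td_sum m i x K = 0"
  using assms
proof (induction K)
  case (Suc K)
  then show ?case using visit_weight_before[of K x i] by (simp add: less_Suc_eq_le)
qed simp

text \<open>The discounted values telescope: the last one remains, and the first visit contributes
  \<open>- J m i\<close>. In between only sampled costs are left.\<close>

lemma td_sum_after:
  assumes "visits x i"
  defines "N \<equiv> first_visit x i"
  shows "td_sum m i x (N + n) = (\<Sum>k<n. \<alpha> ^ k * c (x (N + k)) (m (x (N + k)))) + \<alpha> ^ n * J m (x (N + n)) - J m i"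
proof (induction n)
  case 0
  have "td_sum m i x N = 0" by (rule td_sum_before) (auto simp: N_def less_first_visit)
  then show ?case using first_visit_eq[OF assms(1)] by (simp add: N_def)
next
  case (Suc n)
  then show ?case using visit_weight_after[OF assms(1), of \<alpha> n] by (simp add: N_def algebra_simps)
qed

lemma tail_cost_series:
  assumes m: "is_policy A m"
  shows "summable (\<lambda>k. \<alpha> ^ k * c (x (N + k)) (m (x (N + k))))"
    "0 \<le> (\<Sum>k. \<alpha> ^ k * c (x (N + k)) (m (x (N + k))))"
    "(\<Sum>k. \<alpha> ^ k * c (x (N + k)) (m (x (N + k)))) \<le> value_bound"
    "0 \<le> (\<Sum>k<n. \<alpha> ^ k * c (x (N + k)) (m (x (N + k))))"
    "(\<Sum>k<n. \<alpha> ^ k * c (x (N + k)) (m (x (N + k)))) \<le> value_bound"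
proof -
  have c: "0 \<le> c i (m i)" "c i (m i) \<le> cost_bound" for i
    using m cost_nonneg cost_le by (auto simp: is_policy_def)
  note * = discounted_series[of "\<lambda>k. c (x (N + k)) (m (x (N + k)))", OF c]
  show s: "summable (\<lambda>k. \<alpha> ^ k * c (x (N + k)) (m (x (N + k))))"
    and "0 \<le> (\<Sum>k. \<alpha> ^ k * c (x (N + k)) (m (x (N + k))))"
    and le: "(\<Sum>k. \<alpha> ^ k * c (x (N + k)) (m (x (N + k)))) \<le> value_bound"
    by (fact *)+
  show "0 \<le> (\<Sum>k<n. \<alpha> ^ k * c (x (N + k)) (m (x (N + k))))"
    using c alpha by (intro sum_nonneg mult_nonneg_nonneg) auto
  have "(\<Sum>k<n. \<alpha> ^ k * c (x (N + k)) (m (x (N + k)))) \<le> (\<Sum>k. \<alpha> ^ k * c (x (N + k)) (m (x (N + k))))"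
    using c alpha by (intro sum_le_suminf s) auto
  then show "(\<Sum>k<n. \<alpha> ^ k * c (x (N + k)) (m (x (N + k)))) \<le> value_bound"
    using le by linarith
qed

text \<open>The value 0 without a visit lets the recursion carry the noise without an indicator and
  confines its variance to visits.\<close>

definition noise :: "('s \<Rightarrow> 'a) \<Rightarrow> 's \<Rightarrow> (nat \<Rightarrow> 's) \<Rightarrow> real" where
  "noise m i x = (if visits x i then tail_cost \<alpha> c x m i - J m i else 0)"

lemma tail_cost_bounds:
  assumes m: "is_policy A m"
  shows "0 \<le> tail_cost \<alpha> c x m i" "tail_cost \<alpha> c x m i \<le> value_bound"
  using tail_cost_series[OF m] value_bound_nonneg by (auto simp: tail_cost_def)

lemma noise_bound: "is_policy A m \<Longrightarrow> \<bar>noise m i x\<bar> \<le> value_bound"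
  using tail_cost_bounds[of m x i] J_bounds[of m i] value_bound_nonneg by (auto simp: noise_def)

lemma td_sum_LIMSEQ:
  assumes m: "is_policy A m"
  shows "td_sum m i x \<longlonglongrightarrow> noise m i x"
proof (cases "visits x i")
  case True
  define N where "N = first_visit x i"
  have J0: "(\<lambda>n. \<alpha> ^ n * J m (x (N + n))) \<longlonglongrightarrow> 0"
  proof (rule tendsto_sandwich[where f = "\<lambda>_. 0" and h = "\<lambda>n. \<alpha> ^ n * value_bound"])
    show "(\<lambda>n. \<alpha> ^ n * value_bound) \<longlonglongrightarrow> 0"
      using alpha by (intro tendsto_mult_left_zero LIMSEQ_power_zero) auto
    show "eventually (\<lambda>n. 0 \<le> \<alpha> ^ n * J m (x (N + n))) sequentially"
      using alpha J_bounds[OF m] by auto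
    show "eventually (\<lambda>n. \<alpha> ^ n * J m (x (N + n)) \<le> \<alpha> ^ n * value_bound) sequentially"
      using alpha J_bounds[OF m] by (auto intro!: mult_left_mono)
  qed simp
  have "(\<lambda>n. td_sum m i x (N + n)) \<longlonglongrightarrow> (\<Sum>k. \<alpha> ^ k * c (x (N + k)) (m (x (N + k)))) + 0 - J m i"
    unfolding N_def td_sum_after[OF True]
    using J0 by (intro tendsto_intros summable_LIMSEQ tail_cost_series m) (simp add: N_def)
  then have "(\<lambda>n. td_sum m i x (n + N)) \<longlonglongrightarrow> noise m i x"
    using True by (simp add: noise_def tail_cost_def N_def add.commute)
  then show ?thesis by (rule LIMSEQ_offset)
next
  case False
  then have "td_sum m i x = (\<lambda>_. 0)" by (intro ext td_sum_before) (auto simp: visits_def)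
  then show ?thesis using False by (simp add: noise_def)
qed

text \<open>Uniform in \<open>K\<close>, this supplies the dominating constant for the passage from
  finite sums to the full sampling error.\<close>

lemma td_sum_bound:
  assumes m: "is_policy A m"
  shows "\<bar>td_sum m i x K\<bar> \<le> 2 * value_bound"
proof (cases "\<forall>k<K. x k \<noteq> i")
  case True
  then show ?thesis using td_sum_before[of K x i m] value_bound_nonneg by simp
next
  case False
  then have v: "visits x i" and "first_visit x i < K"
    using first_visit_le[of x _ i] by (auto simp: visits_def intro: le_less_trans)
  then obtain n where K: "K = first_visit x i + n" using less_imp_add_positive by blast
  have "\<alpha> ^ n * J m (x K) \<le> 1 * value_bound"
    using alpha J_bounds[OF m, of "x K"] by (intro mult_mono power_le_one) auto
  moreover have "0 \<le> \<alpha> ^ n * J m (x K)" using alpha J_bounds[OF m, of "x K"] by simp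
  ultimately show ?thesis
    unfolding K td_sum_after[OF v]
    using tail_cost_series(4,5)[OF m, where n = n and x = x and N = "first_visit x i"] J_bounds[OF m, of i] by (simp add: K)
qed

end

context opi
begin

section \<open>Expectations along one trajectory\<close>

lemma measurable_mu_fun: "mu t \<in> measurable N (count_space UNIV) \<Longrightarrow> (\<lambda>\<omega>. f (mu t \<omega>)) \<in> borel_measurable N"
  for f :: "('s \<Rightarrow> 'a) \<Rightarrow> 'b::topological_space"
  by (erule measurable_compose) simp

text \<open>Induction on the number of steps: avoidance at the present state is absorbed into
  \<open>Z\<close>, the induction hypothesis treats the later states, and \<open>next_state\<close>
  averages over the next one, which reproduces the recursion of \<open>hitprob\<close>.\<close>

lemma avoid_probability:
  assumes Z: "Z \<in> borel_measurable (G t (Suc k))" "\<And>\<omega>. \<omega> \<in> space M \<Longrightarrow> \<bar>Z \<omega>\<bar> \<le> B"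
  shows "expectation (\<lambda>\<omega>. Z \<omega> * of_bool (\<forall>r\<in>{..L}. X t (k + r) \<omega> \<noteq> j))
    = expectation (\<lambda>\<omega>. Z \<omega> * (1 - hitprob P (mu t \<omega>) L j (X t k \<omega>)))"
  using Z
proof (induction L arbitrary: Z k)
  case 0
  then show ?case by (intro Bochner_Integration.integral_cong) auto
next
  case (Suc L)
  define Z' where "Z' \<omega> = Z \<omega> * of_bool (X t k \<omega> \<noteq> j)" for \<omega>
  have [measurable]: "X t k \<in> measurable (G t (Suc k)) (count_space UNIV)"
    by (intro G_current) simp
  note [measurable] = Suc.prems(1)
  have Z'G: "Z' \<in> borel_measurable (G t (Suc k))" unfolding Z'_def by measurable
  have Z'b: "\<bar>Z' \<omega>\<bar> \<le> B" if "\<omega> \<in> space M" for \<omega>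
    using Suc.prems(2)[OF that] order_trans[OF abs_ge_zero Suc.prems(2)[OF that]] by (auto simp: Z'_def)
  have "expectation (\<lambda>\<omega>. Z \<omega> * of_bool (\<forall>r\<in>{..Suc L}. X t (k + r) \<omega> \<noteq> j))
      = expectation (\<lambda>\<omega>. Z' \<omega> * of_bool (\<forall>r\<in>{..L}. X t (Suc k + r) \<omega> \<noteq> j))"
    unfolding Z'_def atMost_Suc_eq_insert_0
    by (intro Bochner_Integration.integral_cong) (auto simp: image_image)
  also have "\<dots> = expectation (\<lambda>\<omega>. Z' \<omega> * (1 - hitprob P (mu t \<omega>) L j (X t (Suc k) \<omega>)))"
    by (rule Suc.IH[OF measurable_G_mono[OF Z'G] Z'b]) auto
  also have "\<dots> = expectation (\<lambda>\<omega>. Z' \<omega> * (\<Sum>l\<in>UNIV. kernel t (Suc k) \<omega> l * (1 - hitprob P (mu t \<omega>) L j l)))"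
  proof (rule next_state[OF Z'G Z'b])
    show "(\<lambda>\<omega>. 1 - hitprob P (mu t \<omega>) L j l) \<in> borel_measurable (G t (Suc k))" for l
      by (rule measurable_mu_fun) (auto intro: G_mu)
    show "\<bar>1 - hitprob P (mu t \<omega>) L j l\<bar> \<le> 1" if "\<omega> \<in> space M" for \<omega> l
      using hitprob_bounds[OF mu_policy[OF that], of t L j l] by auto
  qed
  also have "\<dots> = expectation (\<lambda>\<omega>. Z \<omega> * (1 - hitprob P (mu t \<omega>) (Suc L) j (X t k \<omega>)))"
  proof (intro Bochner_Integration.integral_cong refl)
    fix \<omega> assume \<omega>: "\<omega> \<in> space M"
    have "(\<Sum>l\<in>UNIV. kernel t (Suc k) \<omega> l * (1 - hitprob P (mu t \<omega>) L j l))
        = 1 - (\<Sum>l\<in>UNIV. kernel t (Suc k) \<omega> l * hitprob P (mu t \<omega>) L j l)"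
      using kernel_bounds(2)[OF \<omega>, of t "Suc k"] by (simp add: right_diff_distrib sum_subtractf)
    then show "Z' \<omega> * (\<Sum>l\<in>UNIV. kernel t (Suc k) \<omega> l * (1 - hitprob P (mu t \<omega>) L j l))
        = Z \<omega> * (1 - hitprob P (mu t \<omega>) (Suc L) j (X t k \<omega>))"
      by (simp add: Z'_def kernel_def)
  qed
  finally show ?case .
qed

text \<open>A draw from the initial distribution is put in front of
  \<open>avoid_probability\<close>, and complements are taken.\<close>

lemma visit_probability:
  assumes Z: "Z \<in> borel_measurable (G t 0)" "\<And>\<omega>. \<omega> \<in> space M \<Longrightarrow> \<bar>Z \<omega>\<bar> \<le> B"
  shows "expectation (\<lambda>\<omega>. Z \<omega> * ((\<Sum>l\<in>UNIV. p l * hitprob P (mu t \<omega>) L j l) - of_bool (\<exists>r\<in>{..L}. X t r \<omega> = j))) = 0"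
proof -
  have hit: "(\<lambda>\<omega>. hitprob P (mu t \<omega>) L j l) \<in> borel_measurable (G t 0)" for l
    by (rule measurable_mu_fun) (auto intro: G_mu)
  have hit1: "\<bar>1 - hitprob P (mu t \<omega>) L j l\<bar> \<le> 1" if "\<omega> \<in> space M" for \<omega> l
    using hitprob_bounds[OF mu_policy[OF that], of t L j l] by auto
  have B: "0 \<le> B" using Z(2) not_empty by (metis abs_ge_zero ex_in_conv order_trans)
  note [measurable] = measurable_G_M[OF Z(1)] measurable_G_M[OF hit]
  let ?s = "\<lambda>\<omega>. \<Sum>l\<in>UNIV. p l * (1 - hitprob P (mu t \<omega>) L j l)"
  have s1: "\<bar>?s \<omega>\<bar> \<le> 1" if "\<omega> \<in> space M" for \<omega>
  proof -
    have "\<bar>?s \<omega>\<bar> \<le> (\<Sum>l\<in>UNIV. p l * 1)"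
      using hit1[OF that] p_nonneg
      by (intro order_trans[OF sum_abs] sum_mono) (auto simp: abs_mult intro!: mult_left_mono simp del: mult_1_right)
    then show ?thesis using p_sum by simp
  qed
  have eq: "expectation (\<lambda>\<omega>. Z \<omega> * of_bool (\<forall>r\<in>{..L}. X t r \<omega> \<noteq> j)) = expectation (\<lambda>\<omega>. Z \<omega> * ?s \<omega>)"
  proof -
    have "expectation (\<lambda>\<omega>. Z \<omega> * of_bool (\<forall>r\<in>{..L}. X t (0 + r) \<omega> \<noteq> j))
        = expectation (\<lambda>\<omega>. Z \<omega> * (1 - hitprob P (mu t \<omega>) L j (X t 0 \<omega>)))"
      by (rule avoid_probability[OF measurable_G_mono[OF Z(1)] Z(2)]) auto
    also have "\<dots> = expectation (\<lambda>\<omega>. Z \<omega> * (\<Sum>l\<in>UNIV. kernel t 0 \<omega> l * (1 - hitprob P (mu t \<omega>) L j l)))"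
      by (rule next_state[OF Z]) (use hit hit1 in auto)
    finally show ?thesis by (simp add: kernel_def)
  qed
  have i1: "integrable M (\<lambda>\<omega>. Z \<omega> * of_bool (\<forall>r\<in>{..L}. X t r \<omega> \<noteq> j))"
    by (rule integrable_bounded[where B = B]) (use Z(2) B in auto)
  have i2: "integrable M (\<lambda>\<omega>. Z \<omega> * ?s \<omega>)"
  proof (rule integrable_bounded)
    show "\<bar>Z \<omega> * ?s \<omega>\<bar> \<le> B * 1" if "\<omega> \<in> space M" for \<omega>
      unfolding abs_mult[of "Z \<omega>"] using Z(2)[OF that] s1[OF that] B by (intro mult_mono) auto
  qed simp
  have "expectation (\<lambda>\<omega>. Z \<omega> * ((\<Sum>l\<in>UNIV. p l * hitprob P (mu t \<omega>) L j l) - of_bool (\<exists>r\<in>{..L}. X t r \<omega> = j)))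
      = expectation (\<lambda>\<omega>. Z \<omega> * of_bool (\<forall>r\<in>{..L}. X t r \<omega> \<noteq> j) - Z \<omega> * ?s \<omega>)"
  proof (intro Bochner_Integration.integral_cong refl)
    fix \<omega>
    have "?s \<omega> = 1 - (\<Sum>l\<in>UNIV. p l * hitprob P (mu t \<omega>) L j l)"
      using p_sum by (simp add: right_diff_distrib sum_subtractf)
    moreover have "of_bool (\<forall>r\<in>{..L}. X t r \<omega> \<noteq> j) = 1 - (of_bool (\<exists>r\<in>{..L}. X t r \<omega> = j) :: real)"
      by auto
    ultimately show "Z \<omega> * ((\<Sum>l\<in>UNIV. p l * hitprob P (mu t \<omega>) L j l) - of_bool (\<exists>r\<in>{..L}. X t r \<omega> = j))
        = Z \<omega> * of_bool (\<forall>r\<in>{..L}. X t r \<omega> \<noteq> j) - Z \<omega> * ?s \<omega>"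
      by (simp only: right_diff_distrib)
  qed
  also have "\<dots> = 0" using i1 i2 eq by simp
  finally show ?thesis .
qed

lemma visit_weight_measurable:
  assumes "K < k"
  shows "(\<lambda>\<omega>. visit_weight \<alpha> i (\<lambda>k. X t k \<omega>) K) \<in> borel_measurable (G t k)"
  using assms
proof (induction K)
  case 0
  then have [measurable]: "X t 0 \<in> measurable (G t k) (count_space UNIV)" by (rule G_current)
  show ?case by simp
next
  case (Suc K)
  have [measurable]: "(\<lambda>\<omega>. visit_weight \<alpha> i (\<lambda>k. X t k \<omega>) K) \<in> borel_measurable (G t k)"
    using Suc by simp
  have [measurable]: "X t (Suc K) \<in> measurable (G t k) (count_space UNIV)"
    using Suc.prems by (rule G_current)
  have [measurable]: "X t k' \<in> measurable (G t k) (count_space UNIV)" if "k' \<in> {..K}" for k'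
    using that Suc.prems by (intro G_current) auto
  show ?case by simp
qed

lemma td_sum_measurable: "(\<lambda>\<omega>. td_sum (mu t \<omega>) i (\<lambda>k. X t k \<omega>) K) \<in> borel_measurable (G t (Suc K))"
proof (induction K)
  case (Suc K)
  have [measurable]: "(\<lambda>\<omega>. td_sum (mu t \<omega>) i (\<lambda>k. X t k \<omega>) K) \<in> borel_measurable (G t (Suc (Suc K)))"
    using Suc by (rule measurable_G_mono) simp
  have [measurable]: "(\<lambda>\<omega>. visit_weight \<alpha> i (\<lambda>k. X t k \<omega>) K) \<in> borel_measurable (G t (Suc (Suc K)))"
    by (rule visit_weight_measurable) simp
  have [measurable]: "(\<lambda>\<omega>. c (X t K \<omega>) (mu t \<omega> (X t K \<omega>))) \<in> borel_measurable (G t (Suc (Suc K)))"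
    by (rule measurable_mu_X[where f = "\<lambda>m x. c x (m x)"]) (auto intro: G_mu G_current)
  have [measurable]: "(\<lambda>\<omega>. J (mu t \<omega>) (X t k \<omega>)) \<in> borel_measurable (G t (Suc (Suc K)))" if "k \<le> Suc K" for k
    using that by (intro measurable_mu_X[where f = J]) (auto intro: G_mu G_current)
  show ?case by simp
qed simp

text \<open>Given the path so far, the expected temporal difference is 0 by the Bellman equation of
  \<open>J (mu t)\<close>; the visit weight is already known at that time and joins the factor
  \<open>Z\<close>.\<close>

lemma td_sum_centered:
  assumes Z: "Z \<in> borel_measurable (G t 0)" "\<And>\<omega>. \<omega> \<in> space M \<Longrightarrow> \<bar>Z \<omega>\<bar> \<le> B"
  shows "expectation (\<lambda>\<omega>. Z \<omega> * td_sum (mu t \<omega>) i (\<lambda>k. X t k \<omega>) K) = 0"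
proof (induction K)
  case (Suc K)
  have B: "0 \<le> B" using Z(2) not_empty by (metis abs_ge_zero ex_in_conv order_trans)
  define Z' where "Z' \<omega> = Z \<omega> * visit_weight \<alpha> i (\<lambda>k. X t k \<omega>) K" for \<omega>
  have Z'G: "Z' \<in> borel_measurable (G t (Suc K))"
    unfolding Z'_def using measurable_G_mono[OF Z(1)]
    by (intro borel_measurable_times visit_weight_measurable) auto
  have Z'b: "\<bar>Z' \<omega>\<bar> \<le> B * 1" if "\<omega> \<in> space M" for \<omega>
    unfolding Z'_def abs_mult using Z(2)[OF that] visit_weight_bounds[OF alpha, of i _ K] B
    by (intro mult_mono) auto
  have Jb: "\<bar>J (mu t \<omega>) l\<bar> \<le> value_bound" if "\<omega> \<in> space M" for \<omega> l
    using J_bounds[OF mu_policy[OF that], of t l] by auto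
  have JG: "(\<lambda>\<omega>. J (mu t \<omega>) l) \<in> borel_measurable (G t (Suc K))" for l
    by (rule measurable_mu_fun) (auto intro: G_mu)
  have "expectation (\<lambda>\<omega>. Z' \<omega> * J (mu t \<omega>) (X t (Suc K) \<omega>))
      = expectation (\<lambda>\<omega>. Z' \<omega> * (\<Sum>l\<in>UNIV. kernel t (Suc K) \<omega> l * J (mu t \<omega>) l))"
    by (rule next_state[OF Z'G Z'b JG Jb])
  then have eq: "expectation (\<lambda>\<omega>. \<alpha> * (Z' \<omega> * J (mu t \<omega>) (X t (Suc K) \<omega>)))
      = expectation (\<lambda>\<omega>. \<alpha> * (Z' \<omega> * (\<Sum>l\<in>UNIV. kernel t (Suc K) \<omega> l * J (mu t \<omega>) l)))"
    by simp
  note [measurable] = measurable_G_M[OF Z(1)] measurable_G_M[OF td_sum_measurable] measurable_G_M[OF Z'G]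
    measurable_G_M[OF JG] measurable_G_M[OF kernel_measurable]
  have [measurable]: "(\<lambda>\<omega>. J (mu t \<omega>) (X t k \<omega>)) \<in> borel_measurable M" for k
    by (rule measurable_mu_X[where f = J]) auto
  have i1: "integrable M (\<lambda>\<omega>. Z \<omega> * td_sum (mu t \<omega>) i (\<lambda>k. X t k \<omega>) K)"
  proof (rule integrable_bounded)
    show "\<bar>Z \<omega> * td_sum (mu t \<omega>) i (\<lambda>k. X t k \<omega>) K\<bar> \<le> B * (2 * value_bound)" if "\<omega> \<in> space M" for \<omega>
      unfolding abs_mult using Z(2)[OF that] td_sum_bound[OF mu_policy[OF that]] B by (intro mult_mono) auto
  qed simp
  have i2: "integrable M (\<lambda>\<omega>. \<alpha> * (Z' \<omega> * J (mu t \<omega>) (X t (Suc K) \<omega>)))"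
  proof (rule integrable_bounded)
    show "\<bar>\<alpha> * (Z' \<omega> * J (mu t \<omega>) (X t (Suc K) \<omega>))\<bar> \<le> 1 * (B * 1 * value_bound)" if "\<omega> \<in> space M" for \<omega>
      unfolding abs_mult using Z'b[OF that] Jb[OF that] B alpha by (intro mult_mono mult_nonneg_nonneg) auto
  qed simp
  have avg_bound: "\<bar>\<Sum>l\<in>UNIV. kernel t (Suc K) \<omega> l * J (mu t \<omega>) l\<bar> \<le> value_bound" if "\<omega> \<in> space M" for \<omega>
  proof -
    have u: "mu t \<omega> (X t K \<omega>) \<in> A (X t K \<omega>)" using mu_in[OF that] .
    show ?thesis
      unfolding kernel_def nat.case
      using avg_le[OF u, where f = "J (mu t \<omega>)" and b = value_bound] avg_ge[OF u, where f = "J (mu t \<omega>)" and b = 0]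
        J_bounds[OF mu_policy[OF that]] by simp
  qed
  have i3: "integrable M (\<lambda>\<omega>. \<alpha> * (Z' \<omega> * (\<Sum>l\<in>UNIV. kernel t (Suc K) \<omega> l * J (mu t \<omega>) l)))"
  proof (rule integrable_bounded)
    show "\<bar>\<alpha> * (Z' \<omega> * (\<Sum>l\<in>UNIV. kernel t (Suc K) \<omega> l * J (mu t \<omega>) l))\<bar> \<le> 1 * (B * 1 * value_bound)" if "\<omega> \<in> space M" for \<omega>
      unfolding abs_mult[of \<alpha>] abs_mult[of "Z' \<omega>"] using Z'b[OF that] avg_bound[OF that] B alpha by (intro mult_mono mult_nonneg_nonneg) auto
  qed simp
  have "expectation (\<lambda>\<omega>. Z \<omega> * td_sum (mu t \<omega>) i (\<lambda>k. X t k \<omega>) (Suc K))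
      = expectation (\<lambda>\<omega>. Z \<omega> * td_sum (mu t \<omega>) i (\<lambda>k. X t k \<omega>) K + (\<alpha> * (Z' \<omega> * J (mu t \<omega>) (X t (Suc K) \<omega>))
          - \<alpha> * (Z' \<omega> * (\<Sum>l\<in>UNIV. kernel t (Suc K) \<omega> l * J (mu t \<omega>) l))))"
  proof (intro Bochner_Integration.integral_cong refl)
    fix \<omega> assume "\<omega> \<in> space M"
    then have "J (mu t \<omega>) (X t K \<omega>) = Q (J (mu t \<omega>)) (X t K \<omega>) (mu t \<omega> (X t K \<omega>))"
      by (intro J_Bellman mu_policy)
    then have "\<alpha> * (\<Sum>l\<in>UNIV. kernel t (Suc K) \<omega> l * J (mu t \<omega>) l) = J (mu t \<omega>) (X t K \<omega>) - c (X t K \<omega>) (mu t \<omega> (X t K \<omega>))"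
      by (simp add: Q_def kernel_def)
    then have "\<alpha> * (Z' \<omega> * (\<Sum>l\<in>UNIV. kernel t (Suc K) \<omega> l * J (mu t \<omega>) l)) = Z' \<omega> * (J (mu t \<omega>) (X t K \<omega>) - c (X t K \<omega>) (mu t \<omega> (X t K \<omega>)))"
      by (simp only: mult.left_commute[of \<alpha>])
    then show "Z \<omega> * td_sum (mu t \<omega>) i (\<lambda>k. X t k \<omega>) (Suc K)
        = Z \<omega> * td_sum (mu t \<omega>) i (\<lambda>k. X t k \<omega>) K + (\<alpha> * (Z' \<omega> * J (mu t \<omega>) (X t (Suc K) \<omega>))
          - \<alpha> * (Z' \<omega> * (\<Sum>l\<in>UNIV. kernel t (Suc K) \<omega> l * J (mu t \<omega>) l)))"
      by (simp add: Z'_def algebra_simps)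
  qed
  also have "\<dots> = 0"
    using Suc eq
    by (simp only: Bochner_Integration.integral_add Bochner_Integration.integral_diff i1 i2 i3 Bochner_Integration.integrable_diff)
  finally show ?case .
qed simp

abbreviation traj :: "nat \<Rightarrow> 'w \<Rightarrow> nat \<Rightarrow> 's" where
  "traj t \<omega> \<equiv> (\<lambda>k. X t k \<omega>)"

definition W :: "nat \<Rightarrow> 's \<Rightarrow> 'w \<Rightarrow> real" where
  "W t i \<omega> = noise (mu t \<omega>) i (traj t \<omega>)"

lemma W_bound: "\<omega> \<in> space M \<Longrightarrow> \<bar>W t i \<omega>\<bar> \<le> value_bound"
  unfolding W_def by (rule noise_bound[OF mu_policy])

lemma W_measurable_in:
  assumes N: "space N = space M" "\<And>K. (\<lambda>\<omega>. td_sum (mu t \<omega>) i (traj t \<omega>) K) \<in> borel_measurable N"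
  shows "W t i \<in> borel_measurable N"
proof (rule borel_measurable_LIMSEQ_real[OF _ N(2)])
  show "(\<lambda>K. td_sum (mu t \<omega>) i (traj t \<omega>) K) \<longlonglongrightarrow> W t i \<omega>" if "\<omega> \<in> space N" for \<omega>
    using that unfolding W_def N by (rule td_sum_LIMSEQ[OF mu_policy])
qed

lemma G_Suc_current: "f \<in> measurable (G t k) N \<Longrightarrow> f \<in> measurable (G (Suc t) 0) N"
proof -
  have "sets (G t k) \<subseteq> sets (G (Suc t) 0)"
    unfolding G_def[of t k]
    by (intro fibre_sigma_subset hist_measurable G_past G_mu G_current) (auto simp: space_G)
  then show "f \<in> measurable (G t k) N \<Longrightarrow> f \<in> measurable (G (Suc t) 0) N"
    by (auto simp: measurable_def space_G)
qed

lemma W_measurable: "W t i \<in> borel_measurable (G (Suc t) 0)"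
  by (intro W_measurable_in G_Suc_current[OF td_sum_measurable] space_G)

text \<open>The finite sums \<open>td_sum\<close> are centered at every length and uniformly
  bounded, so centering passes to their limit, the error of the full trajectory.\<close>

lemma W_centered:
  assumes Z: "Z \<in> borel_measurable (G t 0)" "\<And>\<omega>. \<omega> \<in> space M \<Longrightarrow> \<bar>Z \<omega>\<bar> \<le> B"
  shows "expectation (\<lambda>\<omega>. Z \<omega> * W t i \<omega>) = 0"
proof -
  have B: "0 \<le> B" using Z(2) not_empty by (metis abs_ge_zero ex_in_conv order_trans)
  note [measurable] = measurable_G_M[OF Z(1)] measurable_G_M[OF td_sum_measurable] measurable_G_M[OF W_measurable]
  have "(\<lambda>K. expectation (\<lambda>\<omega>. Z \<omega> * td_sum (mu t \<omega>) i (traj t \<omega>) K)) \<longlonglongrightarrow> expectation (\<lambda>\<omega>. Z \<omega> * W t i \<omega>)"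
  proof (rule integral_dominated_convergence[where w = "\<lambda>_. B * (2 * value_bound)"])
    show "AE \<omega> in M. (\<lambda>K. Z \<omega> * td_sum (mu t \<omega>) i (traj t \<omega>) K) \<longlonglongrightarrow> Z \<omega> * W t i \<omega>"
      unfolding W_def by (intro AE_I2 tendsto_mult tendsto_const td_sum_LIMSEQ mu_policy)
    show "AE \<omega> in M. norm (Z \<omega> * td_sum (mu t \<omega>) i (traj t \<omega>) K) \<le> B * (2 * value_bound)" for K
      unfolding real_norm_def abs_mult
      using Z(2) td_sum_bound[OF mu_policy] B by (intro AE_I2 mult_mono) auto
  qed auto
  then show ?thesis using LIMSEQ_unique[OF _ tendsto_const] td_sum_centered[OF Z] by simp
qed

section \<open>Step sizes: summable noise and divergence at visits\<close>

abbreviation step :: "nat \<Rightarrow> 's \<Rightarrow> 'w \<Rightarrow> real" where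
  "step t i \<omega> \<equiv> step_size \<beta> cnt (\<lambda>\<tau> k. X \<tau> k \<omega>) t i"

lemma step_range: "0 < step t i \<omega>" "step t i \<omega> \<le> 1"
  using beta_range by (auto simp: step_size_def)

lemma visits_measurable:
  assumes "\<And>k. X t k \<in> measurable N (count_space UNIV)"
  shows "Measurable.pred N (\<lambda>\<omega>. visits (traj t \<omega>) i)"
proof -
  note [measurable] = assms
  show ?thesis unfolding visits_def by measurable
qed

text \<open>Even the counted step is known before trajectory \<open>t\<close> is drawn, as the
  counter looks only at earlier iterations.\<close>

lemma step_measurable: "step t i \<in> borel_measurable (G t 0)"
proof -
  have "{\<omega> \<in> space (G t 0). \<tau> \<in> {\<tau>. \<tau> < t \<and> visits (traj \<tau> \<omega>) i}} \<in> sets (G t 0)" for \<tau>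
    using visits_measurable[of \<tau> "G t 0" i, OF G_past] by (cases "\<tau> < t") (auto simp: pred_def)
  then have card: "(\<lambda>\<omega>. card {\<tau>. \<tau> < t \<and> visits (traj \<tau> \<omega>) i}) \<in> measurable (G t 0) (count_space UNIV)"
    by (rule measurable_card)
  have *: "(\<lambda>\<omega>. \<beta> (card {\<tau>. \<tau> < t \<and> visits (traj \<tau> \<omega>) i})) \<in> borel_measurable (G t 0)"
    by (rule measurable_compose[OF card]) simp
  have eq: "step t i = (\<lambda>\<omega>. if cnt then \<beta> (card {\<tau>. \<tau> < t \<and> visits (traj \<tau> \<omega>) i}) else \<beta> t)"
    by (simp only: step_size_def)
  show ?thesis
    unfolding eq using * by (cases cnt) (simp_all only: if_True if_False borel_measurable_const)
qed

text \<open>With counting, the steps at visits are the terms of \<open>\<beta>\<close> with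
  different indices. The restriction to visits matters there: between visits the counter stands
  still and the same step would be summed repeatedly.\<close>

lemma sum_step_sq_le: "(\<Sum>t<T. of_bool (visits (traj t \<omega>) i) * (step t i \<omega>)\<^sup>2) \<le> (\<Sum>t. (\<beta> t)\<^sup>2)"
proof (cases cnt)
  case True
  have "(\<Sum>t<T. of_bool (visits (traj t \<omega>) i) * (step t i \<omega>)\<^sup>2)
      = (\<Sum>n<card {\<sigma>. \<sigma> < T \<and> visits (traj \<sigma> \<omega>) i}. (\<beta> n)\<^sup>2)"
    unfolding sum_over_visits[symmetric] using True by (intro sum.cong) (auto simp: step_size_def)
  also have "\<dots> \<le> (\<Sum>t. (\<beta> t)\<^sup>2)" by (intro sum_le_suminf beta_sq) auto
  finally show ?thesis .
next
  case False
  have "(\<Sum>t<T. of_bool (visits (traj t \<omega>) i) * (step t i \<omega>)\<^sup>2) \<le> (\<Sum>t<T. (\<beta> t)\<^sup>2)"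
    using False by (intro sum_mono) (auto simp: step_size_def)
  also have "\<dots> \<le> (\<Sum>t. (\<beta> t)\<^sup>2)" by (intro sum_le_suminf beta_sq) auto
  finally show ?thesis .
qed

text \<open>The weights \<open>a\<close> are known before the trajectory. The constant 1 gives the
  noise itself; transition probabilities of the current policy give the noise as it enters the
  Bellman residual.\<close>

lemma noise_summable:
  assumes a: "\<And>t. a t \<in> borel_measurable (G t 0)" "\<And>t \<omega>. \<omega> \<in> space M \<Longrightarrow> \<bar>a t \<omega>\<bar> \<le> 1"
  shows "AE \<omega> in M. summable (\<lambda>t. a t \<omega> * (step t i \<omega> * W t i \<omega>))"
proof (rule L2_martingale_summable[where F = "\<lambda>t. G t 0" and b = value_bound and C = "value_bound\<^sup>2 * (\<Sum>t. (\<beta> t)\<^sup>2)"])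
  note vb = value_bound_nonneg
  have as: "\<bar>a t \<omega> * step t i \<omega>\<bar> \<le> 1" if "\<omega> \<in> space M" for t \<omega>
    unfolding abs_mult using a(2)[OF that, of t] step_range[where t = t and i = i and \<omega> = \<omega>] by (auto intro: mult_le_one)
  show "subalgebra M (G t 0)" "sets (G t 0) \<subseteq> sets (G (Suc t) 0)" for t by (fact G_sub G_Suc)+
  show D: "(\<lambda>\<omega>. a t \<omega> * (step t i \<omega> * W t i \<omega>)) \<in> borel_measurable (G (Suc t) 0)" for t
    by (intro borel_measurable_times W_measurable G_Suc_current[OF a(1)] G_Suc_current[OF step_measurable])
  show bound: "\<bar>a t \<omega> * (step t i \<omega> * W t i \<omega>)\<bar> \<le> value_bound" if "\<omega> \<in> space M" for t \<omega>
  proof -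
    have "\<bar>(a t \<omega> * step t i \<omega>) * W t i \<omega>\<bar> \<le> 1 * value_bound"
      unfolding abs_mult[of _ "W t i \<omega>"] using as[OF that, of t] W_bound[OF that, of t i] by (intro mult_mono) auto
    then show ?thesis by (simp add: mult.assoc)
  qed
  show "expectation (\<lambda>\<omega>. Z \<omega> * (a t \<omega> * (step t i \<omega> * W t i \<omega>))) = 0"
    if Z: "Z \<in> borel_measurable (G t 0)" "\<And>\<omega>. \<omega> \<in> space M \<Longrightarrow> \<bar>Z \<omega>\<bar> \<le> B" for t Z B
  proof -
    have "expectation (\<lambda>\<omega>. (Z \<omega> * (a t \<omega> * step t i \<omega>)) * W t i \<omega>) = 0"
    proof (rule W_centered)
      show "(\<lambda>\<omega>. Z \<omega> * (a t \<omega> * step t i \<omega>)) \<in> borel_measurable (G t 0)"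
        by (intro borel_measurable_times Z a step_measurable)
      show "\<bar>Z \<omega> * (a t \<omega> * step t i \<omega>)\<bar> \<le> B * 1" if "\<omega> \<in> space M" for \<omega>
        unfolding abs_mult[of "Z \<omega>"] using Z(2)[OF that] as[OF that, of t] by (intro mult_mono) auto
    qed
    then show ?thesis by (simp add: mult.assoc)
  qed
  show "(\<Sum>t<T. expectation (\<lambda>\<omega>. (a t \<omega> * (step t i \<omega> * W t i \<omega>))\<^sup>2)) \<le> value_bound\<^sup>2 * (\<Sum>t. (\<beta> t)\<^sup>2)" for T
  proof -
    note [measurable] = measurable_G_M[OF D]
    have int: "integrable M (\<lambda>\<omega>. (a t \<omega> * (step t i \<omega> * W t i \<omega>))\<^sup>2)" for t
    proof (rule integrable_bounded)
      show "\<bar>(a t \<omega> * (step t i \<omega> * W t i \<omega>))\<^sup>2\<bar> \<le> value_bound\<^sup>2" if "\<omega> \<in> space M" for \<omega>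
        using power_mono[OF bound[OF that, of t], of 2] by simp
    qed simp
    have "(\<Sum>t<T. expectation (\<lambda>\<omega>. (a t \<omega> * (step t i \<omega> * W t i \<omega>))\<^sup>2))
        = expectation (\<lambda>\<omega>. \<Sum>t<T. (a t \<omega> * (step t i \<omega> * W t i \<omega>))\<^sup>2)"
      using int by (intro Bochner_Integration.integral_sum[symmetric]) auto
    \<comment> \<open>Under counting the steps are random, so the variances are bounded inside the
      expectation, path by path.\<close>
    also have "\<dots> \<le> expectation (\<lambda>\<omega>. value_bound\<^sup>2 * (\<Sum>t. (\<beta> t)\<^sup>2))"
    proof (intro integral_mono Bochner_Integration.integrable_sum int integrable_const)
      fix \<omega> assume \<omega>: "\<omega> \<in> space M"
      have "(\<Sum>t<T. (a t \<omega> * (step t i \<omega> * W t i \<omega>))\<^sup>2)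
          \<le> (\<Sum>t<T. value_bound\<^sup>2 * (of_bool (visits (traj t \<omega>) i) * (step t i \<omega>)\<^sup>2))"
      proof (intro sum_mono)
        fix t
        show "(a t \<omega> * (step t i \<omega> * W t i \<omega>))\<^sup>2 \<le> value_bound\<^sup>2 * (of_bool (visits (traj t \<omega>) i) * (step t i \<omega>)\<^sup>2)"
        proof (cases "visits (traj t \<omega>) i")
          case True
          have "(a t \<omega>)\<^sup>2 \<le> 1" using a(2)[OF \<omega>, of t] by (simp add: abs_square_le_1)
          moreover have "(W t i \<omega>)\<^sup>2 \<le> value_bound\<^sup>2" using power_mono[OF W_bound[OF \<omega>, of t i], of 2] by simp
          ultimately have "(a t \<omega>)\<^sup>2 * (W t i \<omega>)\<^sup>2 \<le> 1 * value_bound\<^sup>2" by (intro mult_mono) auto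
          then have "((a t \<omega>)\<^sup>2 * (W t i \<omega>)\<^sup>2) * (step t i \<omega>)\<^sup>2 \<le> value_bound\<^sup>2 * (step t i \<omega>)\<^sup>2"
            by (intro mult_right_mono) auto
          then show ?thesis using True by (simp add: power_mult_distrib mult_ac)
        qed (simp add: W_def noise_def)
      qed
      also have "\<dots> \<le> value_bound\<^sup>2 * (\<Sum>t. (\<beta> t)\<^sup>2)"
        unfolding sum_distrib_left[symmetric] by (intro mult_left_mono sum_step_sq_le) auto
      finally show "(\<Sum>t<T. (a t \<omega> * (step t i \<omega> * W t i \<omega>))\<^sup>2) \<le> value_bound\<^sup>2 * (\<Sum>t. (\<beta> t)\<^sup>2)" .
    qed
    finally show ?thesis by (simp add: prob_space)
  qed
qed

text \<open>A weighted form of the conditional Borel-Cantelli lemma: visits within \<open>K\<close>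
  steps and their conditional probabilities, weighted by \<open>\<beta>\<close>, differ by a
  summable series, and those probabilities are at least \<open>\<delta>\<close>. The weights are
  \<open>\<beta> t\<close> also under counting, where the result serves to show that visits never
  cease.\<close>

lemma visit_steps_diverge: "AE \<omega> in M. \<not> summable (\<lambda>t. of_bool (visits (traj t \<omega>) i) * \<beta> t)"
proof -
  obtain K \<delta> where \<delta>: "0 < \<delta>" and hit: "\<And>m i. is_policy A m \<Longrightarrow> \<delta> \<le> (\<Sum>j\<in>UNIV. p j * hitprob P m K i j)"
  proof (rule uniform_hitting[OF A1])
    fix K \<delta> assume "0 < \<delta>" "\<And>m i. is_policy A m \<Longrightarrow> \<delta> \<le> (\<Sum>j\<in>UNIV. p j * hitprob P m K i j)"
    then show thesis by (rule that)
  qed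
  let ?q = "\<lambda>t \<omega>. \<Sum>j\<in>UNIV. p j * hitprob P (mu t \<omega>) K i j"
  let ?V = "\<lambda>t \<omega>. of_bool (\<exists>r\<in>{..K}. X t r \<omega> = i) :: real"
  have q: "0 \<le> ?q t \<omega>" "?q t \<omega> \<le> 1" if "\<omega> \<in> space M" for t \<omega>
  proof -
    note h = hitprob_bounds[OF mu_policy[OF that], of t K i]
    show "0 \<le> ?q t \<omega>" using h p_nonneg by (intro sum_nonneg) auto
    have "?q t \<omega> \<le> (\<Sum>j\<in>UNIV. p j * 1)" using h p_nonneg by (intro sum_mono mult_left_mono) auto
    then show "?q t \<omega> \<le> 1" using p_sum by simp
  qed
  have b: "\<bar>\<beta> t\<bar> \<le> 1" for t using beta_range[of t] by simp
  have "AE \<omega> in M. summable (\<lambda>t. \<beta> t * (?q t \<omega> - ?V t \<omega>))"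
  proof (rule L2_martingale_summable[where F = "\<lambda>t. G t 0" and b = 1 and C = "\<Sum>t. (\<beta> t)\<^sup>2"])
    show "subalgebra M (G t 0)" "sets (G t 0) \<subseteq> sets (G (Suc t) 0)" for t by (fact G_sub G_Suc)+
    have qm: "?q t \<in> borel_measurable (G (Suc t) 0)" for t
      by (rule measurable_mu_fun) (auto intro: G_mu)
    have [measurable]: "X t r \<in> measurable (G (Suc t) 0) (count_space UNIV)" for t r
      by (intro G_past) simp
    note [measurable] = qm
    show D: "(\<lambda>\<omega>. \<beta> t * (?q t \<omega> - ?V t \<omega>)) \<in> borel_measurable (G (Suc t) 0)" for t
      by simp
    show bound: "\<bar>\<beta> t * (?q t \<omega> - ?V t \<omega>)\<bar> \<le> 1" if "\<omega> \<in> space M" for t \<omega>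
      unfolding abs_mult using b[of t] q[OF that, of t] by (intro mult_le_one) auto
    show "expectation (\<lambda>\<omega>. Z \<omega> * (\<beta> t * (?q t \<omega> - ?V t \<omega>))) = 0"
      if Z: "Z \<in> borel_measurable (G t 0)" "\<And>\<omega>. \<omega> \<in> space M \<Longrightarrow> \<bar>Z \<omega>\<bar> \<le> B" for t Z B
    proof -
      have "expectation (\<lambda>\<omega>. \<beta> t * (Z \<omega> * (?q t \<omega> - ?V t \<omega>))) = 0"
        using visit_probability[OF Z, of K i] by simp
      then show ?thesis by (simp only: mult.left_commute[of "\<beta> t"])
    qed
    show "(\<Sum>t<T. expectation (\<lambda>\<omega>. (\<beta> t * (?q t \<omega> - ?V t \<omega>))\<^sup>2)) \<le> (\<Sum>t. (\<beta> t)\<^sup>2)" for T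
    proof -
      have "expectation (\<lambda>\<omega>. (\<beta> t * (?q t \<omega> - ?V t \<omega>))\<^sup>2) \<le> (\<beta> t)\<^sup>2" for t
      proof -
        have le: "(\<beta> t * (?q t \<omega> - ?V t \<omega>))\<^sup>2 \<le> (\<beta> t)\<^sup>2" if "\<omega> \<in> space M" for \<omega>
        proof -
          have "\<bar>?q t \<omega> - ?V t \<omega>\<bar> \<le> 1" using q[OF that, of t] by auto
          then have "(?q t \<omega> - ?V t \<omega>)\<^sup>2 \<le> 1" by (simp only: abs_square_le_1)
          then have "(\<beta> t)\<^sup>2 * (?q t \<omega> - ?V t \<omega>)\<^sup>2 \<le> (\<beta> t)\<^sup>2 * 1" by (intro mult_left_mono) auto
          then show ?thesis by (simp only: power_mult_distrib mult_1_right)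
        qed
        have "expectation (\<lambda>\<omega>. (\<beta> t * (?q t \<omega> - ?V t \<omega>))\<^sup>2) \<le> expectation (\<lambda>\<omega>. (\<beta> t)\<^sup>2)"
        proof (rule integral_mono[OF _ integrable_const le])
          show "integrable M (\<lambda>\<omega>. (\<beta> t * (?q t \<omega> - ?V t \<omega>))\<^sup>2)"
          proof (rule integrable_bounded)
            show "(\<lambda>\<omega>. (\<beta> t * (?q t \<omega> - ?V t \<omega>))\<^sup>2) \<in> borel_measurable M"
              by (rule borel_measurable_power[OF measurable_G_M[OF D]])
            show "\<bar>(\<beta> t * (?q t \<omega> - ?V t \<omega>))\<^sup>2\<bar> \<le> (\<beta> t)\<^sup>2" if "\<omega> \<in> space M" for \<omega>
              using le[OF that] by (simp only: abs_power2)
          qed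
        qed
        then show ?thesis by (simp add: prob_space)
      qed
      then have "(\<Sum>t<T. expectation (\<lambda>\<omega>. (\<beta> t * (?q t \<omega> - ?V t \<omega>))\<^sup>2)) \<le> (\<Sum>t<T. (\<beta> t)\<^sup>2)"
        by (intro sum_mono)
      also have "\<dots> \<le> (\<Sum>t. (\<beta> t)\<^sup>2)" by (intro sum_le_suminf beta_sq) auto
      finally show ?thesis .
    qed
  qed
  then show ?thesis
    using AE_space
  proof eventually_elim
    case (elim \<omega>)
    show ?case
    proof
      assume s: "summable (\<lambda>t. of_bool (visits (traj t \<omega>) i) * \<beta> t)"
      have "summable (\<lambda>t. ?V t \<omega> * \<beta> t)"
        using beta_range by (intro summable_comparison_test'[OF s, of 0]) (auto simp: visits_def less_imp_le)
      then have "summable (\<lambda>t. \<beta> t * (?q t \<omega> - ?V t \<omega>) + ?V t \<omega> * \<beta> t)"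
        using elim(1) by (rule summable_add[rotated])
      then have q': "summable (\<lambda>t. ?q t \<omega> * \<beta> t)" by (simp add: algebra_simps)
      have "summable (\<lambda>t. \<delta> * \<beta> t)"
      proof (rule summable_comparison_test'[OF q', of 0])
        show "norm (\<delta> * \<beta> t) \<le> ?q t \<omega> * \<beta> t" for t
          using hit[OF mu_policy[OF elim(2)], of t i] beta_range[of t] \<delta> by (auto simp: abs_mult intro!: mult_right_mono)
      qed
      then show False using beta_sum \<delta> by (simp add: summable_cmult_iff)
    qed
  qed
qed

text \<open>Infinitely many visits turn \<open>\<beta>(n\<^sub>t(i))\<close> into the full sequence \<open>\<beta>\<close>.\<close>

lemma steps_diverge: "AE \<omega> in M. \<not> summable (\<lambda>t. of_bool (visits (traj t \<omega>) i) * step t i \<omega>)"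
  using visit_steps_diverge[of i]
proof eventually_elim
  case (elim \<omega>)
  let ?V = "\<lambda>t. visits (traj t \<omega>) i"
  show ?case
  proof (cases cnt)
    case False
    then show ?thesis using elim by (simp add: step_size_def)
  next
    case True
    let ?n = "\<lambda>t. card {\<sigma>. \<sigma> < t \<and> ?V \<sigma>}"
    have inf: "infinite {t. ?V t}"
    proof
      assume "finite {t. ?V t}"
      then have "summable (\<lambda>t. of_bool (?V t) * \<beta> t)" by (intro summable_finite) auto
      then show False using elim by blast
    qed
    show ?thesis
    proof
      assume s: "summable (\<lambda>t. of_bool (?V t) * step t i \<omega>)"
      have "(\<Sum>n<N. \<beta> n) \<le> (\<Sum>t. of_bool (?V t) * step t i \<omega>)" for N
      proof -
        \<comment> \<open>Some \<open>N\<close> visits are completed before \<open>T\<close>, so the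
          first \<open>N\<close> terms of \<open>\<beta>\<close> have been used by then.\<close>
        obtain S where S: "finite S" "S \<subseteq> {t. ?V t}" "card S = N"
          using infinite_arbitrarily_large[OF inf] by blast
        define T where "T = Suc (Max (insert 0 S))"
        have "S \<subseteq> {\<sigma>. \<sigma> < T \<and> ?V \<sigma>}" using S by (auto simp: T_def less_Suc_eq_le)
        then have N: "N \<le> ?n T" using S(3) card_mono[of "{\<sigma>. \<sigma> < T \<and> ?V \<sigma>}" S] by simp
        have "(\<Sum>n<N. \<beta> n) \<le> (\<Sum>n<?n T. \<beta> n)"
          using N beta_range by (intro sum_mono2) (auto simp: less_imp_le)
        also have "\<dots> = (\<Sum>t<T. of_bool (?V t) * step t i \<omega>)"
          unfolding sum_over_visits[symmetric] using True by (intro sum.cong) (auto simp: step_size_def)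
        also have "\<dots> \<le> (\<Sum>t. of_bool (?V t) * step t i \<omega>)"
          using step_range(1) by (intro sum_le_suminf s) (auto simp: less_imp_le)
        finally show ?thesis .
      qed
      then have "summable \<beta>"
        by (intro bounded_imp_summable[of \<beta> "\<Sum>t. of_bool (?V t) * step t i \<omega>"])
          (use beta_range in \<open>auto simp: less_imp_le lessThan_Suc_atMost[symmetric] simp del: sum.lessThan_Suc\<close>)
      then show False using beta_sum by blast
    qed
  qed
qed

lemma AE_not_from_expectation:
  assumes "{\<omega> \<in> space M. R \<omega>} \<in> sets M" "expectation (\<lambda>\<omega>. of_bool (R \<omega>)) \<le> (0 :: real)"
  shows "AE \<omega> in M. \<not> R \<omega>"
proof -
  have "prob {\<omega> \<in> space M. R \<omega>} = expectation (indicator {\<omega> \<in> space M. R \<omega>})"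
    using assms(1) by simp
  also have "\<dots> = expectation (\<lambda>\<omega>. of_bool (R \<omega>))"
    by (intro Bochner_Integration.integral_cong) (auto simp: indicator_def)
  finally have "prob {\<omega> \<in> space M. R \<omega>} = 0" using assms(2) measure_nonneg[of M "{\<omega> \<in> space M. R \<omega>}"] by linarith
  then have "{\<omega> \<in> space M. R \<omega>} \<in> null_sets M"
    using assms(1) by (intro null_setsI) (auto simp: emeasure_eq_measure)
  then show ?thesis by (rule AE_I') auto
qed

text \<open>Hence all states of a recurrent class share the same step sizes.\<close>

lemma recurrent_visits:
  assumes rec: "i \<notin> transient_states A P" and ij: "(i, j) \<in> E\<^sup>*"
  shows "AE \<omega> in M. \<forall>t. visits (traj t \<omega>) i \<longrightarrow> visits (traj t \<omega>) j"
proof -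
  \<comment> \<open>The trajectory is cut at a time \<open>K\<close> at which it is in
    \<open>i\<close>: the probability of avoiding \<open>j\<close> for \<open>L\<close> further
    steps tends to 0, because the hitting probability within a recurrent class is 1.\<close>
  have "AE \<omega> in M. \<not> (X t K \<omega> = i \<and> (\<forall>r. X t (K + r) \<omega> \<noteq> j))" for t K
  proof (rule AE_not_from_expectation)
    show "{\<omega> \<in> space M. X t K \<omega> = i \<and> (\<forall>r. X t (K + r) \<omega> \<noteq> j)} \<in> sets M" by measurable
    let ?Z = "\<lambda>\<omega>. of_bool (X t K \<omega> = i) :: real"
    have [measurable]: "X t K \<in> measurable (G t (Suc K)) (count_space UNIV)" by (intro G_current) simp
    have le: "expectation (\<lambda>\<omega>. of_bool (X t K \<omega> = i \<and> (\<forall>r. X t (K + r) \<omega> \<noteq> j)))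
        \<le> expectation (\<lambda>\<omega>. ?Z \<omega> * (1 - hitprob P (mu t \<omega>) L j (X t K \<omega>)))" for L
    proof -
      have "expectation (\<lambda>\<omega>. of_bool (X t K \<omega> = i \<and> (\<forall>r. X t (K + r) \<omega> \<noteq> j)))
          \<le> expectation (\<lambda>\<omega>. ?Z \<omega> * of_bool (\<forall>r\<in>{..L}. X t (K + r) \<omega> \<noteq> j))"
        by (intro integral_mono integrable_bounded[where B = 1]) auto
      also have "\<dots> = expectation (\<lambda>\<omega>. ?Z \<omega> * (1 - hitprob P (mu t \<omega>) L j (X t K \<omega>)))"
        by (rule avoid_probability[where B = 1]) auto
      finally show ?thesis .
    qed
    have "(\<lambda>L. expectation (\<lambda>\<omega>. ?Z \<omega> * (1 - hitprob P (mu t \<omega>) L j (X t K \<omega>)))) \<longlonglongrightarrow> expectation (\<lambda>\<omega>. 0)"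
    proof (rule integral_dominated_convergence[where w = "\<lambda>_. 1"])
      have [measurable]: "(\<lambda>\<omega>. hitprob P (mu t \<omega>) L j (X t K \<omega>)) \<in> borel_measurable M" for L
        by (rule measurable_mu_X[where f = "\<lambda>m. hitprob P m L j"]) auto
      show "(\<lambda>\<omega>. ?Z \<omega> * (1 - hitprob P (mu t \<omega>) L j (X t K \<omega>))) \<in> borel_measurable M" for L
        by measurable
      show "AE \<omega> in M. (\<lambda>L. ?Z \<omega> * (1 - hitprob P (mu t \<omega>) L j (X t K \<omega>))) \<longlonglongrightarrow> 0"
      proof (rule AE_I2)
        fix \<omega> assume "\<omega> \<in> space M"
        note m = mu_policy[OF this, of t]
        have "(\<lambda>L. hitprob P (mu t \<omega>) L j i) \<longlonglongrightarrow> 1"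
          using hitprob_LIMSEQ[OF m, of j i] hit_recurrent[OF A2 m rec rtrancl.rtrancl_refl ij] by simp
        then have "(\<lambda>L. 1 - hitprob P (mu t \<omega>) L j i) \<longlonglongrightarrow> 1 - 1" by (intro tendsto_intros)
        then show "(\<lambda>L. ?Z \<omega> * (1 - hitprob P (mu t \<omega>) L j (X t K \<omega>))) \<longlonglongrightarrow> 0"
          by (cases "X t K \<omega> = i") auto
      qed
      show "AE \<omega> in M. norm (?Z \<omega> * (1 - hitprob P (mu t \<omega>) L j (X t K \<omega>))) \<le> 1" for L
        using hitprob_bounds[OF mu_policy, of _ t L j] by (intro AE_I2) auto
    qed auto
    then have "expectation (\<lambda>\<omega>. of_bool (X t K \<omega> = i \<and> (\<forall>r. X t (K + r) \<omega> \<noteq> j))) \<le> expectation (\<lambda>\<omega>. 0 :: real)"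
      by (rule LIMSEQ_le_const) (use le in blast)
    then show "expectation (\<lambda>\<omega>. of_bool (X t K \<omega> = i \<and> (\<forall>r. X t (K + r) \<omega> \<noteq> j))) \<le> (0 :: real)"
      by simp
  qed
  then have "AE \<omega> in M. \<forall>t K. \<not> (X t K \<omega> = i \<and> (\<forall>r. X t (K + r) \<omega> \<noteq> j))"
    by (simp add: AE_all_countable)
  then show ?thesis by eventually_elim (auto simp: visits_def)
qed

end

section \<open>Convergence\<close>

context mdp
begin

text \<open>A state reached from \<open>j\<close> is also reached from \<open>i\<close>, hence leads
  back to \<open>i\<close> and along the edge to \<open>j\<close>.\<close>

lemma recurrent_step:
  assumes "i \<notin> transient_states A P" "(i, j) \<in> E"
  shows "j \<notin> transient_states A P"
proof
  assume "j \<in> transient_states A P"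
  then obtain k where k: "(j, k) \<in> E\<^sup>*" "(k, j) \<notin> E\<^sup>*" by (auto simp: transient_states_def)
  have "(i, k) \<in> E\<^sup>*" using assms(2) k(1) by (rule converse_rtrancl_into_rtrancl)
  then have "(k, i) \<in> E\<^sup>*" using assms(1) by (auto simp: transient_states_def)
  then show False using k(2) assms(2) by (meson rtrancl.rtrancl_into_rtrancl)
qed

text \<open>The deterministic core, for one sample path: \<open>g\<close> will be the step size
  times the visit indicator and \<open>d\<close> the noise scaled by the step. Only an upper bound
  on \<open>x\<close> is assumed, because \<open>J (m t) \<ge> Jopt\<close> controls it from
  below.\<close>

theorem pathwise_convergence:
  fixes x :: "nat \<Rightarrow> 's \<Rightarrow> real" and m :: "nat \<Rightarrow> 's \<Rightarrow> 'a" and g d :: "nat \<Rightarrow> 's \<Rightarrow> real"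
  assumes A3: "acyclic (E \<inter> (transient_states A P \<times> transient_states A P))"
    and rec: "\<And>t i. x (Suc t) i = (1 - g t i) * x t i + g t i * J (m t) i + d t i"
    and greedy: "\<And>t. greedy A \<alpha> P c (x t) (m t)"
    and g: "\<And>t i. 0 \<le> g t i" "\<And>t i. g t i \<le> 1" "\<And>i. \<not> summable (\<lambda>t. g t i)"
    and d: "\<And>i. summable (\<lambda>t. d t i)" "\<And>i j. summable (\<lambda>t. P i (m t i) j * d t j)"
    and same: "\<And>t i j. i \<notin> transient_states A P \<Longrightarrow> (i, j) \<in> E \<Longrightarrow> g t i = g t j"
    and bound: "\<And>t i. x t i \<le> b"
  shows "(\<lambda>t. x t i) \<longlonglongrightarrow> Jopt i"
proof -
  let ?R = "- transient_states A P"
  have m: "is_policy A (m t)" for t using greedy[of t] by (auto simp: greedy_def is_policy_def)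
  have u: "m t i \<in> A i" for t i using m[of t] by (auto simp: is_policy_def)
  have gr: "Q (x t) i (m t i) \<le> Q (x t) i v" if "v \<in> A i" for t i v
    using greedy[of t] that by (auto simp: greedy_Q)
  have next_in: "j \<in> ?R" if "i \<in> ?R" "P i (m t i) j > 0" for i j t
    using recurrent_step[of i j] edgeI[OF u that(2)] that(1) by blast
  have Jopt0: "0 \<le> Jopt i" for i by (rule optimal_policy) (use J_bounds in auto)

  have lower: "eventually (\<lambda>t. Jopt i - \<epsilon> \<le> x t i) sequentially" if "0 < \<epsilon>" for i \<epsilon>
    using Jopt_le_J[OF m] that
    by (intro stochastic_recursion_lower[where g = "\<lambda>t. g t i" and r = "\<lambda>t. J (m t) i" and d = "\<lambda>t. d t i"])
      (auto simp: rec g d)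

  \<comment> \<open>Keeping the action of \<open>m t\<close> at time \<open>t + 1\<close> can only
    increase the minimum. For a fixed action \<open>Q\<close> is affine, the common step comes out
    of the average, and the Bellman equation of \<open>J (m t)\<close> cancels the target of
    \<open>x\<close>, so no drift remains.\<close>
  have residual: "eventually (\<lambda>t. Q (x t) i (m t i) - x t i \<le> 0 + \<epsilon>) sequentially"
    if "0 < \<epsilon>" and i: "i \<in> ?R" for i \<epsilon>
  proof (rule stochastic_recursion_upper[where g = "\<lambda>t. g t i" and r = "\<lambda>t. 0"
        and d = "\<lambda>t. \<alpha> * (\<Sum>j\<in>UNIV. P i (m t i) j * d t j) - d t i"])
    show "summable (\<lambda>t. \<alpha> * (\<Sum>j\<in>UNIV. P i (m t i) j * d t j) - d t i)"
      by (intro summable_diff summable_mult summable_sum d)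
    show "Q (x (Suc t)) i (m (Suc t) i) - x (Suc t) i
        \<le> (1 - g t i) * (Q (x t) i (m t i) - x t i) + g t i * 0 + (\<alpha> * (\<Sum>j\<in>UNIV. P i (m t i) j * d t j) - d t i)" for t
    proof -
      have "P i (m t i) j * x (Suc t) j
          = (1 - g t i) * (P i (m t i) j * x t j) + g t i * (P i (m t i) j * J (m t) j) + P i (m t i) j * d t j" for j
      proof (cases "P i (m t i) j > 0")
        case True
        then have "g t i = g t j" using same[of i j t] i edgeI[OF u True] by blast
        then show ?thesis by (simp add: rec algebra_simps)
      next
        case False
        then show ?thesis using trans_nonneg[OF u[of t i], of j] by simp
      qed
      then have avg: "(\<Sum>j\<in>UNIV. P i (m t i) j * x (Suc t) j) = (1 - g t i) * (\<Sum>j\<in>UNIV. P i (m t i) j * x t j)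
          + g t i * (\<Sum>j\<in>UNIV. P i (m t i) j * J (m t) j) + (\<Sum>j\<in>UNIV. P i (m t i) j * d t j)"
        by (simp only: sum.distrib sum_distrib_left)
      have "Q (x (Suc t)) i (m t i) = (1 - g t i) * Q (x t) i (m t i) + g t i * Q (J (m t)) i (m t i)
          + \<alpha> * (\<Sum>j\<in>UNIV. P i (m t i) j * d t j)"
        unfolding Q_def avg by (simp add: algebra_simps)
      moreover have "Q (x (Suc t)) i (m (Suc t) i) \<le> Q (x (Suc t)) i (m t i)" by (rule gr[OF u])
      moreover have "Q (J (m t)) i (m t i) = J (m t) i" using J_Bellman[OF m] by simp
      ultimately show ?thesis by (simp add: rec algebra_simps)
    qed
  qed (use g \<open>0 < \<epsilon>\<close> in auto)

  have J_upper: "eventually (\<lambda>t. \<forall>i\<in>?R. J (m t) i \<le> Q (x t) i (m t i) + \<epsilon>) sequentially" if \<epsilon>: "0 < \<epsilon>" for \<epsilon>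
  proof -
    \<comment> \<open>The factor \<open>1 - \<alpha>\<close> in the tolerance makes up for the
      division in the maximum principle.\<close>
    have "eventually (\<lambda>t. \<forall>i\<in>?R. Q (x t) i (m t i) - x t i \<le> 0 + \<epsilon> * (1 - \<alpha>)) sequentially"
      using \<epsilon> alpha by (intro eventually_ball_finite ballI residual) auto
    then show ?thesis
    proof eventually_elim
      case (elim t)
      have e: "J (m t) i - x t i \<le> \<epsilon> * (1 - \<alpha>) / (1 - \<alpha>)" if "i \<in> ?R" for i
      proof (rule discounted_max_principle[OF m next_in _ that])
        fix i assume "i \<in> ?R"
        then have "Q (x t) i (m t i) - x t i \<le> \<epsilon> * (1 - \<alpha>)" using elim by simp
        then show "J (m t) i - x t i \<le> \<alpha> * (\<Sum>j\<in>UNIV. P i (m t i) j * (J (m t) j - x t j)) + \<epsilon> * (1 - \<alpha>)"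
          using J_Bellman[OF m, of t i] Q_diff[of "J (m t)" i "m t i" "x t"] by linarith
      qed
      show ?case
      proof
        fix i assume i: "i \<in> ?R"
        have "Q (J (m t)) i (m t i) \<le> Q (x t) i (m t i) + \<alpha> * \<epsilon>"
        proof (rule Q_le_shift[OF u])
          fix j assume "0 < P i (m t i) j"
          then have "j \<in> ?R" using next_in[OF i] by blast
          then show "J (m t) j \<le> x t j + \<epsilon>" using e[of j] alpha by simp
        qed
        moreover have "\<alpha> * \<epsilon> \<le> \<epsilon>" using alpha \<epsilon> by simp
        ultimately show "J (m t) i \<le> Q (x t) i (m t i) + \<epsilon>" using J_Bellman[OF m, of t i] by linarith
      qed
    qed
  qed

  \<comment> \<open>The greedy action is no worse than one attaining \<open>Jopt\<close>, which
    passes on the error of the successors with a factor \<open>\<alpha>\<close>.\<close>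
  have Q_upper: "Q (x t) i (m t i) \<le> Jopt i + \<alpha> * B"
    if "\<And>j. (i, j) \<in> E \<Longrightarrow> x t j \<le> Jopt j + B" for t i B
  proof -
    obtain v where v: "v \<in> A i" "Jopt i = Q Jopt i v" using Jopt_attained[of i] by blast
    have "Q (x t) i (m t i) \<le> Q (x t) i v" using gr[OF v(1)] .
    also have "\<dots> \<le> Q Jopt i v + \<alpha> * B" using that edgeI[OF v(1)] by (intro Q_le_shift[OF v(1)]) blast
    finally show ?thesis using v(2) by simp
  qed

  \<comment> \<open>The value of the current policy is included because a transient predecessor
    needs both quantities at its successors.\<close>
  define conv where "conv i \<longleftrightarrow> (\<forall>\<epsilon>>0. eventually (\<lambda>t. \<bar>x t i - Jopt i\<bar> \<le> \<epsilon> \<and> J (m t) i \<le> Jopt i + \<epsilon>) sequentially)" for i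

  have convI: "conv i"
    if ev: "\<And>\<epsilon>. 0 < \<epsilon> \<Longrightarrow> eventually (\<lambda>t. J (m t) i \<le> Jopt i + \<epsilon>) sequentially" for i
    unfolding conv_def
  proof (intro allI impI)
    fix \<epsilon> :: real assume \<epsilon>: "0 < \<epsilon>"
    have "eventually (\<lambda>t. x t i \<le> (Jopt i + \<epsilon> / 2) + \<epsilon> / 2) sequentially"
      using ev[of "\<epsilon> / 2"] \<epsilon>
      by (intro stochastic_recursion_upper[where x = "\<lambda>t. x t i" and \<rho> = "Jopt i + \<epsilon> / 2" and g = "\<lambda>t. g t i" and r = "\<lambda>t. J (m t) i" and d = "\<lambda>t. d t i"])
        (auto simp: rec g d)
    then show "eventually (\<lambda>t. \<bar>x t i - Jopt i\<bar> \<le> \<epsilon> \<and> J (m t) i \<le> Jopt i + \<epsilon>) sequentially"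
      using lower[OF \<epsilon>, of i] ev[OF \<epsilon>] by eventually_elim auto
  qed

  \<comment> \<open>Each round multiplies the excess over \<open>Jopt\<close> by
    \<open>\<alpha>\<close> and adds \<open>\<epsilon>\<close>; the constant
    \<open>\<epsilon> / (1 - \<alpha>)\<close> is the fixed point of this map and is therefore
    preserved. The start uses \<open>Jopt \<ge> 0\<close>.\<close>
  have recurrent_bound: "eventually (\<lambda>t. \<forall>i\<in>?R. x t i \<le> Jopt i + (\<alpha> ^ n * max b 0 + \<epsilon> / (1 - \<alpha>))) sequentially"
    if \<epsilon>: "0 < \<epsilon>" for n \<epsilon>
  proof (induction n)
    case 0
    have "x t i \<le> Jopt i + (max b 0 + \<epsilon> / (1 - \<alpha>))" for t i
      using bound[of t i] Jopt0[of i] \<epsilon> alpha divide_pos_pos[of \<epsilon> "1 - \<alpha>"] by linarith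
    then show ?case by simp
  next
    case (Suc n)
    let ?B = "\<alpha> ^ n * max b 0 + \<epsilon> / (1 - \<alpha>)"
    have J_le: "eventually (\<lambda>t. \<forall>i\<in>?R. J (m t) i \<le> Jopt i + \<alpha> * ?B + \<epsilon> / 2) sequentially"
      using Suc J_upper[OF half_gt_zero[OF \<epsilon>]]
    proof eventually_elim
      case (elim t)
      show ?case
      proof
        fix i assume i: "i \<in> ?R"
        then have "Q (x t) i (m t i) \<le> Jopt i + \<alpha> * ?B"
          using elim(1) recurrent_step[of i] by (intro Q_upper) blast
        then show "J (m t) i \<le> Jopt i + \<alpha> * ?B + \<epsilon> / 2" using elim(2) i by force
      qed
    qed
    have "eventually (\<lambda>t. x t i \<le> (Jopt i + \<alpha> * ?B + \<epsilon> / 2) + \<epsilon> / 2) sequentially" if i: "i \<in> ?R" for i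
    proof (rule stochastic_recursion_upper[where g = "\<lambda>t. g t i" and r = "\<lambda>t. J (m t) i" and d = "\<lambda>t. d t i"])
      show "eventually (\<lambda>t. J (m t) i \<le> Jopt i + \<alpha> * ?B + \<epsilon> / 2) sequentially"
        using J_le by eventually_elim (use i in blast)
    qed (use \<epsilon> in \<open>auto simp: rec g d\<close>)
    then have "eventually (\<lambda>t. \<forall>i\<in>?R. x t i \<le> (Jopt i + \<alpha> * ?B + \<epsilon> / 2) + \<epsilon> / 2) sequentially"
      by (intro eventually_ball_finite ballI) auto
    moreover have "\<alpha> * ?B + \<epsilon> = \<alpha> ^ Suc n * max b 0 + \<epsilon> / (1 - \<alpha>)"
      using alpha by (simp add: field_simps)
    ultimately show ?case by (simp add: add.assoc)
  qed

  have conv_recurrent: "conv i" if i: "i \<in> ?R" for i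
  proof (rule convI)
    fix \<epsilon> :: real assume \<epsilon>: "0 < \<epsilon>"
    have "(\<lambda>n. \<alpha> ^ n * max b 0) \<longlonglongrightarrow> 0"
      using alpha by (intro tendsto_mult_left_zero LIMSEQ_power_zero) auto
    then have "eventually (\<lambda>n. \<alpha> ^ n * max b 0 < \<epsilon> / 4) sequentially"
      using \<epsilon> by (intro order_tendstoD) auto
    then obtain n where n: "\<alpha> ^ n * max b 0 < \<epsilon> / 4" by (auto simp: eventually_sequentially)
    have "eventually (\<lambda>t. \<forall>i\<in>?R. x t i \<le> Jopt i + (\<alpha> ^ n * max b 0 + \<epsilon> / 4 * (1 - \<alpha>) / (1 - \<alpha>))) sequentially"
      using \<epsilon> alpha by (intro recurrent_bound) auto
    then show "eventually (\<lambda>t. J (m t) i \<le> Jopt i + \<epsilon>) sequentially"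
      using J_upper[OF half_gt_zero[OF \<epsilon>]]
    proof eventually_elim
      case (elim t)
      have "x t j \<le> Jopt j + \<epsilon> / 2" if "(i, j) \<in> E" for j
      proof -
        have "j \<in> ?R" using recurrent_step[of i j] that i by blast
        then have "x t j \<le> Jopt j + (\<alpha> ^ n * max b 0 + \<epsilon> / 4 * (1 - \<alpha>) / (1 - \<alpha>))" using elim(1) by blast
        also have "\<epsilon> / 4 * (1 - \<alpha>) / (1 - \<alpha>) = \<epsilon> / 4"
          using alpha by (intro nonzero_mult_div_cancel_right) simp
        finally show ?thesis using n by linarith
      qed
      then have "Q (x t) i (m t i) \<le> Jopt i + \<alpha> * (\<epsilon> / 2)" by (rule Q_upper)
      moreover have "\<alpha> * (\<epsilon> / 2) \<le> \<epsilon> / 2" using alpha \<epsilon> by simp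
      moreover have "J (m t) i \<le> Q (x t) i (m t i) + \<epsilon> / 2" using elim(2) i by blast
      ultimately show ?case by linarith
    qed
  qed

  have "conv i" for i
  proof -
    let ?T = "E \<inter> (transient_states A P \<times> transient_states A P)"
    \<comment> \<open>Induction runs from the successors backwards, as the converse of a finite
      acyclic relation is well-founded.\<close>
    have "wf (?T\<inverse>)" using A3 by (intro finite_acyclic_wf_converse) auto
    then show ?thesis
    proof (induction i rule: wf_induct_rule)
      case (less i)
      show ?case
      proof (cases "i \<in> ?R")
        case False
        have succ: "conv j" if "(i, j) \<in> E" for j
          using less[of j] conv_recurrent[of j] False that by blast
        show ?thesis
        proof (rule convI)
          fix \<epsilon> :: real assume \<epsilon>: "0 < \<epsilon>"
          have "eventually (\<lambda>t. \<forall>j\<in>{j. (i, j) \<in> E}. \<bar>x t j - Jopt j\<bar> \<le> \<epsilon> / 3 \<and> J (m t) j \<le> Jopt j + \<epsilon> / 3) sequentially"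
          proof (intro eventually_ball_finite ballI)
            fix j assume "j \<in> {j. (i, j) \<in> E}"
            then have "conv j" using succ by simp
            moreover have "0 < \<epsilon> / 3" using \<epsilon> by simp
            ultimately show "eventually (\<lambda>t. \<bar>x t j - Jopt j\<bar> \<le> \<epsilon> / 3 \<and> J (m t) j \<le> Jopt j + \<epsilon> / 3) sequentially"
              unfolding conv_def by blast
          qed simp
          then show "eventually (\<lambda>t. J (m t) i \<le> Jopt i + \<epsilon>) sequentially"
          proof eventually_elim
            case (elim t)
            have "Q (x t) i (m t i) \<le> Jopt i + \<alpha> * (\<epsilon> / 3)"
            proof (rule Q_upper)
              fix j assume "(i, j) \<in> E"
              then have "\<bar>x t j - Jopt j\<bar> \<le> \<epsilon> / 3" using elim by blast
              then show "x t j \<le> Jopt j + \<epsilon> / 3" by linarith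
            qed
            \<comment> \<open>At a successor, \<open>J (m t)\<close> exceeds \<open>Jopt\<close> by
              at most a third and \<open>x t\<close> falls short of it by at most a third, hence the
              two thirds.\<close>
            moreover have "Q (J (m t)) i (m t i) \<le> Q (x t) i (m t i) + \<alpha> * (2 * \<epsilon> / 3)"
            proof (rule Q_le_shift[OF u])
              fix j assume "0 < P i (m t i) j"
              then have "\<bar>x t j - Jopt j\<bar> \<le> \<epsilon> / 3" "J (m t) j \<le> Jopt j + \<epsilon> / 3"
                using elim edgeI[OF u] by blast+
              then show "J (m t) j \<le> x t j + 2 * \<epsilon> / 3" by linarith
            qed
            moreover have "\<alpha> * (\<epsilon> / 3) \<le> \<epsilon> / 3" "\<alpha> * (2 * \<epsilon> / 3) \<le> 2 * \<epsilon> / 3"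
              using alpha \<epsilon> by auto
            ultimately show ?case using J_Bellman[OF m, of t i] by linarith
          qed
        qed
      qed (rule conv_recurrent)
    qed
  qed
  then have "eventually (\<lambda>t. \<bar>x t i - Jopt i\<bar> \<le> \<epsilon> / 2) sequentially" if "0 < \<epsilon>" for \<epsilon>
    using half_gt_zero[OF that] unfolding conv_def by (blast intro: eventually_mono)
  then show ?thesis
    unfolding tendsto_iff dist_real_def by (force intro: eventually_mono)
qed

end

context opi
begin

lemma opiJ_bounds:
  assumes "\<omega> \<in> space M"
  shows "0 \<le> opiJ \<alpha> c \<beta> cnt (\<lambda>\<tau> k. X \<tau> k \<omega>) (\<lambda>\<tau>. mu \<tau> \<omega>) t i
    \<and> opiJ \<alpha> c \<beta> cnt (\<lambda>\<tau> k. X \<tau> k \<omega>) (\<lambda>\<tau>. mu \<tau> \<omega>) t i \<le> value_bound"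
proof (induction t)
  case (Suc t)
  let ?x = "opiJ \<alpha> c \<beta> cnt (\<lambda>\<tau> k. X \<tau> k \<omega>) (\<lambda>\<tau>. mu \<tau> \<omega>) t i"
  let ?y = "tail_cost \<alpha> c (traj t \<omega>) (mu t \<omega>) i"
  have y: "0 \<le> ?y" "?y \<le> value_bound" using tail_cost_bounds[OF mu_policy[OF assms]] by auto
  have s: "0 < step t i \<omega>" "step t i \<omega> \<le> 1" using step_range by auto
  have "(1 - step t i \<omega>) * ?x + step t i \<omega> * ?y \<le> (1 - step t i \<omega>) * value_bound + step t i \<omega> * value_bound"
    using s y Suc by (intro add_mono mult_left_mono) auto
  moreover have "0 \<le> (1 - step t i \<omega>) * ?x + step t i \<omega> * ?y"
    using s y Suc by (intro add_nonneg_nonneg mult_nonneg_nonneg) auto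
  ultimately show ?case using Suc by (simp add: algebra_simps)
qed (simp add: value_bound_nonneg)

text \<open>Under counting the step depends on the whole record of earlier visits, so agreement is
  assumed in every iteration.\<close>

lemma same_steps:
  assumes "\<And>t. visits (traj t \<omega>) i \<longleftrightarrow> visits (traj t \<omega>) j"
  shows "of_bool (visits (traj t \<omega>) i) * step t i \<omega> = of_bool (visits (traj t \<omega>) j) * step t j \<omega>"
  using assms by (simp add: step_size_def)

theorem opi_converges:
  "AE \<omega> in M. \<forall>i. (\<lambda>t. opiJ \<alpha> c \<beta> cnt (\<lambda>\<tau> k. X \<tau> k \<omega>) (\<lambda>\<tau>. mu \<tau> \<omega>) t i) \<longlonglongrightarrow> Jopt i"
proof -
  have noise: "AE \<omega> in M. \<forall>i. summable (\<lambda>t. step t i \<omega> * W t i \<omega>)"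
    unfolding AE_all_countable using noise_summable[where a = "\<lambda>_ _. 1"] by simp
  have P1: "\<bar>P i (mu t \<omega> i) j\<bar> \<le> 1" if "\<omega> \<in> space M" for t \<omega> i j
    using trans_nonneg[OF mu_in[OF that]] trans_sum[OF mu_in[OF that, of t i]]
      member_le_sum[of j UNIV "P i (mu t \<omega> i)"] by simp
  \<comment> \<open>The noise at a successor \<open>j\<close> enters the residual of
    \<open>i\<close> with a random coefficient that is determined by \<open>mu t\<close>, hence
    known before the trajectory.\<close>
  have noise_P: "AE \<omega> in M. \<forall>i j. summable (\<lambda>t. P i (mu t \<omega> i) j * (step t j \<omega> * W t j \<omega>))"
    unfolding AE_all_countable
    by (intro allI noise_summable P1 measurable_mu_fun G_mu order_refl)
  have "AE \<omega> in M. \<forall>i j. i \<notin> transient_states A P \<longrightarrow> (i, j) \<in> E \<longrightarrow> (\<forall>t. visits (traj t \<omega>) i \<longleftrightarrow> visits (traj t \<omega>) j)"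
    unfolding AE_all_countable
  proof (intro allI AE_impI)
    fix i j assume i: "i \<notin> transient_states A P" and ij: "(i, j) \<in> E"
    \<comment> \<open>Recurrence of \<open>i\<close> provides the way back, so visits transfer in
      both directions.\<close>
    have ji: "(j, i) \<in> E\<^sup>*" using i ij by (auto simp: transient_states_def)
    from recurrent_visits[OF i r_into_rtrancl[OF ij]] recurrent_visits[OF recurrent_step[OF i ij] ji]
    show "AE \<omega> in M. \<forall>t. visits (traj t \<omega>) i \<longleftrightarrow> visits (traj t \<omega>) j" by eventually_elim blast
  qed
  moreover have "AE \<omega> in M. \<forall>i. \<not> summable (\<lambda>t. of_bool (visits (traj t \<omega>) i) * step t i \<omega>)"
    unfolding AE_all_countable by (intro allI steps_diverge)
  ultimately show ?thesis
    using noise noise_P AE_space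
  proof eventually_elim
    case (elim \<omega>)
    note policy = mu_policy[OF elim(5)]
    show ?case
    proof
      fix i
      show "(\<lambda>t. opiJ \<alpha> c \<beta> cnt (\<lambda>\<tau> k. X \<tau> k \<omega>) (\<lambda>\<tau>. mu \<tau> \<omega>) t i) \<longlonglongrightarrow> Jopt i"
      \<comment> \<open>The indicator in \<open>g\<close> covers updated and skipped states by one
        formula; \<open>d\<close> carries none, as \<open>W\<close> vanishes without a
        visit.\<close>
      proof (rule pathwise_convergence[OF A3, where m = "\<lambda>t. mu t \<omega>" and b = value_bound
            and g = "\<lambda>t i. of_bool (visits (traj t \<omega>) i) * step t i \<omega>" and d = "\<lambda>t i. step t i \<omega> * W t i \<omega>"])
        show "opiJ \<alpha> c \<beta> cnt (\<lambda>\<tau> k. X \<tau> k \<omega>) (\<lambda>\<tau>. mu \<tau> \<omega>) (Suc t) i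
            = (1 - of_bool (visits (traj t \<omega>) i) * step t i \<omega>) * opiJ \<alpha> c \<beta> cnt (\<lambda>\<tau> k. X \<tau> k \<omega>) (\<lambda>\<tau>. mu \<tau> \<omega>) t i
              + of_bool (visits (traj t \<omega>) i) * step t i \<omega> * J (mu t \<omega>) i + step t i \<omega> * W t i \<omega>" for t i
          by (simp add: W_def noise_def algebra_simps)
        show "greedy A \<alpha> P c (opiJ \<alpha> c \<beta> cnt (\<lambda>\<tau> k. X \<tau> k \<omega>) (\<lambda>\<tau>. mu \<tau> \<omega>) t) (mu t \<omega>)" for t
          by (rule mu_greedy[OF elim(5)])
        show "0 \<le> of_bool (visits (traj t \<omega>) i) * step t i \<omega>"
          "of_bool (visits (traj t \<omega>) i) * step t i \<omega> \<le> 1" for t i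
          using step_range[where t = t and i = i and \<omega> = \<omega>] by auto
        show "\<not> summable (\<lambda>t. of_bool (visits (traj t \<omega>) i) * step t i \<omega>)" for i
          using elim(2) by blast
        show "summable (\<lambda>t. step t i \<omega> * W t i \<omega>)" for i using elim(3) by blast
        show "summable (\<lambda>t. P i (mu t \<omega> i) j * (step t j \<omega> * W t j \<omega>))" for i j using elim(4) by blast
        show "of_bool (visits (traj t \<omega>) i) * step t i \<omega> = of_bool (visits (traj t \<omega>) j) * step t j \<omega>"
          if "i \<notin> transient_states A P" "(i, j) \<in> E" for t i j
          using elim(1) that by (intro same_steps) blast
        show "opiJ \<alpha> c \<beta> cnt (\<lambda>\<tau> k. X \<tau> k \<omega>) (\<lambda>\<tau>. mu \<tau> \<omega>) t i \<le> value_bound" for t i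
          using opiJ_bounds[OF elim(5)] by blast
      qed
    qed
  qed
qed

end

theorem theorem1:
  fixes M :: "'w measure"
    and A :: "'s::finite \<Rightarrow> 'a set"
    and P :: "'s \<Rightarrow> 'a \<Rightarrow> 's \<Rightarrow> real"
    and c :: "'s \<Rightarrow> 'a \<Rightarrow> real"
    and \<alpha> :: real
    and p :: "'s \<Rightarrow> real"
    and \<beta> :: "nat \<Rightarrow> real"
    and cnt :: bool
    and X :: "nat \<Rightarrow> nat \<Rightarrow> 'w \<Rightarrow> 's"
    and mu :: "nat \<Rightarrow> 'w \<Rightarrow> ('s \<Rightarrow> 'a)"
  assumes alpha: "0 < \<alpha>" "\<alpha> < 1"
    and actions: "\<And>i. finite (A i)" "\<And>i. A i \<noteq> {}"
    and trans_nonneg: "\<And>i u j. u \<in> A i \<Longrightarrow> 0 \<le> P i u j"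
    and trans_sum: "\<And>i u. u \<in> A i \<Longrightarrow> (\<Sum>j\<in>UNIV. P i u j) = 1"
    and cost_nonneg: "\<And>i u. u \<in> A i \<Longrightarrow> 0 \<le> c i u"
    and p_nonneg: "\<And>i. 0 \<le> p i"
    and p_sum: "(\<Sum>i\<in>UNIV. p i) = 1"
    and A1: "\<And>m i. is_policy A m \<Longrightarrow> qvisit p P m i > 0"
    and A2: "\<And>i j u v. u \<in> A i \<Longrightarrow> v \<in> A i \<Longrightarrow> (P i u j > 0 \<longleftrightarrow> P i v j > 0)"
    and A3: "acyclic (reach_graph A P \<inter> (transient_states A P \<times> transient_states A P))"
    and beta_range: "\<And>t. 0 < \<beta> t \<and> \<beta> t \<le> 1"
    and beta_sum: "\<not> summable \<beta>"
    and beta_sq: "summable (\<lambda>t. (\<beta> t)\<^sup>2)"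
    and beta_mono: "\<exists>T0. \<forall>s t. T0 < s \<longrightarrow> s \<le> t \<longrightarrow> \<beta> t \<le> \<beta> s"
    and prob: "prob_space M"
    and X_meas: "\<And>t k. X t k \<in> measurable M (count_space UNIV)"
    and mu_meas: "\<And>t. mu t \<in> measurable M (count_space UNIV)"
    and mu_greedy: "\<And>t \<omega>. \<omega> \<in> space M \<Longrightarrow>
        greedy A \<alpha> P c (opiJ \<alpha> c \<beta> cnt (\<lambda>\<tau> k. X \<tau> k \<omega>) (\<lambda>\<tau>. mu \<tau> \<omega>) t) (mu t \<omega>)"
    and trajectory_law: "\<And>t K h m s.
        measure M {\<omega> \<in> space M. (\<forall>\<tau><t. \<forall>k\<le>K. X \<tau> k \<omega> = h \<tau> k)
                                \<and> (\<forall>\<tau>\<le>t. mu \<tau> \<omega> = m \<tau>)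
                                \<and> (\<forall>k\<le>K. X t k \<omega> = s k)}
        = measure M {\<omega> \<in> space M. (\<forall>\<tau><t. \<forall>k\<le>K. X \<tau> k \<omega> = h \<tau> k)
                                \<and> (\<forall>\<tau>\<le>t. mu \<tau> \<omega> = m \<tau>)}
          * (p (s 0) * (\<Prod>k<K. P (s k) (m t (s k)) (s (Suc k))))"
  shows "AE \<omega> in M. \<forall>i. (\<lambda>t. opiJ \<alpha> c \<beta> cnt (\<lambda>\<tau> k. X \<tau> k \<omega>) (\<lambda>\<tau>. mu \<tau> \<omega>) t i)
                          \<longlonglongrightarrow> Jstar A \<alpha> P c i"
proof -
  interpret prob_space M by (rule prob)
  interpret opi A P c \<alpha> M p \<beta> cnt X mu
    using assms by unfold_locales
  show ?thesis by (rule opi_converges)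
qed

end
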